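(* Let $f,a_1,\dots,a_m\in\mathbb{R}[x]_d$, $b=(b_1,\dots,b_m)\in\mathbb{R}^m$, $0\le m_1\le m$, and let $K=\{x\in\mathbb{R}^n: c_j(x)=0\ (j\in\mathcal{E}),\ c_j(x)\ge 0\ (j\in\mathcal{I})\}$ for given polynomials $c_j$ ($\mathcal{E},\mathcal{I}$ finite disjoint index sets), $c_{eq}=(c_j)_{j\in\mathcal{E}}$, $c_{in}=(c_j)_{j\in\mathcal{I}}$. Let problems (P), (D), $(P_k)$, $(D_k)$ and their optimal values $\phi^*,\vartheta^*,\phi_k,\vartheta_k$ be as defined in the context, and write $f_\theta=f-\sum_{i=1}^m\theta_i a_i$. Suppose that: (1) $\mathrm{Ideal}[c_{eq}]+\mathrm{QM}[c_{in}]$ is archimedean; (2) $\theta^*\in\mathbb{R}^m$ is a maximizer of (D), $y^*$ is a minimizer of (P) with $y^*\ne 0$, and there exists a feasible point $\bar\theta$ of (D) such that $f_{\bar\theta}\in \mathrm{int}(\mathscr{P}_d(K))$; (3) the LICQC, SCC and SOSC hold at every (global) minimizer of the polynomial optimization problem $$\min\ f_{\theta^*}(x)\quad\text{s.t.}\quad c_j(x)=0\ (j\in\mathcal{E}),\ c_j(x)\ge 0\ (j\in\mathcal{I}).$$ Then: (i) $\vartheta_k=\phi_k=\vartheta^*=\phi^*$ for all $k$ big enough. (ii) When $k$ is sufficiently large, every minimizer of the moment relaxation $(P_k)$ has a flat truncation.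
   Context: Notation. $\mathbb{R}[x]=\mathbb{R}[x_1,\dots,x_n]$; $\mathbb{R}[x]_d$ is the space of polynomials of degree at most $d$; $\mathbb{N}^n_d=\{\alpha\in\mathbb{N}^n:|\alpha|\le d\}$. For $p=\sum_{\alpha}p_\alpha x^\alpha\in\mathbb{R}[x]_d$ and $y\in\mathbb{R}^{\mathbb{N}^n_d}$ (a truncated multi-sequence), $\langle p,y\rangle=\sum_\alpha p_\alpha y_\alpha$. For $w\in\mathbb{R}^{\mathbb{N}^n_{2k}}$ and $p$ with $\deg p\le 2k$, $\langle p,w\rangle$ is defined in the same way. Cones. $\mathscr{P}_d(K)=\{p\in\mathbb{R}[x]_d: p\ge0\text{ on }K\}$, with interior taken in $\mathbb{R}[x]_d$. $\mathscr{R}_d(K)$ is the set of $y\in\mathbb{R}^{\mathbb{N}^n_d}$ for which there is a (nonnegative) Borel measure $\mu$ with $\mathrm{supp}(\mu)\subseteq K$ and $y_\alpha=\int x^\alpha\,d\mu$ for all $\alpha\in\mathbb{N}^n_d$. Ideals and quadratic modules. $\Sigma[x]$ is the set of sums of squares of polynomials, $\Sigma[x]_k=\Sigma[x]\cap\mathbb{R}[x]_k$. For a tuple $h=(h_1,\dots,h_t)$, $\mathrm{Ideal}[h]=\sum_i h_i\mathbb{R}[x]$ and $\mathrm{Ideal}[h]_k=\sum_i h_i\,\mathbb{R}[x]_{k-\deg h_i}$. For a tuple $g=(g_1,\dots,g_\ell)$, $\mathrm{QM}[g]=\Sigma[x]+\sum_i g_i\Sigma[x]$ and $\mathrm{QM}[g]_k=\Sigma[x]_k+\sum_i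 g_i\,\Sigma[x]_{k-\deg g_i}$. $\mathrm{Ideal}[h]+\mathrm{QM}[g]$ is archimedean if it contains $R-\|x\|^2$ for some $R>0$. Localizing objects. For $w\in\mathbb{R}^{\mathbb{N}^n_{2k}}$ and a polynomial $q$ with $\deg q\le 2k$: $L_q^{(k)}[w]$ is the symmetric matrix with $\mathrm{vec}(p)^TL_q^{(k)}[w]\mathrm{vec}(p)=\langle qp^2,w\rangle$ for all $p$ with $2\deg p\le 2k-\deg q$ ($\mathrm{vec}(p)$ is the coefficient vector); $M_k[w]=L_1^{(k)}[w]$; $\mathscr{V}_q^{(2k)}[w]$ is the vector with $\langle qp,w\rangle=(\mathscr{V}_q^{(2k)}[w])^T\mathrm{vec}(p)$ for all $p$ with $\deg p\le 2k-\deg q$. Problems (optimal values are infima/suprema). (P): $\min\langle f,y\rangle$ s.t. $\langle a_i,y\rangle=b_i$ ($1\le i\le m_1$), $\langle a_i,y\rangle\ge b_i$ ($m_1<i\le m$), $y\in\mathscr{R}_d(K)$; value $\phi^*$. (D): $\max\sum_{i=1}^m b_i\theta_i$ s.t. $f-\sum_i\theta_ia_i\in\mathscr{P}_d(K)$, $\theta\in\mathbb{R}^m$, $\theta_i\ge0$ ($m_1<i\le m$); value $\vartheta^*$. Let $d_K=\max_{j\in\mathcal{E}\cup\mathcal{I}}\lceil\deg(c_j)/2\rceil$ and $d_0=\max\{\lceil\deg(f)/2\rceil,d_K,\max_i\lceil\deg(a_i)/2\rceil\}$. For $k\ge d_0$: $(P_k)$: $\min\langle f,w\rangle$ s.t.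 $\langle a_i,w\rangle=b_i$ ($i\le m_1$), $\langle a_i,w\rangle\ge b_i$ ($m_1<i\le m$), $\mathscr{V}_{c_j}^{(2k)}[w]=0$ ($j\in\mathcal{E}$), $L_{c_j}^{(k)}[w]\succeq0$ ($j\in\mathcal{I}$), $M_k[w]\succeq0$, $w\in\mathbb{R}^{\mathbb{N}^n_{2k}}$; value $\phi_k$. $(D_k)$: $\max\sum_i b_i\theta_i$ s.t. $f-\sum_i\theta_ia_i\in\mathrm{Ideal}[c_{eq}]_{2k}+\mathrm{QM}[c_{in}]_{2k}$, $\theta\in\mathbb{R}^m$, $\theta_i\ge0$ ($m_1<i\le m$); value $\vartheta_k$. Flat truncation. $w\in\mathbb{R}^{\mathbb{N}^n_{2k}}$ has a flat truncation if there is an integer $t\in[d_0,k]$ with $\mathrm{rank}\,M_{t-d_K}[w|_{2t}]=\mathrm{rank}\,M_t[w|_{2t}]$, where $w|_{2t}$ is the restriction of $w$ to indices in $\mathbb{N}^n_{2t}$. Optimality conditions. For $\min F(x)$ s.t. $c_j(x)=0$ ($j\in\mathcal{E}$), $c_j(x)\ge0$ ($j\in\mathcal{I}$), and a minimizer $x^*$, let $J(x^* )=\{j\in\mathcal{E}\cup\mathcal{I}:c_j(x^* )=0\}$. LICQC: the gradients $\nabla c_j(x^* )$, $j\in J(x^* )$, are linearly independent; then there are (unique) multipliers $\lambda_j$ with $\nabla F(x^* )=\sum_{j\in\mathcal{E}\cup\mathcal{I}}\lambda_j\nabla c_j(x^* )$, and $\lambda_j\ge0$, $\lambda_jc_j(x^*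 )=0$ for $j\in\mathcal{I}$. SCC: $\lambda_j+c_j(x^* )>0$ for all $j\in\mathcal{I}$. SOSC: with $\mathscr{L}=F-\sum_{j}\lambda_jc_j$, $v^T\nabla^2\mathscr{L}(x^* )v>0$ for every nonzero $v\in\mathbb{R}^n$ with $v^T\nabla c_j(x^* )=0$ for all $j\in J(x^* )$. *)

theory Defs
  imports "HOL-Analysis.Analysis" "HOL-Analysis.Finite_Function_Topology"
begin

section \<open>Polynomials in finitely many real variables\<close>

text \<open>
  A polynomial in the variables indexed by the finite type 'n is a finitely supported map from
  exponents to real coefficients. The ring operations are those of the library's convolution
  algebra, and scalar multiplication and the norm (sum of the absolute values of the coefficients)
  are those of \<^theory>\<open>HOL-Analysis.Finite_Function_Topology\<close>.
\<close>

type_synonym 'n expo = "'n \<Rightarrow>\<^sub>0 nat"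
type_synonym 'n rpoly = "'n expo \<Rightarrow>\<^sub>0 real"

definition expo_size :: "'n::finite expo \<Rightarrow> nat" where
  "expo_size \<alpha> = (\<Sum>i\<in>UNIV. Poly_Mapping.lookup \<alpha> i)"

definition expos :: "nat \<Rightarrow> 'n::finite expo set" where
  "expos d = {\<alpha>. expo_size \<alpha> \<le> d}"

definition expo_eval :: "'n::finite expo \<Rightarrow> real^'n \<Rightarrow> real" where
  "expo_eval \<alpha> x = (\<Prod>i\<in>UNIV. (x $ i) ^ Poly_Mapping.lookup \<alpha> i)"

definition monomial :: "'n::finite expo \<Rightarrow> 'n rpoly" where
  "monomial \<alpha> = Poly_Mapping.single \<alpha> 1"

definition peval :: "'n::finite rpoly \<Rightarrow> real^'n \<Rightarrow> real" where
  "peval p x = (\<Sum>\<alpha>\<in>Poly_Mapping.keys p. Poly_Mapping.lookup p \<alpha> * expo_eval \<alpha> x)"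

text \<open>The zero polynomial gets degree 0.\<close>

definition deg :: "'n::finite rpoly \<Rightarrow> nat" where
  "deg p = Max (insert 0 (expo_size ` Poly_Mapping.keys p))"

definition half_deg :: "'n::finite rpoly \<Rightarrow> nat" where
  "half_deg p = nat \<lceil>real (deg p) / 2\<rceil>"

text \<open>
  The degree bound is an integer, so that the bounds \<open>k - deg h\<close> below are not truncated:
  for a negative bound the space is \<open>{0}\<close>.
\<close>

definition polys :: "int \<Rightarrow> 'n::finite rpoly set" where
  "polys d = {p. \<forall>\<alpha>\<in>Poly_Mapping.keys p. int (expo_size \<alpha>) \<le> d}"

definition pderiv_var :: "'n \<Rightarrow> 'n::finite rpoly \<Rightarrow> 'n rpoly" where
  "pderiv_var i p = (\<Sum>\<alpha>\<in>Poly_Mapping.keys p.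
     Poly_Mapping.single (\<alpha> - Poly_Mapping.single i 1)
       (Poly_Mapping.lookup p \<alpha> * real (Poly_Mapping.lookup \<alpha> i)))"

definition grad :: "'n::finite rpoly \<Rightarrow> real^'n \<Rightarrow> real^'n" where
  "grad p x = (\<chi> i. peval (pderiv_var i p) x)"

definition hessian :: "'n::finite rpoly \<Rightarrow> real^'n \<Rightarrow> real^'n^'n" where
  "hessian p x = (\<chi> i j. peval (pderiv_var i (pderiv_var j p)) x)"


section \<open>Ideals and quadratic modules\<close>

definition sos :: "'n::finite rpoly set" where
  "sos = {p. \<exists>(r::nat) q. p = (\<Sum>i<r. q i ^ 2)}"

definition ideal_gen :: "'j set \<Rightarrow> ('j \<Rightarrow> 'n::finite rpoly) \<Rightarrow> 'n rpoly set" where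
  "ideal_gen E h = {\<Sum>j\<in>E. h j * p j | p. True}"

definition ideal_trunc :: "'j set \<Rightarrow> ('j \<Rightarrow> 'n::finite rpoly) \<Rightarrow> nat \<Rightarrow> 'n rpoly set" where
  "ideal_trunc E h k =
     {\<Sum>j\<in>E. h j * p j | p. \<forall>j\<in>E. p j \<in> polys (int k - int (deg (h j)))}"

definition qmodule :: "'j set \<Rightarrow> ('j \<Rightarrow> 'n::finite rpoly) \<Rightarrow> 'n rpoly set" where
  "qmodule I g = {s0 + (\<Sum>j\<in>I. g j * s j) | s0 s. s0 \<in> sos \<and> (\<forall>j\<in>I. s j \<in> sos)}"

definition qmodule_trunc :: "'j set \<Rightarrow> ('j \<Rightarrow> 'n::finite rpoly) \<Rightarrow> nat \<Rightarrow> 'n rpoly set" where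
  "qmodule_trunc I g k =
     {s0 + (\<Sum>j\<in>I. g j * s j) | s0 s.
        s0 \<in> sos \<inter> polys (int k) \<and> (\<forall>j\<in>I. s j \<in> sos \<inter> polys (int k - int (deg (g j))))}"

definition sqnorm_poly :: "'n::finite rpoly" where
  "sqnorm_poly = (\<Sum>i\<in>UNIV. monomial (Poly_Mapping.single i 2))"

definition archimedean_sum :: "'n::finite rpoly set \<Rightarrow> 'n rpoly set \<Rightarrow> bool" where
  "archimedean_sum A Q \<longleftrightarrow>
     (\<exists>R>0. \<exists>p\<in>A. \<exists>q\<in>Q. Poly_Mapping.single 0 R - sqnorm_poly = p + q)"


section \<open>Truncated multi-sequences and localizing objects\<close>

text \<open>
  A truncated multi-sequence of degree \<open>d\<close> is a family indexed by \<open>expos d\<close>, represented by its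
  extension by 0 to all exponents.
\<close>

definition tms :: "nat \<Rightarrow> ('n::finite expo \<Rightarrow> real) set" where
  "tms d = {y. \<forall>\<alpha>. \<alpha> \<notin> expos d \<longrightarrow> y \<alpha> = 0}"

definition tms_restrict :: "nat \<Rightarrow> ('n::finite expo \<Rightarrow> real) \<Rightarrow> 'n expo \<Rightarrow> real" where
  "tms_restrict d w = (\<lambda>\<alpha>. if \<alpha> \<in> expos d then w \<alpha> else 0)"

definition pairing :: "'n::finite rpoly \<Rightarrow> ('n expo \<Rightarrow> real) \<Rightarrow> real" where
  "pairing p y = (\<Sum>\<alpha>\<in>Poly_Mapping.keys p. Poly_Mapping.lookup p \<alpha> * y \<alpha>)"

text \<open>
  Matrices and vectors indexed by exponents are functions together with the finite set of indices
  that are in use. For both localizing objects this index set depends on \<open>k\<close> and \<open>q\<close>,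
  whereas the entries depend only on \<open>q\<close> and \<open>w\<close>.
  The lemmas \<open>loc_matrix_quadratic_form\<close>, \<open>loc_matrix_unique\<close> and
  \<open>loc_vector_linear_form\<close> below show that they are the objects
  determined by \<open>vec(p)\<^sup>T L vec(p) = \<langle>q p\<^sup>2, w\<rangle>\<close> and
  \<open>V\<^sup>T vec(p) = \<langle>q p, w\<rangle>\<close>.
\<close>

definition loc_matrix_index :: "nat \<Rightarrow> 'n::finite rpoly \<Rightarrow> 'n expo set" where
  "loc_matrix_index k q = {\<alpha>. 2 * expo_size \<alpha> + deg q \<le> 2 * k}"

definition loc_matrix ::
  "'n::finite rpoly \<Rightarrow> ('n expo \<Rightarrow> real) \<Rightarrow> 'n expo \<Rightarrow> 'n expo \<Rightarrow> real" where
  "loc_matrix q w \<alpha> \<beta> = pairing (q * monomial (\<alpha> + \<beta>)) w"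

definition loc_vector_index :: "nat \<Rightarrow> 'n::finite rpoly \<Rightarrow> 'n expo set" where
  "loc_vector_index k q = {\<alpha>. expo_size \<alpha> + deg q \<le> 2 * k}"

definition loc_vector :: "'n::finite rpoly \<Rightarrow> ('n expo \<Rightarrow> real) \<Rightarrow> 'n expo \<Rightarrow> real" where
  "loc_vector q w \<alpha> = pairing (q * monomial \<alpha>) w"

definition psd_on :: "'a set \<Rightarrow> ('a \<Rightarrow> 'a \<Rightarrow> real) \<Rightarrow> bool" where
  "psd_on S A \<longleftrightarrow> (\<forall>\<alpha>\<in>S. \<forall>\<beta>\<in>S. A \<alpha> \<beta> = A \<beta> \<alpha>) \<and>
     (\<forall>u. 0 \<le> (\<Sum>\<alpha>\<in>S. \<Sum>\<beta>\<in>S. u \<alpha> * A \<alpha> \<beta> * u \<beta>))"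

text \<open>Row rank; the rows are vectors in the real vector space of finitely supported functions.\<close>

definition rank_on :: "'a set \<Rightarrow> ('a \<Rightarrow> 'a \<Rightarrow> real) \<Rightarrow> nat" where
  "rank_on S A = dim ((\<lambda>\<alpha>. \<Sum>\<beta>\<in>S. Poly_Mapping.single \<beta> (A \<alpha> \<beta>)) ` S)"

definition moment_rank :: "nat \<Rightarrow> ('n::finite expo \<Rightarrow> real) \<Rightarrow> nat" where
  "moment_rank s w = rank_on (loc_matrix_index s (1::'n rpoly)) (loc_matrix 1 w)"


section \<open>The cones\<close>

definition semialg :: "'j set \<Rightarrow> 'j set \<Rightarrow> ('j \<Rightarrow> 'n::finite rpoly) \<Rightarrow> (real^'n) set" where
  "semialg E I c = {x. (\<forall>j\<in>E. peval (c j) x = 0) \<and> (\<forall>j\<in>I. peval (c j) x \<ge> 0)}"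

definition nonneg_polys :: "nat \<Rightarrow> (real^'n) set \<Rightarrow> 'n::finite rpoly set" where
  "nonneg_polys d K = {p \<in> polys (int d). \<forall>x\<in>K. peval p x \<ge> 0}"

text \<open>
  The interior is relative to the finite-dimensional space of polynomials of degree at most \<open>d\<close>;
  all norms give the same topology there.
\<close>

definition int_nonneg_polys :: "nat \<Rightarrow> (real^'n) set \<Rightarrow> 'n::finite rpoly set" where
  "int_nonneg_polys d K = top_of_set (polys (int d)) interior_of nonneg_polys d K"

definition measure_support :: "'a::topological_space measure \<Rightarrow> 'a set" where
  "measure_support M = {x. \<forall>U. open U \<and> x \<in> U \<longrightarrow> emeasure M U > 0}"

text \<open>Integrability is explicit because the Bochner integral of a non-integrable function is 0.\<close>

definition moment_cone :: "nat \<Rightarrow> (real^'n) set \<Rightarrow> ('n::finite expo \<Rightarrow> real) set" where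
  "moment_cone d K = {y \<in> tms d. \<exists>M::(real^'n) measure.
     sets M = sets borel \<and> measure_support M \<subseteq> K \<and>
     (\<forall>\<alpha>\<in>expos d. integrable M (expo_eval \<alpha>) \<and> y \<alpha> = integral\<^sup>L M (expo_eval \<alpha>))}"


section \<open>The optimization problems\<close>

text \<open>
  The constraints are indexed by \<open>1..m\<close>; the values of \<open>a\<close>, \<open>b\<close> and
  \<open>\<theta>\<close> outside this range are never used.
\<close>

definition residual ::
  "'n::finite rpoly \<Rightarrow> (nat \<Rightarrow> 'n rpoly) \<Rightarrow> nat \<Rightarrow> (nat \<Rightarrow> real) \<Rightarrow> 'n rpoly" where
  "residual f a m \<theta> = f - (\<Sum>i=1..m. \<theta> i *\<^sub>R a i)"

definition linear_constraints ::
  "(nat \<Rightarrow> 'n::finite rpoly) \<Rightarrow> (nat \<Rightarrow> real) \<Rightarrow> nat \<Rightarrow> nat \<Rightarrow> ('n expo \<Rightarrow> real) \<Rightarrow> bool" where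
  "linear_constraints a b m1 m y \<longleftrightarrow>
     (\<forall>i\<in>{1..m1}. pairing (a i) y = b i) \<and> (\<forall>i\<in>{m1<..m}. pairing (a i) y \<ge> b i)"

definition P_feasible ::
  "(nat \<Rightarrow> 'n::finite rpoly) \<Rightarrow> (nat \<Rightarrow> real) \<Rightarrow> nat \<Rightarrow> nat \<Rightarrow> nat \<Rightarrow> (real^'n) set
     \<Rightarrow> ('n expo \<Rightarrow> real) set" where
  "P_feasible a b m1 m d K = {y \<in> moment_cone d K. linear_constraints a b m1 m y}"

definition D_feasible ::
  "'n::finite rpoly \<Rightarrow> (nat \<Rightarrow> 'n rpoly) \<Rightarrow> nat \<Rightarrow> nat \<Rightarrow> nat \<Rightarrow> (real^'n) set
     \<Rightarrow> (nat \<Rightarrow> real) set" where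
  "D_feasible f a m1 m d K =
     {\<theta>. residual f a m \<theta> \<in> nonneg_polys d K \<and> (\<forall>i\<in>{m1<..m}. \<theta> i \<ge> 0)}"

definition Pk_feasible ::
  "(nat \<Rightarrow> 'n::finite rpoly) \<Rightarrow> (nat \<Rightarrow> real) \<Rightarrow> nat \<Rightarrow> nat
     \<Rightarrow> 'j set \<Rightarrow> 'j set \<Rightarrow> ('j \<Rightarrow> 'n rpoly) \<Rightarrow> nat \<Rightarrow> ('n expo \<Rightarrow> real) set" where
  "Pk_feasible a b m1 m E I c k =
     {w \<in> tms (2 * k). linear_constraints a b m1 m w \<and>
        (\<forall>j\<in>E. \<forall>\<alpha>\<in>loc_vector_index k (c j). loc_vector (c j) w \<alpha> = 0) \<and>
        (\<forall>j\<in>I. psd_on (loc_matrix_index k (c j)) (loc_matrix (c j) w)) \<and>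
        psd_on (loc_matrix_index k (1::'n rpoly)) (loc_matrix 1 w)}"

definition Dk_feasible ::
  "'n::finite rpoly \<Rightarrow> (nat \<Rightarrow> 'n rpoly) \<Rightarrow> nat \<Rightarrow> nat
     \<Rightarrow> 'j set \<Rightarrow> 'j set \<Rightarrow> ('j \<Rightarrow> 'n rpoly) \<Rightarrow> nat \<Rightarrow> (nat \<Rightarrow> real) set" where
  "Dk_feasible f a m1 m E I c k =
     {\<theta>. (\<exists>p\<in>ideal_trunc E c (2 * k). \<exists>q\<in>qmodule_trunc I c (2 * k). residual f a m \<theta> = p + q) \<and>
         (\<forall>i\<in>{m1<..m}. \<theta> i \<ge> 0)}"

definition dual_objective :: "(nat \<Rightarrow> real) \<Rightarrow> nat \<Rightarrow> (nat \<Rightarrow> real) \<Rightarrow> real" where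
  "dual_objective b m \<theta> = (\<Sum>i=1..m. b i * \<theta> i)"

definition is_minimizer :: "('a \<Rightarrow> real) \<Rightarrow> 'a set \<Rightarrow> 'a \<Rightarrow> bool" where
  "is_minimizer F S x \<longleftrightarrow> x \<in> S \<and> (\<forall>z\<in>S. F x \<le> F z)"

definition is_maximizer :: "('a \<Rightarrow> real) \<Rightarrow> 'a set \<Rightarrow> 'a \<Rightarrow> bool" where
  "is_maximizer F S x \<longleftrightarrow> x \<in> S \<and> (\<forall>z\<in>S. F z \<le> F x)"

definition inf_value :: "('a \<Rightarrow> real) \<Rightarrow> 'a set \<Rightarrow> ereal" where
  "inf_value F S = (INF x\<in>S. ereal (F x))"

definition sup_value :: "('a \<Rightarrow> real) \<Rightarrow> 'a set \<Rightarrow> ereal" where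
  "sup_value F S = (SUP x\<in>S. ereal (F x))"

text \<open>The 0 only serves to give the empty maximum a value.\<close>

definition dK :: "'j set \<Rightarrow> ('j \<Rightarrow> 'n::finite rpoly) \<Rightarrow> nat" where
  "dK J c = Max (insert 0 ((\<lambda>j. half_deg (c j)) ` J))"

definition d0 ::
  "'n::finite rpoly \<Rightarrow> (nat \<Rightarrow> 'n rpoly) \<Rightarrow> nat \<Rightarrow> 'j set \<Rightarrow> ('j \<Rightarrow> 'n rpoly) \<Rightarrow> nat" where
  "d0 f a m J c = Max ({half_deg f, dK J c} \<union> (\<lambda>i. half_deg (a i)) ` {1..m})"

definition flat_truncation ::
  "nat \<Rightarrow> nat \<Rightarrow> nat \<Rightarrow> ('n::finite expo \<Rightarrow> real) \<Rightarrow> bool" where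
  "flat_truncation d_0 d_K k w \<longleftrightarrow>
     (\<exists>t\<in>{d_0..k}. moment_rank (t - d_K) (tms_restrict (2 * t) w)
                     = moment_rank t (tms_restrict (2 * t) w))"


section \<open>Optimality conditions\<close>

definition active_set ::
  "'j set \<Rightarrow> 'j set \<Rightarrow> ('j \<Rightarrow> 'n::finite rpoly) \<Rightarrow> real^'n \<Rightarrow> 'j set" where
  "active_set E I c x = {j \<in> E \<union> I. peval (c j) x = 0}"

text \<open>Injectivity is needed because the gradients must be independent as a family.\<close>

definition LICQC ::
  "'j set \<Rightarrow> 'j set \<Rightarrow> ('j \<Rightarrow> 'n::finite rpoly) \<Rightarrow> real^'n \<Rightarrow> bool" where
  "LICQC E I c x \<longleftrightarrow> inj_on (\<lambda>j. grad (c j) x) (active_set E I c x) \<and>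
     independent ((\<lambda>j. grad (c j) x) ` active_set E I c x)"

definition multipliers ::
  "'j set \<Rightarrow> 'j set \<Rightarrow> ('j \<Rightarrow> 'n::finite rpoly) \<Rightarrow> 'n rpoly \<Rightarrow> real^'n \<Rightarrow> ('j \<Rightarrow> real) \<Rightarrow> bool"
where
  "multipliers E I c F x l \<longleftrightarrow>
     grad F x = (\<Sum>j\<in>E \<union> I. l j *\<^sub>R grad (c j) x) \<and>
     (\<forall>j\<in>I. l j \<ge> 0 \<and> l j * peval (c j) x = 0)"

definition SCC :: "'j set \<Rightarrow> ('j \<Rightarrow> 'n::finite rpoly) \<Rightarrow> real^'n \<Rightarrow> ('j \<Rightarrow> real) \<Rightarrow> bool" where
  "SCC I c x l \<longleftrightarrow> (\<forall>j\<in>I. l j + peval (c j) x > 0)"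

definition SOSC ::
  "'j set \<Rightarrow> 'j set \<Rightarrow> ('j \<Rightarrow> 'n::finite rpoly) \<Rightarrow> 'n rpoly \<Rightarrow> real^'n \<Rightarrow> ('j \<Rightarrow> real) \<Rightarrow> bool"
where
  "SOSC E I c F x l \<longleftrightarrow>
     (\<forall>v. v \<noteq> 0 \<and> (\<forall>j\<in>active_set E I c x. v \<bullet> grad (c j) x = 0) \<longrightarrow>
        v \<bullet> (hessian (F - (\<Sum>j\<in>E \<union> I. l j *\<^sub>R c j)) x *v v) > 0)"

text \<open>
  By lemma \<open>multipliers_unique\<close> below, LICQC determines the multipliers on \<open>E \<union> I\<close>, so the
  existential quantifier refers to the unique multipliers of \<open>x\<close>.
\<close>

definition optimality_conditions ::
  "'j set \<Rightarrow> 'j set \<Rightarrow> ('j \<Rightarrow> 'n::finite rpoly) \<Rightarrow> 'n rpoly \<Rightarrow> real^'n \<Rightarrow> bool" where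
  "optimality_conditions E I c F x \<longleftrightarrow> LICQC E I c x \<and>
     (\<exists>l. multipliers E I c F x l \<and> SCC I c x l \<and> SOSC E I c F x l)"


section \<open>Basic facts relating the definitions to their usual characterizations\<close>

lemma expo_size_add: "expo_size (\<alpha> + \<beta>) = expo_size \<alpha> + expo_size \<beta>"
  by (simp add: expo_size_def lookup_add sum.distrib)

lemma finite_expos [simp]: "finite (expos d)"
proof -
  have "Poly_Mapping.lookup ` expos d \<subseteq> (UNIV :: 'a set) \<rightarrow>\<^sub>E {..d}"
  proof
    fix g assume "g \<in> Poly_Mapping.lookup ` (expos d :: 'a expo set)"
    then obtain \<alpha> where \<alpha>: "expo_size \<alpha> \<le> d" "g = Poly_Mapping.lookup \<alpha>"
      by (auto simp: expos_def)
    have "g i \<le> d" for i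
      using member_le_sum[of i UNIV "Poly_Mapping.lookup \<alpha>"] \<alpha> by (simp add: expo_size_def)
    then show "g \<in> UNIV \<rightarrow>\<^sub>E {..d}" by auto
  qed
  then have "finite (Poly_Mapping.lookup ` (expos d :: 'a expo set))"
    by (rule finite_subset) (simp add: finite_PiE)
  then show ?thesis
    by (rule finite_imageD) (auto intro: inj_onI poly_mapping_eqI)
qed

lemma finite_loc_matrix_index [simp]: "finite (loc_matrix_index k q)"
  by (rule finite_subset[OF _ finite_expos[of k]]) (auto simp: loc_matrix_index_def expos_def)

lemma finite_loc_vector_index [simp]: "finite (loc_vector_index k q)"
  by (rule finite_subset[OF _ finite_expos[of "2 * k"]])
     (auto simp: loc_vector_index_def expos_def)

lemma pairing_superset:
  assumes "finite A" "Poly_Mapping.keys p \<subseteq> A"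
  shows "pairing p y = (\<Sum>\<alpha>\<in>A. Poly_Mapping.lookup p \<alpha> * y \<alpha>)"
  unfolding pairing_def using assms
  by (intro sum.mono_neutral_left) (auto simp: in_keys_iff)

lemma pairing_add: "pairing (p + q) y = pairing p y + pairing q y"
proof -
  let ?A = "Poly_Mapping.keys p \<union> Poly_Mapping.keys q"
  have "Poly_Mapping.keys (p + q) \<subseteq> ?A" by (rule keys_add)
  then show ?thesis
    using pairing_superset[of ?A p y] pairing_superset[of ?A q y] pairing_superset[of ?A "p + q" y]
    by (simp add: lookup_add algebra_simps sum.distrib)
qed

lemma pairing_0 [simp]: "pairing 0 y = 0"
  by (simp add: pairing_def)

lemma pairing_sum: "pairing (\<Sum>i\<in>S. p i) y = (\<Sum>i\<in>S. pairing (p i) y)"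
  by (induction S rule: infinite_finite_induct) (auto simp: pairing_add)

lemma pairing_single: "pairing (Poly_Mapping.single \<alpha> r) y = r * y \<alpha>"
  by (cases "r = 0") (simp_all add: pairing_def)

lemma poly_as_sum:
  assumes "finite A" "Poly_Mapping.keys p \<subseteq> A"
  shows "p = (\<Sum>\<alpha>\<in>A. Poly_Mapping.single \<alpha> (Poly_Mapping.lookup p \<alpha>))"
proof (rule poly_mapping_eqI)
  fix \<beta>
  have "Poly_Mapping.lookup (\<Sum>\<alpha>\<in>A. Poly_Mapping.single \<alpha> (Poly_Mapping.lookup p \<alpha>)) \<beta>
          = (\<Sum>\<alpha>\<in>A. if \<alpha> = \<beta> then Poly_Mapping.lookup p \<beta> else 0)"
    by (auto simp: lookup_sum lookup_single when_def intro!: sum.cong)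
  also have "\<dots> = Poly_Mapping.lookup p \<beta>"
    using assms by (auto simp: in_keys_iff)
  finally show "Poly_Mapping.lookup p \<beta>
    = Poly_Mapping.lookup (\<Sum>\<alpha>\<in>A. Poly_Mapping.single \<alpha> (Poly_Mapping.lookup p \<alpha>)) \<beta>" by simp
qed

lemma pairing_mult_single:
  "pairing (q * Poly_Mapping.single \<alpha> r) w = r * pairing (q * monomial \<alpha>) w"
proof -
  have q: "q = (\<Sum>\<gamma>\<in>Poly_Mapping.keys q. Poly_Mapping.single \<gamma> (Poly_Mapping.lookup q \<gamma>))"
    by (rule poly_as_sum) auto
  have "pairing (q * Poly_Mapping.single \<alpha> s) w
          = (\<Sum>\<gamma>\<in>Poly_Mapping.keys q. Poly_Mapping.lookup q \<gamma> * s * w (\<gamma> + \<alpha>))" for s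
    by (subst q) (simp add: sum_distrib_right mult_single pairing_sum pairing_single)
  then show ?thesis
    by (simp add: monomial_def sum_distrib_left mult_ac)
qed

lemma loc_vector_linear_form:
  assumes "Poly_Mapping.keys p \<subseteq> loc_vector_index k q"
  shows "(\<Sum>\<alpha>\<in>loc_vector_index k q. loc_vector q w \<alpha> * Poly_Mapping.lookup p \<alpha>)
           = pairing (q * p) w"
proof -
  have p: "p = (\<Sum>\<alpha>\<in>loc_vector_index k q. Poly_Mapping.single \<alpha> (Poly_Mapping.lookup p \<alpha>))"
    using assms by (intro poly_as_sum) auto
  show ?thesis
    by (subst (2) p)
       (simp add: sum_distrib_left pairing_sum pairing_mult_single loc_vector_def mult_ac)
qed

lemma loc_matrix_bilinear_form:
  assumes "Poly_Mapping.keys p \<subseteq> loc_matrix_index k q" "Poly_Mapping.keys r \<subseteq> loc_matrix_index k q"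
  shows "(\<Sum>\<alpha>\<in>loc_matrix_index k q. \<Sum>\<beta>\<in>loc_matrix_index k q.
            Poly_Mapping.lookup p \<alpha> * loc_matrix q w \<alpha> \<beta> * Poly_Mapping.lookup r \<beta>)
           = pairing (q * (p * r)) w"
proof -
  let ?A = "loc_matrix_index k q"
  have p: "p = (\<Sum>\<alpha>\<in>?A. Poly_Mapping.single \<alpha> (Poly_Mapping.lookup p \<alpha>))"
    and r: "r = (\<Sum>\<alpha>\<in>?A. Poly_Mapping.single \<alpha> (Poly_Mapping.lookup r \<alpha>))"
    using assms by (intro poly_as_sum; simp)+
  have "p * r = (\<Sum>\<alpha>\<in>?A. \<Sum>\<beta>\<in>?A. Poly_Mapping.single (\<alpha> + \<beta>)
                   (Poly_Mapping.lookup p \<alpha> * Poly_Mapping.lookup r \<beta>))"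
    by (subst p, subst r) (simp add: sum_product mult_single)
  then show ?thesis
    by (simp add: sum_distrib_left pairing_sum pairing_mult_single loc_matrix_def mult_ac)
qed

lemma loc_matrix_quadratic_form:
  assumes "Poly_Mapping.keys p \<subseteq> loc_matrix_index k q"
  shows "(\<Sum>\<alpha>\<in>loc_matrix_index k q. \<Sum>\<beta>\<in>loc_matrix_index k q.
            Poly_Mapping.lookup p \<alpha> * loc_matrix q w \<alpha> \<beta> * Poly_Mapping.lookup p \<beta>)
           = pairing (q * p ^ 2) w"
  using loc_matrix_bilinear_form[OF assms assms] by (simp add: power2_eq_square)

lemma loc_matrix_symmetric: "loc_matrix q w \<alpha> \<beta> = loc_matrix q w \<beta> \<alpha>"
  by (simp add: loc_matrix_def add.commute)

lemma quadratic_form_pair: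
  fixes B :: "'a \<Rightarrow> 'a \<Rightarrow> real" and u :: "'a \<Rightarrow> real"
  assumes "finite S" "\<alpha> \<in> S" "\<beta> \<in> S" "\<alpha> \<noteq> \<beta>" "\<And>\<gamma>. \<gamma> \<noteq> \<alpha> \<Longrightarrow> \<gamma> \<noteq> \<beta> \<Longrightarrow> u \<gamma> = 0"
  shows "(\<Sum>\<gamma>\<in>S. \<Sum>\<delta>\<in>S. u \<gamma> * B \<gamma> \<delta> * u \<delta>)
           = u \<alpha> * B \<alpha> \<alpha> * u \<alpha> + u \<alpha> * B \<alpha> \<beta> * u \<beta> + u \<beta> * B \<beta> \<alpha> * u \<alpha> + u \<beta> * B \<beta> \<beta> * u \<beta>"
proof -
  have *: "(\<Sum>\<gamma>\<in>S. g \<gamma>) = g \<alpha> + g \<beta>" if "\<And>\<gamma>. \<gamma> \<noteq> \<alpha> \<Longrightarrow> \<gamma> \<noteq> \<beta> \<Longrightarrow> g \<gamma> = 0" for g :: "'a \<Rightarrow> real"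
  proof -
    have "(\<Sum>\<gamma>\<in>S. g \<gamma>) = (\<Sum>\<gamma>\<in>{\<alpha>, \<beta>}. g \<gamma>)"
      using assms that by (intro sum.mono_neutral_right) auto
    then show ?thesis using assms by simp
  qed
  show ?thesis
    using assms(5) by (simp add: * algebra_simps)
qed

lemma loc_matrix_unique:
  fixes B :: "'n::finite expo \<Rightarrow> 'n expo \<Rightarrow> real"
  assumes sym: "\<And>\<alpha> \<beta>. B \<alpha> \<beta> = B \<beta> \<alpha>"
    and form: "\<And>p. Poly_Mapping.keys p \<subseteq> loc_matrix_index k q \<Longrightarrow>
      (\<Sum>\<alpha>\<in>loc_matrix_index k q. \<Sum>\<beta>\<in>loc_matrix_index k q.
         Poly_Mapping.lookup p \<alpha> * B \<alpha> \<beta> * Poly_Mapping.lookup p \<beta>) = pairing (q * p ^ 2) w"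
    and \<alpha>: "\<alpha> \<in> loc_matrix_index k q" and \<beta>: "\<beta> \<in> loc_matrix_index k q"
  shows "B \<alpha> \<beta> = loc_matrix q w \<alpha> \<beta>"
proof -
  let ?A = "loc_matrix_index k q"
  let ?Q = "\<lambda>B u. \<Sum>\<alpha>\<in>?A. \<Sum>\<beta>\<in>?A. u \<alpha> * B \<alpha> \<beta> * u \<beta> :: real"
  have eq: "?Q B (Poly_Mapping.lookup p) = ?Q (loc_matrix q w) (Poly_Mapping.lookup p)"
    if "Poly_Mapping.keys p \<subseteq> ?A" for p :: "'n rpoly"
    using form[OF that] loc_matrix_quadratic_form[OF that, of w] by simp
  have sing: "?Q C (Poly_Mapping.lookup (Poly_Mapping.single \<gamma> 1)) = C \<gamma> \<gamma>"
    if "\<gamma> \<in> ?A" for \<gamma> and C :: "'n expo \<Rightarrow> 'n expo \<Rightarrow> real"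
  proof -
    have "?Q C (Poly_Mapping.lookup (Poly_Mapping.single \<gamma> 1))
            = (\<Sum>\<alpha>\<in>?A. \<Sum>\<beta>\<in>?A. if \<alpha> = \<gamma> then (if \<beta> = \<gamma> then C \<gamma> \<gamma> else 0) else 0)"
      by (intro sum.cong) (auto simp: lookup_single when_def)
    also have "\<dots> = (\<Sum>\<alpha>\<in>?A. if \<alpha> = \<gamma> then C \<gamma> \<gamma> else 0)"
      using that by (intro sum.cong) auto
    finally show ?thesis using that by simp
  qed
  have diag: "B \<gamma> \<gamma> = loc_matrix q w \<gamma> \<gamma>" if "\<gamma> \<in> ?A" for \<gamma>
    using eq[of "Poly_Mapping.single \<gamma> 1"] that sing[OF that] by simp
  show ?thesis
  proof (cases "\<alpha> = \<beta>")
    case False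
    let ?p = "Poly_Mapping.single \<alpha> 1 + Poly_Mapping.single \<beta> 1 :: 'n rpoly"
    have keys: "Poly_Mapping.keys ?p \<subseteq> ?A"
      using keys_add[of "Poly_Mapping.single \<alpha> (1::real)" "Poly_Mapping.single \<beta> 1"] \<alpha> \<beta> by auto
    have l: "Poly_Mapping.lookup ?p \<gamma> = (if \<gamma> = \<alpha> \<or> \<gamma> = \<beta> then 1 else 0)" for \<gamma>
      using False by (auto simp: lookup_add lookup_single when_def)
    have "?Q C (Poly_Mapping.lookup ?p) = C \<alpha> \<alpha> + C \<alpha> \<beta> + C \<beta> \<alpha> + C \<beta> \<beta>"
      for C :: "'n expo \<Rightarrow> 'n expo \<Rightarrow> real"
      using quadratic_form_pair[OF finite_loc_matrix_index \<alpha> \<beta> False,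
          of "Poly_Mapping.lookup ?p" C]
      by (simp add: l)
    from eq[OF keys, unfolded this] show ?thesis
      using diag[OF \<alpha>] diag[OF \<beta>] sym[of \<alpha> \<beta>] loc_matrix_symmetric[of q w \<alpha> \<beta>] by simp
  qed (use diag \<alpha> in simp)
qed

lemma peval_eq_pairing: "peval p x = pairing p (\<lambda>\<alpha>. expo_eval \<alpha> x)"
  by (simp add: peval_def pairing_def)

lemma peval_add: "peval (p + q) x = peval p x + peval q x"
  by (simp add: peval_eq_pairing pairing_add)

lemma expo_eval_add: "expo_eval (\<alpha> + \<beta>) x = expo_eval \<alpha> x * expo_eval \<beta> x"
  by (simp add: expo_eval_def lookup_add power_add prod.distrib)

lemma peval_mult: "peval (p * q) x = peval p x * peval q x"
proof -
  have p: "p = (\<Sum>\<gamma>\<in>Poly_Mapping.keys p. Poly_Mapping.single \<gamma> (Poly_Mapping.lookup p \<gamma>))"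
    and q: "q = (\<Sum>\<gamma>\<in>Poly_Mapping.keys q. Poly_Mapping.single \<gamma> (Poly_Mapping.lookup q \<gamma>))"
    by (rule poly_as_sum; simp)+
  have pq: "p * q = (\<Sum>\<alpha>\<in>Poly_Mapping.keys p. \<Sum>\<beta>\<in>Poly_Mapping.keys q.
      Poly_Mapping.single (\<alpha> + \<beta>) (Poly_Mapping.lookup p \<alpha> * Poly_Mapping.lookup q \<beta>))"
    by (subst p, subst q) (simp add: sum_product mult_single)
  show ?thesis
    unfolding peval_eq_pairing pq
    by (simp add: pairing_sum pairing_single expo_eval_add)
       (simp add: pairing_def sum_product mult_ac)
qed

lemma expo_eval_minus_single:
  "real (Poly_Mapping.lookup \<alpha> i) * expo_eval (\<alpha> - Poly_Mapping.single i 1) x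
     = real (Poly_Mapping.lookup \<alpha> i) * (x $ i) ^ (Poly_Mapping.lookup \<alpha> i - 1)
         * (\<Prod>j\<in>UNIV - {i}. (x $ j) ^ Poly_Mapping.lookup \<alpha> j)"
proof -
  have "expo_eval (\<alpha> - Poly_Mapping.single i 1) x
          = (x $ i) ^ (Poly_Mapping.lookup \<alpha> i - 1)
              * (\<Prod>j\<in>UNIV - {i}. (x $ j) ^ Poly_Mapping.lookup (\<alpha> - Poly_Mapping.single i 1) j)"
    unfolding expo_eval_def
    by (subst prod.remove[of _ i]) (auto simp: lookup_minus lookup_single)
  also have "(\<Prod>j\<in>UNIV - {i}. (x $ j) ^ Poly_Mapping.lookup (\<alpha> - Poly_Mapping.single i 1) j)
      = (\<Prod>j\<in>UNIV - {i}. (x $ j) ^ Poly_Mapping.lookup \<alpha> j)"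
    by (intro prod.cong) (auto simp: lookup_minus lookup_single when_def)
  finally show ?thesis by (simp add: mult_ac)
qed

lemma expo_eval_has_derivative:
  fixes \<alpha> :: "'a::finite expo"
  shows
  "(expo_eval \<alpha> has_derivative
     (\<lambda>v. \<Sum>i\<in>UNIV. v $ i * (real (Poly_Mapping.lookup \<alpha> i)
                               * expo_eval (\<alpha> - Poly_Mapping.single i 1) x))) (at x)"
proof -
  have "((\<lambda>x. (x $ i) ^ n) has_derivative (\<lambda>v. real n * (v $ i) * (x $ i) ^ (n - 1))) (at x)"
    for i and n :: nat and x :: "real^'a"
    by (rule derivative_eq_intros bounded_linear.has_derivative[OF bounded_linear_vec_nth]
        has_derivative_ident refl)+
  then have "((\<lambda>x. \<Prod>i\<in>UNIV. (x $ i) ^ Poly_Mapping.lookup \<alpha> i) has_derivative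
    (\<lambda>v. \<Sum>i\<in>UNIV. (real (Poly_Mapping.lookup \<alpha> i) * (v $ i)
            * (x $ i) ^ (Poly_Mapping.lookup \<alpha> i - 1))
          * (\<Prod>j\<in>UNIV - {i}. (x $ j) ^ Poly_Mapping.lookup \<alpha> j))) (at x)"
    by (intro has_derivative_prod) auto
  moreover have "expo_eval \<alpha> = (\<lambda>x. \<Prod>i\<in>UNIV. (x $ i) ^ Poly_Mapping.lookup \<alpha> i)"
    by (simp add: expo_eval_def fun_eq_iff)
  moreover have "(real (Poly_Mapping.lookup \<alpha> i) * (v $ i)
            * (x $ i) ^ (Poly_Mapping.lookup \<alpha> i - 1))
          * (\<Prod>j\<in>UNIV - {i}. (x $ j) ^ Poly_Mapping.lookup \<alpha> j)
      = v $ i * (real (Poly_Mapping.lookup \<alpha> i)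
          * expo_eval (\<alpha> - Poly_Mapping.single i 1) x)" for v :: "real^'a" and i
    by (subst expo_eval_minus_single) (simp add: mult_ac)
  ultimately show ?thesis
    by (simp only:)
qed

lemma grad_GDERIV: "GDERIV (peval p) x :> grad p x"
proof -
  have gr: "v \<bullet> grad p x = (\<Sum>\<alpha>\<in>Poly_Mapping.keys p. Poly_Mapping.lookup p \<alpha> *
      (\<Sum>i\<in>UNIV. v $ i * (real (Poly_Mapping.lookup \<alpha> i)
          * expo_eval (\<alpha> - Poly_Mapping.single i 1) x)))" for v
  proof -
    have "v \<bullet> grad p x = (\<Sum>i\<in>UNIV. \<Sum>\<alpha>\<in>Poly_Mapping.keys p. v $ i *
      (Poly_Mapping.lookup p \<alpha> * real (Poly_Mapping.lookup \<alpha> i)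
          * expo_eval (\<alpha> - Poly_Mapping.single i 1) x))"
      by (simp add: inner_vec_def grad_def pderiv_var_def peval_eq_pairing pairing_sum
          pairing_single sum_distrib_left)
    also have "\<dots> = (\<Sum>\<alpha>\<in>Poly_Mapping.keys p. \<Sum>i\<in>UNIV. v $ i *
      (Poly_Mapping.lookup p \<alpha> * real (Poly_Mapping.lookup \<alpha> i)
          * expo_eval (\<alpha> - Poly_Mapping.single i 1) x))"
      by (rule sum.swap)
    finally show ?thesis by (simp add: sum_distrib_left mult_ac)
  qed
  have "(peval p has_derivative (\<lambda>v. v \<bullet> grad p x)) (at x)"
    unfolding gr peval_def[abs_def]
    by (intro has_derivative_sum has_derivative_mult_right expo_eval_has_derivative)
  then show ?thesis
    by (simp add: gderiv_def)
qed

lemma multipliers_unique: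
  assumes fin: "finite E" "finite I"
    and lic: "LICQC E I c x" and x: "x \<in> semialg E I c"
    and l: "multipliers E I c F x l" and l': "multipliers E I c F x l'"
    and j: "j \<in> E \<union> I"
  shows "l j = l' j"
proof -
  let ?J = "active_set E I c x"
  have inactive: "l i = 0 \<and> l' i = 0" if "i \<in> E \<union> I - ?J" for i
    using that x l l' by (auto simp: active_set_def semialg_def multipliers_def)
  have restr: "(\<Sum>i\<in>E \<union> I. u i *\<^sub>R grad (c i) x) = (\<Sum>i\<in>?J. u i *\<^sub>R grad (c i) x)"
    if "\<forall>i\<in>E \<union> I - ?J. u i = 0" for u
    using fin that by (intro sum.mono_neutral_right) (auto simp: active_set_def)
  have "(\<Sum>i\<in>?J. l i *\<^sub>R grad (c i) x) = (\<Sum>i\<in>?J. l' i *\<^sub>R grad (c i) x)"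
    using l l' restr[of l] restr[of l'] inactive by (simp add: multipliers_def)
  then have 0: "(\<Sum>i\<in>?J. (l i - l' i) *\<^sub>R grad (c i) x) = 0"
    by (simp add: scaleR_left_diff_distrib sum_subtractf)
  have inj: "inj_on (\<lambda>j. grad (c j) x) ?J"
    and ind: "independent ((\<lambda>j. grad (c j) x) ` ?J)"
    using lic by (auto simp: LICQC_def)
  let ?h = "the_inv_into ?J (\<lambda>j. grad (c j) x)"
  have finJ: "finite ?J" using fin by (simp add: active_set_def)
  have "(\<Sum>v\<in>(\<lambda>j. grad (c j) x) ` ?J. (l (?h v) - l' (?h v)) *\<^sub>R v) = 0"
    using 0 by (simp add: sum.reindex[OF inj] the_inv_into_f_f[OF inj] cong: sum.cong)
  then have "l (?h v) - l' (?h v) = 0" if "v \<in> (\<lambda>j. grad (c j) x) ` ?J" for v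
    using independentD[OF ind finite_imageI[OF finJ] subset_refl, of "\<lambda>v. l (?h v) - l' (?h v)"]
      that by auto
  then have "l (?h (grad (c i) x)) - l' (?h (grad (c i) x)) = 0" if "i \<in> ?J" for i
    using that by blast
  then have "l i = l' i" if "i \<in> ?J" for i
    using that by (simp add: the_inv_into_f_f[OF inj])
  then show ?thesis using inactive j by (cases "j \<in> ?J") auto
qed

end

theory Submission
  imports Defs
begin

text \<open>
  Let \<open>F\<close> be the residual at \<open>\<theta>opt\<close>, \<open>M\<close> the sum of the ideal and the quadratic module, and
  \<open>Z\<close> the set of zeros of \<open>F\<close> on \<open>K\<close>. The heart of the matter is that
  \<open>F - \<eta> p\<^sup>2 \<in> M\<close> for some \<open>\<eta> > 0\<close> whenever \<open>p\<close> vanishes on \<open>Z\<close>.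

  The optimality conditions at \<open>v \<in> Z\<close> give \<open>S \<in> M\<close> such that \<open>F - S\<close> grows
  quadratically at \<open>v\<close> in all directions, not only along \<open>K\<close> (an augmented Lagrangian).
  Hence \<open>Z\<close> is finite, and multiplying by squares that peak at the points of \<open>Z\<close> makes
  one \<open>S\<close> work for all \<open>v\<close>, with \<open>F - S > 0\<close> on \<open>K - Z\<close>. Such an \<open>F - S\<close> lies in \<open>M\<close>:
  otherwise a maximal module over the squares separates it from \<open>M\<close> inside the ideal of all
  polynomials that are bounded by a fixed sum of squares \<open>u\<close> vanishing exactly on \<open>Z\<close>.
  The functional defined by this module is evaluation at a point of \<open>K - Z\<close>, up to a factor,
  or a nonnegative combination of second derivatives at a point of \<open>Z\<close>; both are positive
  on \<open>F - S\<close>. For \<open>Z = {}\<close> this is Putinar's theorem.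

  Strong duality between (P) and (D) then gives (i). For (ii), a minimizer \<open>w\<close> satisfies
  \<open>\<langle>F, w\<rangle> \<le> 0\<close>, so \<open>\<langle>p\<^sup>2, w\<rangle> = 0\<close> for any given \<open>p\<close> vanishing on \<open>Z\<close> once
  \<open>k\<close> is large. So modulo the kernel of the moment matrix every monomial of bounded degree is a
  combination of the Lagrange polynomials of \<open>Z\<close>, and the rank is at most \<open>card Z\<close>. Since it
  increases with the order, it is constant on one of \<open>card Z + 1\<close> consecutive steps of length
  \<open>d\<^sub>K\<close>.
\<close>

\<comment> \<open>Polynomials as a real algebra\<close>
section \<open>The real algebra of polynomials\<close>

\<comment> \<open>Since \<open>F\<close> vanishes on \<open>Z\<close>, separating \<open>F\<close>
  from \<open>M\<close> with the normalisation at 1 can end in evaluation at a point of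
  \<open>Z\<close>, which contradicts nothing. The element \<open>u\<close> vanishes there as well,
  so normalising at \<open>u\<close> keeps the second-order information that evaluation loses. The
  price: at a point of \<open>Z\<close> the functional pairs second-order coefficients with a
  positive semidefinite matrix of which nothing more is known. SOSC controls the Hessian of the
  Lagrangian only on the tangent space, so growth in the other directions has to be bought with an
  element \<open>S\<close> of \<open>M\<close>; strict complementarity lets squares pay for it.

  The stronger form with \<open>p\<close> comes almost for free, because quadratic growth absorbs a
  small multiple of the square of \<open>p\<close>, and it is what turns a bound on one number into
  kernel vectors of the moment matrix. The degree of its certificate depends on \<open>p\<close>, so
  only finitely many \<open>p\<close> may be used: the orders at which ranks are compared are fixed
  first, from \<open>card Z\<close> alone, and only then is \<open>k\<close> taken large.\<close>
alias lookup = Poly_Mapping.lookup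

lemma lookup_const_mult_left:
  fixes s :: "'a::monoid_add \<Rightarrow>\<^sub>0 'b::semiring_0"
  shows "lookup (Poly_Mapping.single 0 r * s) k = r * lookup s k"
proof -
  have "lookup (Poly_Mapping.single 0 r * s) k
      = Sum_any (\<lambda>l. lookup (Poly_Mapping.single 0 r) l
          * Sum_any (\<lambda>q. lookup s q when k = l + q))"
    by (simp add: times_poly_mapping.rep_eq prod_fun_def)
  also have "\<dots> = (\<Sum>l\<in>{0}. lookup (Poly_Mapping.single 0 r) l
          * Sum_any (\<lambda>q. lookup s q when k = l + q))"
    by (rule Sum_any.expand_superset) (auto simp: lookup_single when_def)
  also have "\<dots> = r * lookup s k"
    by (simp add: lookup_single)
  finally show ?thesis .
qed

lemma lookup_const_mult_right:
  fixes s :: "'a::monoid_add \<Rightarrow>\<^sub>0 'b::semiring_0"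
  shows "lookup (s * Poly_Mapping.single 0 r) k = lookup s k * r"
proof -
  have inner: "Sum_any (\<lambda>q. lookup (Poly_Mapping.single 0 r) q when k = l + q)
      = (r when k = l)" for l
  proof -
    have "Sum_any (\<lambda>q. lookup (Poly_Mapping.single 0 r) q when k = l + q)
        = (\<Sum>q\<in>{0}. lookup (Poly_Mapping.single 0 r) q when k = l + q)"
      by (rule Sum_any.expand_superset) (auto simp: lookup_single when_def)
    then show ?thesis by (simp add: lookup_single)
  qed
  have "lookup (s * Poly_Mapping.single 0 r) k
      = Sum_any (\<lambda>l. lookup s l * (r when k = l))"
    by (simp add: times_poly_mapping.rep_eq prod_fun_def inner)
  also have "\<dots> = (\<Sum>l\<in>{k}. lookup s l * (r when k = l))"
    by (rule Sum_any.expand_superset) (auto simp: when_def)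
  finally show ?thesis by simp
qed

lemma lookup_scaleR:
  "lookup (r *\<^sub>R s) k = r *\<^sub>R lookup (s :: 'a \<Rightarrow>\<^sub>0 'b::real_vector) k"
proof -
  have "finite {i. r *\<^sub>R lookup s i \<noteq> 0}"
    by (rule finite_subset[OF _ finite_keys[of s]]) (auto simp: in_keys_iff)
  then show ?thesis by (simp add: scaleR_poly_mapping_def lookup_Abs_poly_mapping)
qed

text \<open>Scaling is multiplication by a constant polynomial, from the left as well as from the
  right, which covers noncommutative coefficients too. With this instance \<open>of_real\<close>
  denotes constants, and the abstract results below apply to polynomials.\<close>

instance poly_mapping :: (monoid_add, real_algebra_1) real_algebra_1
proof
  fix r :: real and p q :: "'a \<Rightarrow>\<^sub>0 'b"
  have left: "r *\<^sub>R s = Poly_Mapping.single 0 (of_real r) * s" for s :: "'a \<Rightarrow>\<^sub>0 'b"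
    by (rule poly_mapping_eqI) (simp add: lookup_const_mult_left lookup_scaleR scaleR_conv_of_real)
  have right: "r *\<^sub>R s = s * Poly_Mapping.single 0 (of_real r)" for s :: "'a \<Rightarrow>\<^sub>0 'b"
    by (rule poly_mapping_eqI) (simp add: lookup_const_mult_right lookup_scaleR of_real_def)
  show "r *\<^sub>R p * q = r *\<^sub>R (p * q)" by (simp add: left mult.assoc)
  show "p * r *\<^sub>R q = r *\<^sub>R (p * q)" by (simp add: right mult.assoc)
qed

section \<open>Modules closed under squares and the ideal of bounded elements\<close>

section \<open>Modules over the squares\<close>

text \<open>Sums of squares in any commutative ring, in a form suited to induction;
  \<open>sos_eq_sosums\<close> identifies them with \<open>sos\<close>.\<close>

inductive_set sosums :: "'a::comm_ring_1 set" where
  zero: "0 \<in> sosums"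
| add_square: "s \<in> sosums \<Longrightarrow> a\<^sup>2 + s \<in> sosums"

lemma sosums_square: "a\<^sup>2 \<in> sosums"
  using sosums.add_square[OF sosums.zero, of a] by simp

lemma sosums_add: "s \<in> sosums \<Longrightarrow> t \<in> sosums \<Longrightarrow> s + t \<in> sosums"
  by (induction rule: sosums.induct) (auto simp: add.assoc intro: sosums.add_square)

lemma sosums_sum: "(\<And>i. i \<in> S \<Longrightarrow> s i \<in> sosums) \<Longrightarrow> sum s S \<in> sosums"
  by (induction S rule: infinite_finite_induct) (auto intro: sosums_add sosums.zero)

text \<open>A quadratic module that need not contain 1: the modules constructed later may lie inside
  a proper ideal.\<close>

locale square_module =
  fixes Q :: "'a::{comm_ring_1, real_algebra_1} set"
  assumes zero_mem: "0 \<in> Q"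
    and add_mem: "x \<in> Q \<Longrightarrow> y \<in> Q \<Longrightarrow> x + y \<in> Q"
    and square_mult_mem: "x \<in> Q \<Longrightarrow> a\<^sup>2 * x \<in> Q"
begin

lemma scaleR_mem: "0 \<le> r \<Longrightarrow> x \<in> Q \<Longrightarrow> r *\<^sub>R x \<in> Q"
  using square_mult_mem[of x "of_real (sqrt r)"]
  by (simp flip: of_real_power) (simp add: scaleR_conv_of_real)

lemma sosums_mult_mem: "s \<in> sosums \<Longrightarrow> x \<in> Q \<Longrightarrow> s * x \<in> Q"
  by (induction rule: sosums.induct) (auto simp: zero_mem distrib_right add_mem square_mult_mem)

lemma sum_mem: "(\<And>i. i \<in> S \<Longrightarrow> f i \<in> Q) \<Longrightarrow> sum f S \<in> Q"
  by (induction S rule: infinite_finite_induct) (auto intro: add_mem zero_mem)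

end

lemma sosums_mult_square: "s \<in> sosums \<Longrightarrow> a\<^sup>2 * s \<in> (sosums :: 'a::comm_ring_1 set)"
proof (induction rule: sosums.induct)
  case (add_square s b)
  then show ?case
    using sosums.add_square[of "a\<^sup>2 * s" "a * b"] by (simp add: distrib_left power_mult_distrib)
qed (simp add: sosums.zero)

text \<open>\<open>u\<close> takes over the part of the order unit 1; \<open>u = 1\<close> is the
  classical setting. Unlike 1 it may vanish at some points, and then only an ideal of elements is
  comparable with it.\<close>

locale archimedean_module = square_module M for M :: "'a::{comm_ring_1, real_algebra_1} set" +
  fixes u :: 'a
  assumes one_mem: "1 \<in> M"
    and arch: "\<exists>N. of_real N - a \<in> M"
    and u_sos: "u \<in> sosums"
begin

lemma sosums_subset: "s \<in> sosums \<Longrightarrow> s \<in> M"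
  using sosums_mult_mem[OF _ one_mem] by simp

lemma u_mem: "u \<in> M"
  by (rule sosums_subset[OF u_sos])

lemma u_mult_mem: "x \<in> M \<Longrightarrow> u * x \<in> M"
  by (rule sosums_mult_mem[OF u_sos])

definition bounded :: "'a set" where
  "bounded = {a. \<exists>N. N *\<^sub>R u + a \<in> M \<and> N *\<^sub>R u - a \<in> M}"

lemma bounded_mono: "r *\<^sub>R u + a \<in> M \<Longrightarrow> r \<le> s \<Longrightarrow> s *\<^sub>R u + a \<in> M"
  using add_mem[OF _ scaleR_mem[OF _ u_mem], of "r *\<^sub>R u + a" "s - r"]
  by (simp add: algebra_simps)

lemma boundedI: "r *\<^sub>R u + a \<in> M \<Longrightarrow> s *\<^sub>R u - a \<in> M \<Longrightarrow> a \<in> bounded"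
  unfolding bounded_def mem_Collect_eq
  by (rule exI[of _ "max r s"]) (use bounded_mono[of r a] bounded_mono[of s "-a"] in auto)

lemma bounded_zero: "0 \<in> bounded"
  by (rule boundedI[of 0 _ 0]) (simp_all add: zero_mem)

lemma bounded_u: "u \<in> bounded"
  by (rule boundedI[of 0 _ 1]) (simp_all add: zero_mem u_mem)

lemma bounded_minus: "a \<in> bounded \<Longrightarrow> - a \<in> bounded"
  by (auto simp: bounded_def)

lemma bounded_add:
  assumes "a \<in> bounded" "b \<in> bounded" shows "a + b \<in> bounded"
proof -
  obtain N K where N: "N *\<^sub>R u + a \<in> M" "N *\<^sub>R u - a \<in> M" "K *\<^sub>R u + b \<in> M" "K *\<^sub>R u - b \<in> M"
    using assms by (auto simp: bounded_def)
  show ?thesis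
    by (rule boundedI[of "N + K" _ "N + K"])
      (use add_mem[OF N(1,3)] add_mem[OF N(2,4)] in \<open>simp_all add: algebra_simps\<close>)
qed

lemma bounded_diff: "a \<in> bounded \<Longrightarrow> b \<in> bounded \<Longrightarrow> a - b \<in> bounded"
  using bounded_add[of a "- b"] bounded_minus[of b] by simp

text \<open>\<open>b\<^sup>2\<close> is at most a constant \<open>K\<close> modulo \<open>M\<close>,
  and \<open>K - b\<^sup>2\<close> may be multiplied by the sum of squares \<open>u\<close>. Passing
  to \<open>\<bar>N\<bar>\<close> allows this bound to be scaled.\<close>

lemma bounded_square_mult:
  assumes "a \<in> bounded" shows "b\<^sup>2 * a \<in> bounded"
proof -
  obtain N where N: "N *\<^sub>R u + a \<in> M" "N *\<^sub>R u - a \<in> M"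
    using assms by (auto simp: bounded_def)
  obtain K where "of_real K - b\<^sup>2 \<in> M" using arch by blast
  then have K: "K *\<^sub>R u - b\<^sup>2 * u \<in> M"
    using u_mult_mem[of "of_real K - b\<^sup>2"] by (simp add: algebra_simps scaleR_conv_of_real)
  have N': "\<bar>N\<bar> *\<^sub>R u + a \<in> M" "\<bar>N\<bar> *\<^sub>R u - a \<in> M"
    using bounded_mono[OF N(1)] bounded_mono[of N "-a"] N by auto
  have K': "(\<bar>N\<bar> * K) *\<^sub>R u - b\<^sup>2 * (\<bar>N\<bar> *\<^sub>R u) \<in> M"
    using scaleR_mem[OF _ K, of "\<bar>N\<bar>"] by (simp add: algebra_simps)
  show ?thesis
    by (rule boundedI[of "\<bar>N\<bar> * K" _ "\<bar>N\<bar> * K"])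
      (use add_mem[OF K' square_mult_mem[OF N'(1)], of b]
          add_mem[OF K' square_mult_mem[OF N'(2)], of b] in \<open>simp_all add: algebra_simps\<close>)
qed

lemma bounded_scaleR:
  assumes "a \<in> bounded" shows "r *\<^sub>R a \<in> bounded"
proof -
  have *: "s *\<^sub>R a \<in> bounded" if "0 \<le> s" for s
    using bounded_square_mult[OF assms, of "of_real (sqrt s)"] that
    by (simp flip: of_real_power) (simp add: scaleR_conv_of_real)
  show ?thesis
    using *[of r] bounded_minus[OF *[of "- r"]] by (cases "0 \<le> r") auto
qed

text \<open>Polarisation reduces a general factor to squares, so \<open>bounded\<close> is an
  ideal.\<close>

lemma bounded_mult:
  assumes "a \<in> bounded" shows "b * a \<in> bounded"
proof -
  have "b * a = (1/4) *\<^sub>R ((b + 1)\<^sup>2 * a - (b - 1)\<^sup>2 * a)"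
  proof -
    have "(b + 1)\<^sup>2 * a - (b - 1)\<^sup>2 * a = 4 * (b * a)"
      by (simp add: power2_eq_square algebra_simps)
    also have "\<dots> = 4 *\<^sub>R (b * a)" by (simp add: scaleR_conv_of_real)
    finally show ?thesis by simp
  qed
  then show ?thesis
    using assms by (auto intro!: bounded_scaleR bounded_diff bounded_square_mult)
qed

lemma bounded_sum: "(\<And>i. i \<in> S \<Longrightarrow> f i \<in> bounded) \<Longrightarrow> sum f S \<in> bounded"
  by (induction S rule: infinite_finite_induct) (auto intro: bounded_add bounded_zero)

text \<open>Add the two hypotheses and the square of \<open>g - h\<close> or of
  \<open>g + h\<close>. This brings products into the ideal although the factors themselves need not
  be \<open>u\<close>-bounded.\<close>

lemma bounded_product:
  assumes "u - g\<^sup>2 \<in> M" "u - h\<^sup>2 \<in> M"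
  shows "g * h \<in> bounded"
proof -
  have sq: "(x::'a)\<^sup>2 \<in> M" for x using square_mult_mem[OF one_mem, of x] by simp
  have 2: "2 *\<^sub>R u - 2 *\<^sub>R (g * h) \<in> M"
    using add_mem[OF add_mem[OF assms] sq[of "g - h"]]
    by (simp add: power2_eq_square algebra_simps scaleR_2)
  have 3: "2 *\<^sub>R u + 2 *\<^sub>R (g * h) \<in> M"
    using add_mem[OF add_mem[OF assms] sq[of "g + h"]]
    by (simp add: power2_eq_square algebra_simps scaleR_2)
  have "(1/2) *\<^sub>R (2 *\<^sub>R (g * h)) \<in> bounded"
    by (intro bounded_scaleR boundedI[OF 3 2])
  then show ?thesis by simp
qed

end

section \<open>The order functional of a total cone, and separation\<close>

section \<open>Total cones and separation\<close>

locale total_cone =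
  fixes Q J :: "'a::real_vector set" and u :: 'a
  assumes cone_zero: "0 \<in> Q" and cone_add: "x \<in> Q \<Longrightarrow> y \<in> Q \<Longrightarrow> x + y \<in> Q"
    and cone_scaleR: "0 \<le> r \<Longrightarrow> x \<in> Q \<Longrightarrow> r *\<^sub>R x \<in> Q"
    and subspace: "subspace J" and u_in: "u \<in> J" "u \<in> Q"
    and order_unit: "a \<in> J \<Longrightarrow> \<exists>N. a + N *\<^sub>R u \<in> Q \<and> N *\<^sub>R u - a \<in> Q"
    and total: "a \<in> J \<Longrightarrow> a \<in> Q \<or> - a \<in> Q"
    and proper: "- u \<notin> Q"
begin

lemma scaled_u_mem: "0 \<le> r \<Longrightarrow> r *\<^sub>R u \<in> Q"
  by (rule cone_scaleR[OF _ u_in(2)])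

lemma neg_scaled_u_not_mem: "r < 0 \<Longrightarrow> r *\<^sub>R u \<notin> Q"
  using cone_scaleR[of "- 1 / r" "r *\<^sub>R u"] proper by (auto simp: field_simps)

text \<open>The Dedekind cut of \<open>a\<close> in multiples of \<open>u\<close>. \<open>Q\<close>
  need not be closed, so \<open>val_lower\<close> and \<open>val_upper\<close> hold only off the
  cut, and additivity is proved up to an arbitrary positive error.\<close>

definition val :: "'a \<Rightarrow> real" where "val a = Sup {r. a - r *\<^sub>R u \<in> Q}"

lemma below_above_le:
  assumes "a - r *\<^sub>R u \<in> Q" "s *\<^sub>R u - a \<in> Q" shows "r \<le> s"
proof -
  have "(s - r) *\<^sub>R u \<in> Q" using cone_add[OF assms] by (simp add: algebra_simps)
  then show ?thesis using neg_scaled_u_not_mem[of "s - r"] by force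
qed

lemma val_lower:
  assumes a: "a \<in> J" and r: "r < val a" shows "a - r *\<^sub>R u \<in> Q"
proof -
  obtain N where N: "a + N *\<^sub>R u \<in> Q" using order_unit[OF a] by blast
  have "{r. a - r *\<^sub>R u \<in> Q} \<noteq> {}"
    using N by (auto intro!: exI[of _ "- N"])
  then obtain s where s: "a - s *\<^sub>R u \<in> Q" "r < s"
    using less_cSupD[OF _ r[unfolded val_def]] by auto
  then show ?thesis
    using cone_add[OF s(1) scaled_u_mem[of "s - r"]] by (simp add: algebra_simps)
qed

lemma val_ge:
  assumes a: "a \<in> J" and r: "a - r *\<^sub>R u \<in> Q" shows "r \<le> val a"
proof -
  obtain N where "N *\<^sub>R u - a \<in> Q" using order_unit[OF a] by blast
  then have "bdd_above {r. a - r *\<^sub>R u \<in> Q}"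
    by (intro bdd_aboveI[of _ N]) (auto intro: below_above_le)
  then show ?thesis unfolding val_def using r by (intro cSup_upper) auto
qed

lemma val_upper:
  assumes a: "a \<in> J" and r: "val a < r" shows "r *\<^sub>R u - a \<in> Q"
  using total[of "a - r *\<^sub>R u"] val_ge[OF a, of r] r
    subspace_diff[OF subspace a subspace_scale[OF subspace u_in(1)]]
  by auto

lemma val_le:
  assumes a: "a \<in> J" and r: "r *\<^sub>R u - a \<in> Q" shows "val a \<le> r"
proof (rule ccontr)
  assume "\<not> val a \<le> r"
  then obtain s where "r < s" "s < val a" using dense[of r "val a"] by auto
  then show False using below_above_le[OF val_lower[OF a] r, of s] by auto
qed

lemma val_add:
  assumes a: "a \<in> J" and b: "b \<in> J" shows "val (a + b) = val a + val b"
proof (rule antisym; rule field_le_epsilon)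
  note ab = subspace_add[OF subspace a b]
  fix e :: real assume e: "0 < e"
  have "(val a + val b + e) *\<^sub>R u - (a + b) \<in> Q"
    using cone_add[OF val_upper[OF a, of "val a + e/2"] val_upper[OF b, of "val b + e/2"]] e
    by (simp add: algebra_simps flip: scaleR_left_distrib)
  then show "val (a + b) \<le> val a + val b + e"
    by (rule val_le[OF ab])
  have "(a + b) - (val a + val b - e) *\<^sub>R u \<in> Q"
    using cone_add[OF val_lower[OF a, of "val a - e/2"] val_lower[OF b, of "val b - e/2"]] e
    by (simp add: algebra_simps flip: scaleR_left_distrib)
  then show "val a + val b \<le> val (a + b) + e"
    using val_ge[OF ab] by fastforce
qed

lemma val_zero: "val 0 = 0"
  using val_add[OF subspace_0[OF subspace] subspace_0[OF subspace]] by simp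

lemma val_minus: "a \<in> J \<Longrightarrow> val (- a) = - val a"
  using val_add[of a "- a"] subspace_neg[OF subspace, of a] val_zero by simp

lemma val_scaleR:
  assumes a: "a \<in> J" shows "val (r *\<^sub>R a) = r * val a"
proof -
  have *: "val (s *\<^sub>R a) = s * val a" if s: "0 < s" for s
  proof (rule antisym; rule field_le_epsilon)
    note sa = subspace_scale[OF subspace a, of s]
    fix e :: real assume e: "0 < e"
    have "s *\<^sub>R ((val a + e/s) *\<^sub>R u - a) \<in> Q"
      using s e by (intro cone_scaleR val_upper[OF a]) auto
    then show "val (s *\<^sub>R a) \<le> s * val a + e"
      using s by (intro val_le sa) (simp add: algebra_simps)
    have "s *\<^sub>R (a - (val a - e/s) *\<^sub>R u) \<in> Q"
      using s e by (intro cone_scaleR val_lower[OF a]) auto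
    then have "s *\<^sub>R a - (s * val a - e) *\<^sub>R u \<in> Q"
      using s by (simp add: algebra_simps)
    then show "s * val a \<le> val (s *\<^sub>R a) + e"
      using val_ge[OF sa] by fastforce
  qed
  show ?thesis
    using *[of r] *[of "- r"] val_zero val_minus[OF subspace_scale[OF subspace a], of r]
    by (cases r "0 :: real" rule: linorder_cases) auto
qed

lemma val_nonneg: "a \<in> Q \<Longrightarrow> a \<in> J \<Longrightarrow> 0 \<le> val a"
  using val_ge[of a 0] by simp

lemma val_u: "val u = 1"
  by (intro antisym val_le val_ge u_in) (simp_all add: cone_zero)

end

text \<open>A maximal cone that contains \<open>C\<close> and avoids \<open>- u\<close> is total,
  and its \<open>val\<close> is the functional. The order unit plays the part of an interior point
  in the Hahn-Banach theorem, so no topology is involved.\<close>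

theorem cone_separation:
  fixes C :: "'a::real_vector set"
  assumes zero: "0 \<in> C" and add: "\<And>x y. x \<in> C \<Longrightarrow> y \<in> C \<Longrightarrow> x + y \<in> C"
    and scale: "\<And>r x. 0 \<le> r \<Longrightarrow> x \<in> C \<Longrightarrow> r *\<^sub>R x \<in> C"
    and unit: "\<And>a. \<exists>N. a + N *\<^sub>R u \<in> C" and u: "u \<in> C" "- u \<notin> C"
  shows "\<exists>L. linear L \<and> (\<forall>x\<in>C. 0 \<le> L x) \<and> L u = (1::real)"
proof -
  define cone where "cone Q \<longleftrightarrow> (\<forall>x\<in>Q. \<forall>y\<in>Q. x + y \<in> Q) \<and> (\<forall>r\<ge>0. \<forall>x\<in>Q. r *\<^sub>R x \<in> Q)"
    for Q :: "'a set"
  define \<A> where "\<A> = {Q. cone Q \<and> C \<subseteq> Q \<and> - u \<notin> Q}"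
  have "\<exists>Q\<in>\<A>. \<forall>X\<in>\<A>. Q \<subseteq> X \<longrightarrow> X = Q"
  proof (rule subset_Zorn_nonempty)
    have "C \<in> \<A>" using add scale u by (auto simp: \<A>_def cone_def)
    then show "\<A> \<noteq> {}" by blast
  next
    fix \<C> assume \<C>: "\<C> \<noteq> {}" "subset.chain \<A> \<C>"
    then have sub: "\<And>Q. Q \<in> \<C> \<Longrightarrow> Q \<in> \<A>" and lin: "\<And>X Y. X \<in> \<C> \<Longrightarrow> Y \<in> \<C> \<Longrightarrow> X \<subseteq> Y \<or> Y \<subseteq> X"
      by (auto simp: subset_chain_def)
    have "x + y \<in> \<Union>\<C>" if xy: "x \<in> \<Union>\<C>" "y \<in> \<Union>\<C>" for x y
    proof -
      obtain X Y where "x \<in> X" "y \<in> Y" "X \<in> \<C>" "Y \<in> \<C>" using xy by blast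
      then obtain Z where Z: "Z \<in> \<C>" "x \<in> Z" "y \<in> Z" using lin[of X Y] by blast
      then have "cone Z" using sub[OF Z(1)] by (simp add: \<A>_def)
      then have "x + y \<in> Z" using Z(2,3) unfolding cone_def by blast
      then show ?thesis using Z(1) by blast
    qed
    moreover have "r *\<^sub>R x \<in> \<Union>\<C>" if xr: "x \<in> \<Union>\<C>" "0 \<le> r" for x r
    proof -
      obtain Z where Z: "Z \<in> \<C>" "x \<in> Z" using xr(1) by blast
      then have "cone Z" using sub[OF Z(1)] by (simp add: \<A>_def)
      then have "r *\<^sub>R x \<in> Z" using Z(2) xr(2) unfolding cone_def by blast
      then show ?thesis using Z(1) by blast
    qed
    ultimately have "cone (\<Union>\<C>)" unfolding cone_def by blast
    then show "\<Union>\<C> \<in> \<A>" using sub \<C>(1) by (fastforce simp: \<A>_def)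
  qed
  then obtain Q where Q: "Q \<in> \<A>" and max: "\<And>X. X \<in> \<A> \<Longrightarrow> Q \<subseteq> X \<Longrightarrow> X = Q" by blast
  have C_Q: "\<And>x. x \<in> C \<Longrightarrow> x \<in> Q" and u_Q: "- u \<notin> Q"
    and add_Q: "\<And>x y. x \<in> Q \<Longrightarrow> y \<in> Q \<Longrightarrow> x + y \<in> Q"
    and scale_Q: "\<And>r x. 0 \<le> r \<Longrightarrow> x \<in> Q \<Longrightarrow> r *\<^sub>R x \<in> Q"
    using Q by (auto simp: \<A>_def cone_def)
  have ext: "\<exists>q\<in>Q. \<exists>s\<ge>0. - u = q + s *\<^sub>R a" if a: "a \<notin> Q" for a
  proof (rule ccontr)
    assume no: "\<not> ?thesis"
    define X where "X = {q + s *\<^sub>R a | q s. q \<in> Q \<and> 0 \<le> s}"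
    have QX: "Q \<subseteq> X" unfolding X_def by (force intro: exI[of _ "0::real"])
    have "cone X"
      unfolding cone_def
    proof (intro conjI ballI allI impI)
      fix x y assume "x \<in> X" "y \<in> X"
      then obtain q s q' s' where "x = q + s *\<^sub>R a" "y = q' + s' *\<^sub>R a" "q \<in> Q" "q' \<in> Q" "0 \<le> s" "0 \<le> s'"
        unfolding X_def by blast
      then show "x + y \<in> X"
        unfolding X_def mem_Collect_eq
        by (intro exI[of _ "q + q'"] exI[of _ "s + s'"]) (auto simp: algebra_simps add_Q)
    next
      fix r :: real and x assume "0 \<le> r" "x \<in> X"
      then obtain q s where "x = q + s *\<^sub>R a" "q \<in> Q" "0 \<le> s" unfolding X_def by blast
      then show "r *\<^sub>R x \<in> X"
        unfolding X_def mem_Collect_eq using \<open>0 \<le> r\<close>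
        by (intro exI[of _ "r *\<^sub>R q"] exI[of _ "r * s"]) (auto simp: algebra_simps scale_Q)
    qed
    then have "X \<in> \<A>" using QX C_Q no by (auto simp: \<A>_def X_def)
    then have "X = Q" using max QX by blast
    moreover have "0 + 1 *\<^sub>R a \<in> X" unfolding X_def using C_Q[OF zero] zero_le_one by blast
    ultimately show False using a by simp
  qed
  interpret total_cone Q UNIV u
  proof
    show "0 \<in> Q" "u \<in> Q" "- u \<notin> Q" using C_Q zero u u_Q by auto
    show "x + y \<in> Q" if "x \<in> Q" "y \<in> Q" for x y using add_Q that .
    show "r *\<^sub>R x \<in> Q" if "0 \<le> r" "x \<in> Q" for r x using scale_Q that .
    show "\<exists>N. a + N *\<^sub>R u \<in> Q \<and> N *\<^sub>R u - a \<in> Q" for a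
    proof -
      obtain N K where N: "a + N *\<^sub>R u \<in> C" "- a + K *\<^sub>R u \<in> C" using unit by blast
      have mono: "x + max N K *\<^sub>R u \<in> Q" if "x + r *\<^sub>R u \<in> C" "r \<le> max N K" for x r
        using add[OF that(1) scale[OF _ u(1), of "max N K - r"]] that(2)
        by (intro C_Q) (simp add: algebra_simps)
      show ?thesis
        using mono[OF N(1)] mono[OF N(2)] by (intro exI[of _ "max N K"]) auto
    qed
    show "a \<in> Q \<or> - a \<in> Q" for a
    proof (rule ccontr)
      assume neither: "\<not> (a \<in> Q \<or> - a \<in> Q)"
      obtain q s where qs: "q \<in> Q" "0 \<le> s" "- u = q + s *\<^sub>R a"
        using ext[of a] neither by blast
      obtain q' s' where qs': "q' \<in> Q" "0 \<le> s'" "- u = q' + s' *\<^sub>R - a"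
        using ext[of "- a"] neither by blast
      have s: "0 < s" using qs u_Q by (cases "s = 0") auto
      \<comment> \<open>These weights cancel \<open>a\<close> between the two representations of
        \<open>- u\<close>. What remains is a negative multiple of \<open>u\<close> in
        \<open>Q\<close>, because \<open>s\<close> is positive.\<close>
      have "s' *\<^sub>R (q + s *\<^sub>R a) + s *\<^sub>R (q' + s' *\<^sub>R - a) = s' *\<^sub>R - u + s *\<^sub>R - u"
        using qs qs' by simp
      then have "s' *\<^sub>R q + s *\<^sub>R q' = (s' + s) *\<^sub>R - u"
        by (simp add: algebra_simps)
      moreover have "s' *\<^sub>R q + s *\<^sub>R q' \<in> Q"
        using qs qs' by (intro add_Q scale_Q)
      ultimately have "(s' + s) *\<^sub>R - u \<in> Q" by metis
      moreover have "0 \<le> 1 / (s' + s)" using s qs'(2) by simp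
      ultimately have "(1 / (s' + s)) *\<^sub>R ((s' + s) *\<^sub>R - u) \<in> Q" by (rule scale_Q[rotated])
      then show False using s qs'(2) u_Q by simp
    qed
  qed (simp_all add: subspace_UNIV)
  have "linear val" by (intro linearI) (simp_all add: val_add val_scaleR)
  moreover have "\<forall>x\<in>C. 0 \<le> val x" using C_Q by (auto intro: val_nonneg)
  ultimately show ?thesis using val_u by blast
qed

section \<open>Functionals on the bounded ideal and the membership criterion\<close>

section \<open>States on ideals of bounded elements\<close>

context archimedean_module
begin

text \<open>
  \<open>\<psi>\<close> is a real point of the algebra, and \<open>\<phi>\<close> a functional on the ideal \<open>bounded\<close> on which the algebra
  acts through \<open>\<psi>\<close>; the values of \<open>\<phi>\<close> outside the ideal are irrelevant.
\<close>

definition state :: "('a \<Rightarrow> real) \<Rightarrow> ('a \<Rightarrow> real) \<Rightarrow> bool" where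
  "state \<psi> \<phi> \<longleftrightarrow>
     (\<forall>a b. \<psi> (a + b) = \<psi> a + \<psi> b) \<and> (\<forall>a b. \<psi> (a * b) = \<psi> a * \<psi> b) \<and>
     (\<forall>r. \<psi> (of_real r) = r) \<and> (\<forall>a\<in>M. 0 \<le> \<psi> a) \<and>
     \<phi> u = 1 \<and> (\<forall>a\<in>bounded. \<forall>b\<in>bounded. \<phi> (a + b) = \<phi> a + \<phi> b) \<and>
     (\<forall>a\<in>bounded. \<forall>b. \<phi> (b * a) = \<psi> b * \<phi> a) \<and> (\<forall>a\<in>M \<inter> bounded. 0 \<le> \<phi> a)"

lemma square_module_bounded: "square_module (M \<inter> bounded)"
  by unfold_locales
    (auto intro: zero_mem add_mem square_mult_mem bounded_zero bounded_add bounded_square_mult)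

end

locale total_module = archimedean_module M u
  for M :: "'a::{comm_ring_1, real_algebra_1} set" and u +
  fixes Q
  assumes Q: "square_module Q" and M_sub_Q: "M \<inter> bounded \<subseteq> Q"
    and total_Q: "a \<in> bounded \<Longrightarrow> a \<in> Q \<or> - a \<in> Q"
    and proper_Q: "- u \<notin> Q"
begin

interpretation Q: square_module Q by (rule Q)

lemma bounded_cases:
  assumes "a \<in> bounded"
  shows "\<exists>N. a + N *\<^sub>R u \<in> Q \<and> N *\<^sub>R u - a \<in> Q"
proof -
  obtain N where N: "N *\<^sub>R u + a \<in> M" "N *\<^sub>R u - a \<in> M"
    using assms by (auto simp: bounded_def)
  moreover have "N *\<^sub>R u + a \<in> bounded" "N *\<^sub>R u - a \<in> bounded"
    using assms by (auto intro: bounded_add bounded_diff bounded_scaleR bounded_u)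
  ultimately show ?thesis
    using M_sub_Q by (intro exI[of _ N]) (auto simp: add.commute)
qed

sublocale total_cone Q bounded u
proof
  show "u \<in> Q" using M_sub_Q u_mem bounded_u by blast
  show "subspace bounded"
    by (intro subspaceI bounded_zero bounded_add bounded_scaleR)
qed (auto simp: Q.zero_mem Q.add_mem Q.scaleR_mem bounded_u bounded_cases total_Q proper_Q)

text \<open>If the algebra is to act on \<open>val\<close> through a character, then looking at
  \<open>u\<close>, where \<open>val\<close> is 1, forces this formula.\<close>

definition chi :: "'a \<Rightarrow> real" where "chi b = val (b * u)"

lemma mult_u_bounded: "b * u \<in> bounded"
  by (rule bounded_mult[OF bounded_u])

text \<open>From \<open>b\<close> between \<open>- e\<close> and \<open>e\<close> one would like to
  multiply inequalities, but \<open>Q\<close> is closed only under multiplication by squares. The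
  combination with the weights \<open>(of_real e - b)\<^sup>2\<close> and
  \<open>(of_real e + b)\<^sup>2\<close> is the substitute.\<close>

lemma val_null_square:
  assumes b: "chi b = 0" shows "val (b\<^sup>2 * u) = 0"
proof (rule antisym)
  have bd: "e *\<^sub>R u + b * u \<in> bounded" "e *\<^sub>R u - b * u \<in> bounded" for e
    by (auto intro: bounded_add bounded_diff bounded_scaleR bounded_u mult_u_bounded)
  show "val (b\<^sup>2 * u) \<le> 0"
  proof (rule field_le_epsilon)
    fix d :: real assume "0 < d"
    define e where "e = sqrt d"
    have e: "0 < e" "e\<^sup>2 = d" using \<open>0 < d\<close> by (auto simp: e_def)
    have vb: "val (b * u) = 0" using b by (simp add: chi_def)
    have p: "e *\<^sub>R u + b * u \<in> Q"
      using val_lower[OF mult_u_bounded, of "- e" b] vb e by (simp add: add.commute)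
    have m: "e *\<^sub>R u - b * u \<in> Q"
      using val_upper[OF mult_u_bounded, of b e] vb e by simp
    have "(1 / (2 * e)) *\<^sub>R ((of_real e - b)\<^sup>2 * (e *\<^sub>R u + b * u) + (of_real e + b)\<^sup>2 * (e *\<^sub>R u - b * u)) \<in> Q"
      using e by (intro Q.scaleR_mem Q.add_mem Q.square_mult_mem p m) simp
    also have "(of_real e - b)\<^sup>2 * (e *\<^sub>R u + b * u) + (of_real e + b)\<^sup>2 * (e *\<^sub>R u - b * u)
        = (2 * e) *\<^sub>R (e\<^sup>2 *\<^sub>R u - b\<^sup>2 * u)"
      by (simp add: scaleR_conv_of_real power2_eq_square algebra_simps)
    finally have "e\<^sup>2 *\<^sub>R u - b\<^sup>2 * u \<in> Q" using e(1) by simp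
    then show "val (b\<^sup>2 * u) \<le> 0 + d"
      using e by (intro val_le mult_u_bounded) simp
  qed
  show "0 \<le> val (b\<^sup>2 * u)"
    using M_sub_Q square_mult_mem[OF u_mem, of b] mult_u_bounded by (intro val_nonneg) auto
qed

text \<open>A Cauchy-Schwarz argument: \<open>val\<close> is 0 at \<open>b\<^sup>2 * a\<close> and
  \<open>b\<^sup>2 * u\<close>, so its nonnegative value at
  \<open>(of_real t + b)\<^sup>2 * (a + N *\<^sub>R u)\<close> has no constant term in
  \<open>t\<close>, and the linear coefficient must vanish.\<close>

lemma val_null_mult:
  assumes b: "chi b = 0" and a: "a \<in> bounded" shows "val (b * a) = 0"
proof -
  obtain N where N: "a + N *\<^sub>R u \<in> Q" "N *\<^sub>R u - a \<in> Q" using bounded_cases[OF a] by blast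
  have bb: "b\<^sup>2 * a \<in> bounded" "b * a \<in> bounded" by (auto intro: bounded_mult a)
  have sq0: "val (b\<^sup>2 * a) = 0"
  proof -
    have "0 \<le> val (b\<^sup>2 * (a + N *\<^sub>R u))" "0 \<le> val (b\<^sup>2 * (N *\<^sub>R u - a))"
      using N a by (auto intro!: val_nonneg Q.square_mult_mem bounded_mult bounded_add bounded_diff
          bounded_scaleR bounded_u)
    moreover have "val (b\<^sup>2 * (a + N *\<^sub>R u)) = val (b\<^sup>2 * a)"
      using val_add[OF bb(1) bounded_scaleR[OF mult_u_bounded, of N "b\<^sup>2"]] val_null_square[OF b]
        val_scaleR[OF mult_u_bounded, of N "b\<^sup>2"] by (simp add: algebra_simps)
    moreover have "val (b\<^sup>2 * (N *\<^sub>R u - a)) = - val (b\<^sup>2 * a)"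
      using val_add[OF bounded_minus[OF bb(1)] bounded_scaleR[OF mult_u_bounded, of N "b\<^sup>2"]]
        val_null_square[OF b] val_minus[OF bb(1)]
        val_scaleR[OF mult_u_bounded, of N "b\<^sup>2"] by (simp add: algebra_simps)
    ultimately show ?thesis by simp
  qed
  define y where "y = val (b * a)"
  define z where "z = N + val a"
  have quad: "0 \<le> t\<^sup>2 * z + 2 * t * y" for t
  proof -
    have "(of_real t + b)\<^sup>2 * (a + N *\<^sub>R u)
       = t\<^sup>2 *\<^sub>R (a + N *\<^sub>R u) + ((2 * t) *\<^sub>R (b * a) + ((2 * t * N) *\<^sub>R (b * u) +
           (b\<^sup>2 * a + N *\<^sub>R (b\<^sup>2 * u))))"
      by (simp add: scaleR_conv_of_real power2_eq_square algebra_simps)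
    moreover have "val \<dots> = t\<^sup>2 * z + 2 * t * y"
      using a bb b sq0 val_null_square[OF b]
      by (simp add: val_add val_scaleR val_u bounded_add bounded_scaleR bounded_u mult_u_bounded
          chi_def y_def z_def)
    moreover have "0 \<le> val ((of_real t + b)\<^sup>2 * (a + N *\<^sub>R u))"
      using N a by (auto intro!: val_nonneg Q.square_mult_mem bounded_mult bounded_add
          bounded_scaleR bounded_u)
    ultimately show ?thesis by simp
  qed
  have "0 \<le> z" using quad[of 1] quad[of "-1"] by simp
  \<comment> \<open>The minimiser of the quadratic with leading coefficient \<open>z + 1\<close>
    instead of \<open>z\<close>, so that \<open>z = 0\<close> needs no separate case.\<close>
  define t where "t = - y / (z + 1)"
  have t: "(z + 1) * t = - y" using \<open>0 \<le> z\<close> by (simp add: t_def)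
  have "0 \<le> (z + 1)\<^sup>2 * (t\<^sup>2 * z + 2 * t * y)"
    by (intro mult_nonneg_nonneg quad) simp
  also have "\<dots> = ((z + 1) * t)\<^sup>2 * z + 2 * (z + 1) * ((z + 1) * t) * y"
    by (simp add: power2_eq_square algebra_simps)
  also have "\<dots> = - (y\<^sup>2 * (z + 2))"
    unfolding t by (simp add: power2_eq_square algebra_simps)
  finally have "y\<^sup>2 * (z + 2) \<le> 0" by simp
  then have "y\<^sup>2 \<le> 0" using \<open>0 \<le> z\<close> by (simp add: mult_le_0_iff)
  then show ?thesis by (simp add: y_def)
qed

lemma chi_of_real: "chi (of_real r) = r"
  using val_scaleR[OF bounded_u, of r] by (simp add: chi_def val_u scaleR_conv_of_real)

lemma chi_add: "chi (a + b) = chi a + chi b"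
  by (simp add: chi_def distrib_right val_add mult_u_bounded)

text \<open>Subtracting the constant \<open>chi b\<close> from \<open>b\<close> reduces this to
  \<open>val_null_mult\<close>.\<close>

lemma val_mult:
  assumes a: "a \<in> bounded" shows "val (b * a) = chi b * val a"
proof -
  have "chi (b + of_real (- chi b)) = 0"
    unfolding chi_add chi_of_real by simp
  from val_null_mult[OF this a]
  have "val (b * a + (- chi b) *\<^sub>R a) = 0" by (simp add: algebra_simps scaleR_conv_of_real)
  then show ?thesis
    using a by (subst (asm) val_add) (auto simp: bounded_mult bounded_scaleR val_scaleR bounded_minus val_minus)
qed

lemma state_chi_val: "state chi val"
proof -
  have "chi (a * b) = chi a * chi b" for a b
    using val_mult[OF mult_u_bounded, of a b] by (simp add: chi_def mult.assoc)
  moreover have "0 \<le> chi a" if "a \<in> M" for a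
    using u_mult_mem[OF that] M_sub_Q mult_u_bounded[of a]
    by (auto simp: chi_def mult.commute intro!: val_nonneg)
  moreover have "0 \<le> val a" if "a \<in> M \<inter> bounded" for a
    using M_sub_Q that by (intro val_nonneg) auto
  ultimately show ?thesis
    by (simp add: state_def chi_add chi_of_real val_u val_add val_mult)
qed

end

context archimedean_module
begin

text \<open>If \<open>G\<close> were outside \<open>M\<close>, every \<open>r\<close> with
  \<open>r *\<^sub>R u + G \<in> M\<close> would be nonnegative, yet each could be lowered by the
  fixed amount \<open>1/k\<^sup>2\<close>, which is impossible close to the infimum. The lemma later
  keeps \<open>- u\<close> out of the module generated by \<open>M \<inter> bounded\<close> and
  \<open>- G\<close>.\<close>

lemma mem_if_multiple_ge_u:
  assumes G: "G \<in> bounded" and \<sigma>: "\<sigma> \<in> sosums" "\<sigma> * G - u \<in> M"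
  shows "G \<in> M"
proof (rule ccontr)
  assume nG: "G \<notin> M"
  obtain N1 where "of_real N1 - \<sigma> \<in> M" using arch by blast
  then have N1: "N1 *\<^sub>R u + - (\<sigma> * u) \<in> M"
    using u_mult_mem[of "of_real N1 - \<sigma>"] by (simp add: algebra_simps scaleR_conv_of_real)
  have "\<sigma> * (\<sigma> * G) \<in> bounded" by (intro bounded_mult G)
  then obtain N2 where N2: "N2 *\<^sub>R u + - (\<sigma> * (\<sigma> * G)) \<in> M" by (auto simp: bounded_def)
  \<comment> \<open>Large enough for \<open>2 * k\<close> times \<open>u\<close> to dominate
    \<open>\<sigma> * u\<close>, and for \<open>2 * k - 1\<close> times \<open>u\<close> to dominate
    \<open>\<sigma> * (\<sigma> * G)\<close>.\<close>
  define k where "k = max 1 (max N1 (N2 + 1))"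
  have k: "1 \<le> k" "N1 \<le> 2 * k" "N2 \<le> 2 * k - 1"
  proof -
    have "1 \<le> k" "N1 \<le> k" "N2 + 1 \<le> k" by (auto simp: k_def)
    then show "1 \<le> k" "N1 \<le> 2 * k" "N2 \<le> 2 * k - 1" by linarith+
  qed
  have step: "(r - 1/k\<^sup>2) *\<^sub>R u + G \<in> M" if r: "0 \<le> r" "r *\<^sub>R u + G \<in> M" for r
  proof -
    have t: "(of_real k - \<sigma>)\<^sup>2 * (r *\<^sub>R u + G) \<in> M" "(2 * k) *\<^sub>R (\<sigma> * G - u) \<in> M"
      "r *\<^sub>R (\<sigma> * ((2 * k) *\<^sub>R u + - (\<sigma> * u))) \<in> M"
      "(2 * k - 1) *\<^sub>R u + - (\<sigma> * (\<sigma> * G)) \<in> M"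
      using r k \<sigma> bounded_mono[OF N1, of "2 * k"] bounded_mono[OF N2, of "2 * k - 1"]
      by (simp_all only: square_mult_mem scaleR_mem sosums_mult_mem)
    \<comment> \<open>The last three terms cancel everything in the expanded square that involves
      \<sigma>. The surplus is one copy of \<open>- u\<close>, which is the gain.\<close>
    have "(of_real k - \<sigma>)\<^sup>2 * (r *\<^sub>R u + G) + ((2 * k) *\<^sub>R (\<sigma> * G - u)
        + (r *\<^sub>R (\<sigma> * ((2 * k) *\<^sub>R u + - (\<sigma> * u))) + ((2 * k - 1) *\<^sub>R u + - (\<sigma> * (\<sigma> * G))))) \<in> M"
      by (intro add_mem[OF t(1) add_mem[OF t(2) add_mem[OF t(3) t(4)]]])
    also have "(of_real k - \<sigma>)\<^sup>2 * (r *\<^sub>R u + G) + ((2 * k) *\<^sub>R (\<sigma> * G - u)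
        + (r *\<^sub>R (\<sigma> * ((2 * k) *\<^sub>R u + - (\<sigma> * u))) + ((2 * k - 1) *\<^sub>R u + - (\<sigma> * (\<sigma> * G)))))
        = k\<^sup>2 *\<^sub>R ((r - 1/k\<^sup>2) *\<^sub>R u + G)"
      using k(1) by (simp add: scaleR_conv_of_real power2_eq_square algebra_simps)
        (simp flip: of_real_mult)
    finally have "(1/k\<^sup>2) *\<^sub>R (k\<^sup>2 *\<^sub>R ((r - 1/k\<^sup>2) *\<^sub>R u + G)) \<in> M"
      by (rule scaleR_mem[rotated]) simp
    moreover have "1/k\<^sup>2 * k\<^sup>2 = 1" using k(1) by simp
    ultimately show ?thesis by (metis scaleR_scaleR scaleR_one)
  qed
  define S where "S = {r. r *\<^sub>R u + G \<in> M}"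
  have pos: "0 \<le> r" if "r \<in> S" for r
  proof (rule ccontr)
    assume "\<not> 0 \<le> r"
    then show False using bounded_mono[of r G 0] that nG by (auto simp: S_def)
  qed
  have "S \<noteq> {}" using G by (auto simp: bounded_def S_def)
  moreover have bdd: "bdd_below S" using pos by (intro bdd_belowI[of _ 0]) auto
  ultimately obtain r where r: "r \<in> S" "r < Inf S + 1/k\<^sup>2"
    using k(1) cInf_less_iff[of S "Inf S + 1/k\<^sup>2"] by auto
  have "r - 1/k\<^sup>2 \<in> S" using step[of r] r(1) pos[OF r(1)] by (simp add: S_def)
  then show False using cInf_lower[OF _ bdd, of "r - 1/k\<^sup>2"] r(2) by simp
qed

lemma square_module_extend:
  assumes "square_module Q"
  shows "square_module {q + s * a | q s. q \<in> Q \<and> s \<in> sosums}"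
proof -
  interpret Q: square_module Q by fact
  show ?thesis
  proof
    show "0 \<in> {q + s * a | q s. q \<in> Q \<and> s \<in> sosums}"
      using Q.zero_mem sosums.zero by (auto intro!: exI[of _ 0])
  next
    fix x y assume "x \<in> {q + s * a | q s. q \<in> Q \<and> s \<in> sosums}"
      "y \<in> {q + s * a | q s. q \<in> Q \<and> s \<in> sosums}"
    then obtain q s q' s' where *: "q \<in> Q" "s \<in> sosums" "q' \<in> Q" "s' \<in> sosums"
      "x = q + s * a" "y = q' + s' * a" by blast
    then have "x + y = (q + q') + (s + s') * a" by (simp add: algebra_simps)
    then show "x + y \<in> {q + s * a | q s. q \<in> Q \<and> s \<in> sosums}"
      using * Q.add_mem sosums_add by blast
  next
    fix x b assume "x \<in> {q + s * a | q s. q \<in> Q \<and> s \<in> sosums}"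
    then obtain q s where *: "q \<in> Q" "s \<in> sosums" "x = q + s * a" by blast
    then have "b\<^sup>2 * x = b\<^sup>2 * q + (b\<^sup>2 * s) * a" by (simp add: algebra_simps)
    then show "b\<^sup>2 * x \<in> {q + s * a | q s. q \<in> Q \<and> s \<in> sosums}"
      using * Q.square_mult_mem sosums_mult_square by blast
  qed
qed

text \<open>By \<open>mem_if_multiple_ge_u\<close>, adjoining \<open>- G\<close> to
  \<open>M \<inter> bounded\<close> does not produce \<open>- u\<close>. A maximal module of this
  kind inside the ideal is total, and its \<open>val\<close> is a state that is nonpositive at
  \<open>G\<close>.\<close>

theorem mem_if_states_positive:
  assumes G: "G \<in> bounded" and pos: "\<And>\<psi> \<phi>. state \<psi> \<phi> \<Longrightarrow> 0 < \<phi> G"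
  shows "G \<in> M"
proof (rule ccontr)
  assume nG: "G \<notin> M"
  define Q0 where "Q0 = {m + s * - G | m s. m \<in> M \<inter> bounded \<and> s \<in> sosums}"
  have Q0: "square_module Q0"
    unfolding Q0_def by (rule square_module_extend[OF square_module_bounded])
  have Q0_M: "M \<inter> bounded \<subseteq> Q0"
    using sosums.zero by (force simp: Q0_def)
  have Q0_G: "- G \<in> Q0"
    unfolding Q0_def mem_Collect_eq
    by (rule exI[of _ 0], rule exI[of _ 1])
      (use zero_mem bounded_zero sosums_square[of 1] in auto)
  have Q0_bounded: "Q0 \<subseteq> bounded"
    using G by (auto simp: Q0_def simp del: mult_minus_right
        intro!: bounded_add bounded_mult bounded_minus)
  have Q0_u: "- u \<notin> Q0"
  proof
    assume "- u \<in> Q0"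
    then obtain m s where "m \<in> M" "s \<in> sosums" "- u = m + s * - G" by (auto simp: Q0_def)
    moreover from this have "s * G - u = m" by (simp add: algebra_simps)
    ultimately show False using mem_if_multiple_ge_u[OF G, of s] nG by simp
  qed
  define \<A> where "\<A> = {Q. square_module Q \<and> Q0 \<subseteq> Q \<and> Q \<subseteq> bounded \<and> - u \<notin> Q}"
  have "\<exists>Q\<in>\<A>. \<forall>X\<in>\<A>. Q \<subseteq> X \<longrightarrow> X = Q"
  proof (rule subset_Zorn_nonempty)
    show "\<A> \<noteq> {}" using Q0 Q0_bounded Q0_u by (auto simp: \<A>_def)
  next
    fix \<C> assume \<C>: "\<C> \<noteq> {}" "subset.chain \<A> \<C>"
    then have sub: "\<And>Q. Q \<in> \<C> \<Longrightarrow> Q \<in> \<A>" and lin: "\<And>X Y. X \<in> \<C> \<Longrightarrow> Y \<in> \<C> \<Longrightarrow> X \<subseteq> Y \<or> Y \<subseteq> X"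
      by (auto simp: subset_chain_def)
    then have sm: "\<And>Q. Q \<in> \<C> \<Longrightarrow> square_module Q" by (auto simp: \<A>_def)
    have "square_module (\<Union>\<C>)"
    proof
      show "0 \<in> \<Union>\<C>" using \<C>(1) sm square_module.zero_mem by blast
    next
      fix x y assume "x \<in> \<Union>\<C>" "y \<in> \<Union>\<C>"
      then obtain X Y where "x \<in> X" "y \<in> Y" "X \<in> \<C>" "Y \<in> \<C>" by blast
      then show "x + y \<in> \<Union>\<C>"
        using lin[of X Y] sm square_module.add_mem by (metis UnionI subset_iff)
    next
      fix x a assume "x \<in> \<Union>\<C>"
      then show "a\<^sup>2 * x \<in> \<Union>\<C>" using sm square_module.square_mult_mem by blast
    qed
    then show "\<Union>\<C> \<in> \<A>" using sub \<C>(1) by (fastforce simp: \<A>_def)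
  qed
  then obtain Q where Q: "Q \<in> \<A>" and max: "\<And>X. X \<in> \<A> \<Longrightarrow> Q \<subseteq> X \<Longrightarrow> X = Q" by blast
  interpret Q: square_module Q using Q by (auto simp: \<A>_def)
  have Q': "Q0 \<subseteq> Q" "Q \<subseteq> bounded" "- u \<notin> Q" using Q by (auto simp: \<A>_def)
  have u_in_Q: "u \<in> Q" using u_mem bounded_u Q0_M Q' by blast
  have ext: "\<exists>q\<in>Q. \<exists>s\<in>sosums. - u = q + s * a" if a: "a \<in> bounded" "a \<notin> Q" for a
  proof (rule ccontr)
    assume no: "\<not> ?thesis"
    define X where "X = {q + s * a | q s. q \<in> Q \<and> s \<in> sosums}"
    have "Q \<subseteq> X" using sosums.zero by (force simp: X_def)
    moreover have "X \<in> \<A>"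
      using square_module_extend[OF Q.square_module_axioms, of a] Q' a \<open>Q \<subseteq> X\<close> no
      by (auto simp: \<A>_def X_def intro!: bounded_add bounded_mult)
    moreover have "a \<in> X"
      unfolding X_def mem_Collect_eq
      by (rule exI[of _ 0], rule exI[of _ 1]) (use Q.zero_mem sosums_square[of 1] in auto)
    ultimately show False using max a by blast
  qed
  interpret total_module M u Q
  proof
    show "M \<inter> bounded \<subseteq> Q" using Q0_M Q' by blast
    show "- u \<notin> Q" by fact
    fix a assume a: "a \<in> bounded"
    show "a \<in> Q \<or> - a \<in> Q"
    proof (rule ccontr)
      assume neither: "\<not> (a \<in> Q \<or> - a \<in> Q)"
      obtain q s where qs: "q \<in> Q" "s \<in> sosums" "- u = q + s * a"
        using ext[OF a] neither by blast
      obtain q' s' where qs': "q' \<in> Q" "s' \<in> sosums" "- u = q' + s' * - a"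
        using ext[OF bounded_minus[OF a]] neither by blast
      \<comment> \<open>The multipliers are sums of squares and cannot be divided out as in
        \<open>cone_separation\<close>. The combination shows only that \<open>- (s' * u)\<close>
        lies in \<open>Q\<close>; as \<open>a\<close> is below a multiple of \<open>u\<close>, this
        puts \<open>- (s' * a)\<close> into \<open>Q\<close> as well, and hence
        \<open>- u\<close>.\<close>
      have "s' * (q + s * a) + s * (q' + s' * - a) = s' * - u + s * - u"
        using qs qs' by simp
      then have "- (s' * u) = s' * q + (s * u + s * q')"
        by (simp add: algebra_simps)
      also have "\<dots> \<in> Q" using qs qs' u_in_Q by (intro Q.add_mem Q.sosums_mult_mem)
      finally have s'u: "- (s' * u) \<in> Q" .
      obtain N where N: "N *\<^sub>R u - a \<in> M" using a by (auto simp: bounded_def)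
      then have "\<bar>N\<bar> *\<^sub>R u - a \<in> M" using bounded_mono[of N "- a" "\<bar>N\<bar>"] by simp
      moreover have "\<bar>N\<bar> *\<^sub>R u - a \<in> bounded" by (intro bounded_diff bounded_scaleR bounded_u a)
      ultimately have "\<bar>N\<bar> *\<^sub>R u - a \<in> Q" using Q0_M Q' by blast
      then have "q' + (s' * (\<bar>N\<bar> *\<^sub>R u - a) + \<bar>N\<bar> *\<^sub>R (- (s' * u))) \<in> Q"
        using qs' s'u by (intro Q.add_mem Q.sosums_mult_mem Q.scaleR_mem) auto
      also have "q' + (s' * (\<bar>N\<bar> *\<^sub>R u - a) + \<bar>N\<bar> *\<^sub>R (- (s' * u))) = - u"
        unfolding qs'(3) by (simp add: algebra_simps)
      finally show False using Q' by simp
    qed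
  qed
  have "0 \<le> val (- G)" using Q0_G Q' by (intro val_nonneg) auto
  then show False using pos[OF state_chi_val] val_minus[OF G] by simp
qed

end

section \<open>Evaluation, homomorphisms and first-order expansion\<close>

section \<open>Polynomials as functions\<close>

lemma of_real_eq_single: "of_real r = (Poly_Mapping.single 0 r :: 'n::finite rpoly)"
proof -
  have "(of_real r :: 'n rpoly) = r *\<^sub>R 1" by (simp add: of_real_def)
  also have "\<dots> = Poly_Mapping.single 0 r"
    by (rule poly_mapping_eqI)
      (simp add: lookup_scaleR lookup_single when_def flip: single_one)
  finally show ?thesis .
qed

definition var :: "'n::finite \<Rightarrow> 'n rpoly" where
  "var i = monomial (Poly_Mapping.single i 1)"

lemma peval_single: "peval (Poly_Mapping.single \<alpha> r) x = r * expo_eval \<alpha> x"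
  by (simp add: peval_eq_pairing pairing_single)

lemma expo_eval_zero [simp]: "expo_eval 0 x = 1"
  by (simp add: expo_eval_def)

lemma peval_of_real [simp]: "peval (of_real r) x = r"
  by (simp add: of_real_eq_single peval_single)

lemma peval_0 [simp]: "peval 0 x = 0" and peval_1 [simp]: "peval 1 x = 1"
  using peval_of_real[of 0 x] peval_of_real[of 1 x] by simp_all

lemma peval_scaleR [simp]: "peval (r *\<^sub>R p) x = r * peval p x"
  by (simp add: scaleR_conv_of_real peval_mult)

lemma peval_minus [simp]: "peval (- p) x = - peval p x"
  using peval_scaleR[of "-1" p x] by simp

lemma peval_diff [simp]: "peval (p - q) x = peval p x - peval q x"
  using peval_add[of p "- q" x] by simp

lemmas peval_simps [simp] = peval_add peval_mult

lemma peval_power [simp]: "peval (p ^ k) x = peval p x ^ k"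
  by (induction k) auto

lemma peval_numeral [simp]: "peval (numeral k) x = numeral k"
  using peval_of_real[of "numeral k" x] by simp

lemma peval_sum [simp]: "peval (sum p S) x = (\<Sum>i\<in>S. peval (p i) x)"
  by (induction S rule: infinite_finite_induct) auto

lemma peval_prod [simp]: "peval (prod p S) x = (\<Prod>i\<in>S. peval (p i) x)"
  by (induction S rule: infinite_finite_induct) auto

lemma expo_eval_single: "expo_eval (Poly_Mapping.single i k) x = x $ i ^ k"
proof -
  have "expo_eval (Poly_Mapping.single i k) x = (\<Prod>j\<in>UNIV. if j = i then x $ i ^ k else 1)"
    unfolding expo_eval_def by (intro prod.cong) (auto simp: lookup_single when_def)
  then show ?thesis by simp
qed

lemma peval_var [simp]: "peval (var i) x = x $ i"
  by (simp add: var_def monomial_def peval_single expo_eval_single)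

lemma peval_monomial [simp]: "peval (monomial \<alpha>) x = expo_eval \<alpha> x"
  by (simp add: monomial_def peval_single)

lemma monomial_add: "monomial (\<alpha> + \<beta>) = monomial \<alpha> * monomial \<beta>"
  by (simp add: monomial_def mult_single)

lemma monomial_zero: "monomial 0 = 1"
  by (simp add: monomial_def)

lemma rpoly_induct [case_names const var add mult]:
  fixes p :: "'n::finite rpoly"
  assumes const: "\<And>r. P (of_real r)" and var: "\<And>i. P (var i)"
    and add: "\<And>p q. P p \<Longrightarrow> P q \<Longrightarrow> P (p + q)" and mult: "\<And>p q. P p \<Longrightarrow> P q \<Longrightarrow> P (p * q)"
  shows "P p"
proof -
  have monom: "P (monomial \<alpha>)" for \<alpha> :: "'n expo"
  proof (induction "expo_size \<alpha>" arbitrary: \<alpha>)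
    case 0
    then have "\<alpha> = 0" by (intro poly_mapping_eqI) (simp add: expo_size_def)
    then show ?case using const[of 1] by (simp add: monomial_zero)
  next
    case (Suc k)
    then obtain i where i: "lookup \<alpha> i \<noteq> 0"
      by (force simp: expo_size_def)
    have eq: "\<alpha> = Poly_Mapping.single i 1 + (\<alpha> - Poly_Mapping.single i 1)"
      using i by (intro poly_mapping_eqI) (auto simp: lookup_add lookup_minus lookup_single when_def)
    have "expo_size (Poly_Mapping.single i 1) = 1"
      by (simp add: expo_size_def lookup_single when_def)
    then have "k = expo_size (\<alpha> - Poly_Mapping.single i 1)"
      using Suc(2) arg_cong[OF eq, of expo_size] by (simp add: expo_size_add)
    then have "P (var i * monomial (\<alpha> - Poly_Mapping.single i 1))"
      using Suc(1) by (intro mult var) auto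
    then show ?case by (subst eq) (simp only: monomial_add var_def)
  qed
  have "P (Poly_Mapping.single \<alpha> r)" for \<alpha> r
    using mult[OF const[of r] monom[of \<alpha>]]
    by (simp add: of_real_eq_single monomial_def mult_single)
  then have "P (\<Sum>\<alpha>\<in>S. Poly_Mapping.single \<alpha> (lookup p \<alpha>))" for S
    using const[of 0] by (induction S rule: infinite_finite_induct) (auto intro: add)
  then show ?thesis
    using poly_as_sum[OF finite_keys subset_refl, of p] by metis
qed

lemma continuous_on_peval: "continuous_on S (peval p)"
proof (induction p rule: rpoly_induct)
  case (mult p q)
  then show ?case by (simp add: peval_mult[abs_def] continuous_on_mult)
next
  case (add p q)
  then show ?case by (simp add: peval_add[abs_def] continuous_on_add)
qed (simp_all add: continuous_intros)

lemma isCont_peval: "isCont (peval p) x"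
  using continuous_on_peval[of UNIV p] by (simp add: continuous_on_eq_continuous_at)

lemma peval_unique:
  fixes h :: "'n::finite rpoly \<Rightarrow> real"
  assumes "\<And>p q. h (p + q) = h p + h q" "\<And>p q. h (p * q) = h p * h q" "\<And>r. h (of_real r) = r"
  shows "h p = peval p (\<chi> i. h (var i))"
  by (induction p rule: rpoly_induct) (simp_all add: assms)

text \<open>A first-order expansion whose cofactors are again polynomials, so that it can be applied
  to them once more.\<close>

lemma hadamard:
  fixes p :: "'n::finite rpoly"
  shows "\<exists>q. p = of_real (peval p v) + (\<Sum>i\<in>UNIV. q i * (var i - of_real (v $ i)))"
proof (induction p rule: rpoly_induct)
  case (const r)
  show ?case by (intro exI[of _ "\<lambda>_. 0"]) simp
next
  case (var i)
  have "(\<Sum>j\<in>UNIV. (if j = i then 1 else 0) * (var j - of_real (v $ j))) = var i - of_real (v $ i)"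
    by (simp add: if_distrib[of "\<lambda>x. x * _"] cong: if_cong)
  then show ?case by (intro exI[of _ "\<lambda>j. if j = i then 1 else 0"]) simp
next
  case (add p q)
  then obtain p' q' where p: "p = of_real (peval p v) + (\<Sum>i\<in>UNIV. p' i * (var i - of_real (v $ i)))"
    and q: "q = of_real (peval q v) + (\<Sum>i\<in>UNIV. q' i * (var i - of_real (v $ i)))" by blast
  have "of_real (peval (p + q) v) + (\<Sum>i\<in>UNIV. (p' i + q' i) * (var i - of_real (v $ i)))
    = (of_real (peval p v) + (\<Sum>i\<in>UNIV. p' i * (var i - of_real (v $ i))))
      + (of_real (peval q v) + (\<Sum>i\<in>UNIV. q' i * (var i - of_real (v $ i))))"
    by (simp add: distrib_right sum.distrib add_ac)
  also have "\<dots> = p + q" by (simp only: p[symmetric] q[symmetric])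
  finally show ?case by (intro exI[of _ "\<lambda>i. p' i + q' i"]) (rule sym)
next
  case (mult p q)
  then obtain p' q' where p: "p = of_real (peval p v) + (\<Sum>i\<in>UNIV. p' i * (var i - of_real (v $ i)))"
    and q: "q = of_real (peval q v) + (\<Sum>i\<in>UNIV. q' i * (var i - of_real (v $ i)))" by blast
  let ?r = "\<lambda>i. p' i * q + of_real (peval p v) * q' i"
  let ?P = "\<Sum>i\<in>UNIV. p' i * (var i - of_real (v $ i))"
  let ?Q = "\<Sum>i\<in>UNIV. q' i * (var i - of_real (v $ i))"
  have "of_real (peval (p * q) v) + (\<Sum>i\<in>UNIV. ?r i * (var i - of_real (v $ i)))
      = of_real (peval (p * q) v) + (?P * q + of_real (peval p v) * ?Q)"
    unfolding sum_distrib_left sum_distrib_right sum.distrib[symmetric]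
    by (intro arg_cong2[where f = "(+)"] sum.cong refl) (simp only: distrib_right distrib_left mult_ac)
  also have "\<dots> = of_real (peval p v) * (of_real (peval q v) + ?Q) + ?P * q"
    by (simp add: algebra_simps)
  also have "\<dots> = (of_real (peval p v) + ?P) * q"
    by (simp only: q[symmetric] distrib_right)
  also have "\<dots> = p * q" by (simp only: p[symmetric])
  finally show ?case by (intro exI[of _ ?r]) (rule sym)
qed

section \<open>Second-order analysis at zeros and the membership theorem\<close>

section \<open>Polynomials with finitely many strict zeros\<close>

lemma double_sum_insert:
  fixes f :: "'i \<Rightarrow> 'i \<Rightarrow> real"
  assumes "finite S" "s \<notin> S"
  shows "(\<Sum>i\<in>insert s S. \<Sum>j\<in>insert s S. f i j)
    = f s s + (\<Sum>i\<in>S. f s i) + (\<Sum>i\<in>S. f i s) + (\<Sum>i\<in>S. \<Sum>j\<in>S. f i j)"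
  using assms by (simp add: sum.distrib)

text \<open>The induction passes to the Schur complement of one diagonal entry of \<open>A\<close>.\<close>

lemma trace_mult_nonneg:
  fixes A B :: "'i \<Rightarrow> 'i \<Rightarrow> real"
  assumes "finite S"
    and "\<And>i j. A i j = A j i" and "\<And>i j. B i j = B j i"
    and "\<And>z. (\<exists>i\<in>S. z i \<noteq> 0) \<Longrightarrow> 0 < (\<Sum>i\<in>S. \<Sum>j\<in>S. z i * z j * A i j)"
    and "\<And>z. 0 \<le> (\<Sum>i\<in>S. \<Sum>j\<in>S. z i * z j * B i j)"
  shows "0 \<le> (\<Sum>i\<in>S. \<Sum>j\<in>S. A i j * B i j)"
  using assms
proof (induction S arbitrary: A rule: finite_induct)
  case (insert s S)
  note form = double_sum_insert[OF insert.hyps]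
  define a where "a = A s s"
  have "0 < (\<Sum>i\<in>insert s S. \<Sum>j\<in>insert s S. (if i = s then 1 else 0) * (if j = s then 1 else 0) * A i j)"
    using insert.prems(3)[of "\<lambda>i. if i = s then 1 else 0"] by auto
  also have "\<dots> = a"
  proof -
    have "i \<noteq> s" if "i \<in> S" for i using insert.hyps that by auto
    then show ?thesis unfolding form by (simp add: a_def)
  qed
  finally have a: "0 < a" .
  define A' where "A' i j = A i j - A s i * A s j / a" for i j
  have "0 \<le> (\<Sum>i\<in>S. \<Sum>j\<in>S. A' i j * B i j)"
  proof (rule insert.IH)
    show "A' i j = A' j i" for i j using insert.prems(1)[of i j] by (simp add: A'_def)
    show "B i j = B j i" for i j by fact
    show "0 \<le> (\<Sum>i\<in>S. \<Sum>j\<in>S. z i * z j * B i j)" for z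
    proof -
      have eq: "(\<Sum>i\<in>S. \<Sum>j\<in>S. (z(s := 0)) i * (z(s := 0)) j * B i j)
          = (\<Sum>i\<in>S. \<Sum>j\<in>S. z i * z j * B i j)"
        using insert.hyps by (intro sum.cong refl) auto
      show ?thesis using insert.prems(4)[of "z(s := 0)"] unfolding form eq by simp
    qed
    fix z :: "'i \<Rightarrow> real" assume z: "\<exists>i\<in>S. z i \<noteq> 0"
    define t where "t = (\<Sum>i\<in>S. z i * A s i)"
    \<comment> \<open>The entry at \<open>s\<close> minimises the quadratic form of \<open>A\<close>
      in that coordinate; the minimum is the form of the Schur complement.\<close>
    define y where "y = z(s := - t / a)"
    have y: "y s = - t / a" "\<And>i. i \<in> S \<Longrightarrow> y i = z i" using insert.hyps by (auto simp: y_def)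
    have "0 < (\<Sum>i\<in>insert s S. \<Sum>j\<in>insert s S. y i * y j * A i j)"
    proof (rule insert.prems(3))
      obtain i where "i \<in> S" "z i \<noteq> 0" using z by auto
      then show "\<exists>i\<in>insert s S. y i \<noteq> 0" using y(2)[of i] by (intro bexI[of _ i]) auto
    qed
    also have "\<dots> = y s * y s * a + y s * t + y s * t + (\<Sum>i\<in>S. \<Sum>j\<in>S. z i * z j * A i j)"
    proof -
      have "(\<Sum>i\<in>S. y s * y i * A s i) = y s * t" "(\<Sum>i\<in>S. y i * y s * A i s) = y s * t"
        using y(2) insert.prems(1)[of _ s]
        by (auto simp: t_def sum_distrib_left intro!: sum.cong)
      moreover have "(\<Sum>i\<in>S. \<Sum>j\<in>S. y i * y j * A i j) = (\<Sum>i\<in>S. \<Sum>j\<in>S. z i * z j * A i j)"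
        using y(2) by (intro sum.cong) auto
      ultimately show ?thesis unfolding form by (simp add: a_def)
    qed
    also have "\<dots> = (\<Sum>i\<in>S. \<Sum>j\<in>S. z i * z j * A i j) - t * t / a"
      using a by (simp add: y(1) field_simps)
    also have "t * t / a = (\<Sum>i\<in>S. \<Sum>j\<in>S. z i * z j * (A s i * A s j / a))"
      unfolding t_def sum_product sum_divide_distrib by (intro sum.cong refl) simp
    finally show "0 < (\<Sum>i\<in>S. \<Sum>j\<in>S. z i * z j * A' i j)"
      by (simp add: A'_def algebra_simps sum_subtractf)
  qed
  \<comment> \<open>What \<open>A'\<close> leaves out of \<open>A\<close> is the rank-one matrix
    with entries \<open>A s i * A s j / a\<close>. It contributes \<open>a\<close> times the form of
    \<open>B\<close> at the vector \<open>A s i / a\<close>.\<close>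
  moreover have "0 \<le> a * (\<Sum>i\<in>insert s S. \<Sum>j\<in>insert s S. (A s i / a) * (A s j / a) * B i j)"
    using a by (intro mult_nonneg_nonneg insert.prems(4)) simp
  moreover have "a * (\<Sum>i\<in>insert s S. \<Sum>j\<in>insert s S. (A s i / a) * (A s j / a) * B i j)
      = A s s * B s s + (\<Sum>i\<in>S. A s i * B s i) + (\<Sum>i\<in>S. A i s * B i s)
        + (\<Sum>i\<in>S. \<Sum>j\<in>S. A s i * A s j / a * B i j)"
  proof -
    have ass: "A s s = a" by (simp add: a_def)
    have col: "(\<Sum>i\<in>S. A i s * B i s) = (\<Sum>i\<in>S. A s i * B i s)"
      using insert.prems(1) by (intro sum.cong refl) metis
    have "a * (\<Sum>i\<in>S. A s s / a * (A s i / a) * B s i) = (\<Sum>i\<in>S. A s i * B s i)"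
      "a * (\<Sum>i\<in>S. A s i / a * (A s s / a) * B i s) = (\<Sum>i\<in>S. A i s * B i s)"
      "a * (\<Sum>i\<in>S. \<Sum>j\<in>S. A s i / a * (A s j / a) * B i j)
        = (\<Sum>i\<in>S. \<Sum>j\<in>S. A s i * A s j / a * B i j)"
      using a by (simp_all add: sum_distrib_left ass col)
    moreover have "a * (A s s / a * (A s s / a) * B s s) = A s s * B s s"
      using a by (simp add: a_def)
    ultimately show ?thesis unfolding form by (simp only: distrib_left)
  qed
  ultimately show ?case
    unfolding form by (simp add: A'_def algebra_simps sum_subtractf)
qed simp

definition shift :: "real^'n::finite \<Rightarrow> 'n \<Rightarrow> 'n rpoly" where
  "shift v i = var i - of_real (v $ i)"

lemma peval_shift [simp]: "peval (shift v i) x = x $ i - v $ i"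
  by (simp add: shift_def)

abbreviation quadratic_growth_at :: "real^'n::finite \<Rightarrow> 'n rpoly \<Rightarrow> bool" where
  "quadratic_growth_at v p \<equiv> \<exists>\<delta>>0. \<forall>\<^sub>F x in nhds v. \<delta> * (norm (x - v))\<^sup>2 \<le> peval p x"

text \<open>The value of the cofactor \<open>q i\<close> at \<open>v\<close> is a partial derivative
  of \<open>G\<close>. It is 0 because \<open>G\<close> is nonnegative on both sides of
  \<open>v\<close> along the axis, so \<open>hadamard\<close> applies to the cofactors in
  turn.\<close>

lemma second_order_representation:
  fixes G :: "'n::finite rpoly"
  assumes 0: "peval G v = 0" and nn: "\<forall>\<^sub>F x in nhds v. 0 \<le> peval G x"
  shows "\<exists>H. G = (\<Sum>i\<in>UNIV. \<Sum>j\<in>UNIV. H i j * (shift v i * shift v j))"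
proof -
  obtain q where q: "G = (\<Sum>i\<in>UNIV. q i * shift v i)"
    using hadamard[of G v] 0 by (auto simp: shift_def)
  have "peval (q i) v = 0" for i
  proof -
    define \<gamma> where "\<gamma> t = v + t *\<^sub>R axis i 1" for t :: real
    have G: "peval G (\<gamma> t) = t * peval (q i) (\<gamma> t)" for t
    proof -
      have "peval G (\<gamma> t) = (\<Sum>j\<in>UNIV. if j = i then t * peval (q i) (\<gamma> t) else 0)"
        unfolding q peval_sum by (intro sum.cong) (auto simp: \<gamma>_def axis_def)
      then show ?thesis by simp
    qed
    have "((\<lambda>t. v + t *\<^sub>R axis i 1) \<longlongrightarrow> v + 0 *\<^sub>R axis i 1) (at 0)"
      by (intro tendsto_intros)
    then have \<gamma>: "(\<gamma> \<longlongrightarrow> v) (at 0)" by (simp add: \<gamma>_def[abs_def])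
    have ev: "\<forall>\<^sub>F t in at 0. 0 \<le> t * peval (q i) (\<gamma> t)"
      using eventually_compose_filterlim[OF nn \<gamma>] by (simp add: G)
    have lim: "((\<lambda>t. peval (q i) (\<gamma> t)) \<longlongrightarrow> peval (q i) v) (at 0)"
      using isCont_tendsto_compose[OF isCont_peval \<gamma>] .
    have "0 \<le> peval (q i) v"
    proof (rule tendsto_lowerbound[OF tendsto_mono[OF _ lim]])
      show "at_right 0 \<le> at (0::real)" by (simp add: at_le)
      show "\<forall>\<^sub>F t in at_right 0. 0 \<le> peval (q i) (\<gamma> t)"
        using filter_leD[OF at_le[OF subset_UNIV] ev] eventually_at_right_less[of 0]
        by eventually_elim (simp add: zero_le_mult_iff)
    qed simp
    moreover have left: "\<forall>\<^sub>F t in at_left 0. t < (0::real)" by (simp add: eventually_at_filter)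
    have "peval (q i) v \<le> 0"
    proof (rule tendsto_upperbound[OF tendsto_mono[OF _ lim]])
      show "at_left 0 \<le> at (0::real)" by (simp add: at_le)
      show "\<forall>\<^sub>F t in at_left 0. peval (q i) (\<gamma> t) \<le> 0"
        using filter_leD[OF at_le[OF subset_UNIV] ev] left
        by eventually_elim (simp add: zero_le_mult_iff)
    qed simp
    ultimately show ?thesis by simp
  qed
  then have "\<exists>h. q i = (\<Sum>j\<in>UNIV. h j * shift v j)" for i
    using hadamard[of "q i" v] by (auto simp: shift_def)
  then obtain H where H: "\<And>i. q i = (\<Sum>j\<in>UNIV. H i j * shift v j)" by metis
  show ?thesis
    by (rule exI[of _ H]) (simp add: q H sum_distrib_right sum_distrib_left mult_ac)
qed

text \<open>Restrict to the line through \<open>v\<close> in direction \<open>z\<close>, divide by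
  the square of the parameter and let it tend to 0.\<close>

lemma second_order_form_ge:
  fixes H :: "'n::finite \<Rightarrow> 'n \<Rightarrow> 'n rpoly"
  assumes ge: "\<forall>\<^sub>F x in nhds v.
      \<delta> * (norm (x - v))\<^sup>2 \<le> peval (\<Sum>i\<in>UNIV. \<Sum>j\<in>UNIV. H i j * (shift v i * shift v j)) x"
  shows "\<delta> * (norm z)\<^sup>2 \<le> (\<Sum>i\<in>UNIV. \<Sum>j\<in>UNIV. z $ i * z $ j * peval (H i j) v)"
proof -
  define \<gamma> where "\<gamma> t = v + t *\<^sub>R z" for t :: real
  have "((\<lambda>t. v + t *\<^sub>R z) \<longlongrightarrow> v + 0 *\<^sub>R z) (at 0)"
    by (intro tendsto_intros)
  then have \<gamma>: "(\<gamma> \<longlongrightarrow> v) (at 0)" by (simp add: \<gamma>_def[abs_def])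
  have lim: "((\<lambda>t. \<Sum>i\<in>UNIV. \<Sum>j\<in>UNIV. z $ i * z $ j * peval (H i j) (\<gamma> t)) \<longlongrightarrow>
     (\<Sum>i\<in>UNIV. \<Sum>j\<in>UNIV. z $ i * z $ j * peval (H i j) v)) (at 0)"
    by (intro tendsto_intros isCont_tendsto_compose[OF isCont_peval \<gamma>])
  have "peval (\<Sum>i\<in>UNIV. \<Sum>j\<in>UNIV. H i j * (shift v i * shift v j)) (\<gamma> t)
      = t\<^sup>2 * (\<Sum>i\<in>UNIV. \<Sum>j\<in>UNIV. z $ i * z $ j * peval (H i j) (\<gamma> t))" for t
    by (simp add: \<gamma>_def sum_distrib_left power2_eq_square mult_ac)
  then have ev: "\<forall>\<^sub>F t in at 0. \<delta> * (t\<^sup>2 * (norm z)\<^sup>2)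
      \<le> t\<^sup>2 * (\<Sum>i\<in>UNIV. \<Sum>j\<in>UNIV. z $ i * z $ j * peval (H i j) (\<gamma> t))"
    using eventually_compose_filterlim[OF ge \<gamma>] by (simp add: \<gamma>_def power_mult_distrib)
  have "\<forall>\<^sub>F t in at 0. \<delta> * (norm z)\<^sup>2
      \<le> (\<Sum>i\<in>UNIV. \<Sum>j\<in>UNIV. z $ i * z $ j * peval (H i j) (\<gamma> t))"
    using ev eventually_neq_at_within[of "0::real" 0 UNIV]
  proof eventually_elim
    case (elim t)
    then have "t\<^sup>2 * (\<delta> * (norm z)\<^sup>2) \<le> t\<^sup>2 * (\<Sum>i\<in>UNIV. \<Sum>j\<in>UNIV. z $ i * z $ j * peval (H i j) (\<gamma> t))"
      by (simp add: mult_ac)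
    then show ?case using elim(2) by (subst (asm) mult_le_cancel_left_pos) auto
  qed
  then show ?thesis by (intro tendsto_lowerbound[OF lim]) simp_all
qed

lemma lagrange_polys:
  fixes Z :: "(real^'n::finite) set"
  assumes "finite Z"
  shows "\<exists>b. \<forall>v\<in>Z. \<forall>w\<in>Z. peval (b v) w = (if v = w then 1 else 0)"
proof -
  \<comment> \<open>Affine along the line through the two points, 0 at \<open>w\<close> and 1 at
    \<open>v\<close>.\<close>
  define d :: "real^'n \<Rightarrow> real^'n \<Rightarrow> 'n rpoly" where
    "d v w = (1 / (norm (v - w))\<^sup>2) *\<^sub>R (\<Sum>i\<in>UNIV. of_real (v $ i - w $ i) * shift w i)" for v w
  have d: "peval (d v w) x = ((v - w) \<bullet> (x - w)) / (norm (v - w))\<^sup>2" for v w x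
    by (simp add: d_def inner_vec_def)
  have "peval (\<Prod>w\<in>Z - {v}. d v w) w = (if v = w then 1 else 0)" if "v \<in> Z" "w \<in> Z" for v w
  proof (cases "v = w")
    case True
    then show ?thesis by (auto simp: d power2_norm_eq_inner intro!: prod.neutral split: if_splits)
  next
    case False
    then have "\<exists>x\<in>Z - {v}. peval (d v x) w = 0" using that by (intro bexI[of _ w]) (auto simp: d)
    then show ?thesis using False assms by (auto simp: prod_zero_iff)
  qed
  then show ?thesis by (intro exI[of _ "\<lambda>v. \<Prod>w\<in>Z - {v}. d v w"]) auto
qed

locale archimedean_poly_module = square_module M for M :: "'n::finite rpoly set" +
  assumes one_mem: "1 \<in> M" and arch: "\<exists>N. of_real N - p \<in> M"
begin

theorem mem_if_strict_local_minima:
  fixes Z :: "(real^'n) set"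
  assumes Z: "finite Z"
    and pos: "\<And>x. x \<notin> Z \<Longrightarrow> (\<And>p. p \<in> M \<Longrightarrow> 0 \<le> peval p x) \<Longrightarrow> 0 < peval G x"
    and zero: "\<And>v. v \<in> Z \<Longrightarrow> peval G v = 0"
    and min: "\<And>v. v \<in> Z \<Longrightarrow> quadratic_growth_at v G"
  shows "G \<in> M"
proof -
  obtain b where b: "\<And>v w. v \<in> Z \<Longrightarrow> w \<in> Z \<Longrightarrow> peval (b v) w = (if v = w then 1 else 0)"
    using lagrange_polys[OF Z] by blast
  \<comment> \<open>These vanish on all of \<open>Z\<close>, and products of two of them at the same
    \<open>v\<close> are \<open>u\<close>-bounded. A second-order expansion at \<open>v\<close>,
    multiplied by \<open>(b v)\<^sup>2\<close>, therefore lies in the ideal.\<close>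
  define g where "g v i = b v * shift v i" for v i
  define e where "e = 1 - (\<Sum>v\<in>Z. (b v)\<^sup>2)"
  \<comment> \<open>\<open>G\<close> is \<open>u\<close>-bounded because \<open>1 = (1 + e) (\<Sum>v\<in>Z. (b v)\<^sup>2) + e\<^sup>2\<close>.\<close>
  define u where "u = e\<^sup>2 + (\<Sum>v\<in>Z. \<Sum>i\<in>UNIV. (g v i)\<^sup>2)"
  interpret archimedean_module M u
  proof
    show "1 \<in> M" by (rule one_mem)
    show "\<exists>N. of_real N - a \<in> M" for a by (rule arch)
    show "u \<in> sosums"
      unfolding u_def by (intro sosums_add sosums_sum sosums_square)
  qed
  have u_e: "u - e\<^sup>2 \<in> M"
    unfolding u_def by (intro sosums_subset) (auto intro!: sosums_sum sosums_square)
  have u_g: "u - (g v i)\<^sup>2 \<in> M" if "v \<in> Z" for v i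
  proof -
    have "u - (g v i)\<^sup>2 = e\<^sup>2 + ((\<Sum>w\<in>Z - {v}. \<Sum>j\<in>UNIV. (g w j)\<^sup>2) + (\<Sum>j\<in>UNIV - {i}. (g v j)\<^sup>2))"
      using Z that by (simp add: u_def sum.remove[of Z v] sum.remove[of UNIV i])
    also have "\<dots> \<in> sosums" by (intro sosums_add sosums_sum sosums_square)
    finally show ?thesis by (rule sosums_subset)
  qed
  have gg: "g v i * g v j \<in> bounded" if "v \<in> Z" for v i j
    using that by (intro bounded_product u_g)
  have local_rep: "(b v)\<^sup>2 * p = (\<Sum>i\<in>UNIV. \<Sum>j\<in>UNIV. H i j * (g v i * g v j))"
    if "p = (\<Sum>i\<in>UNIV. \<Sum>j\<in>UNIV. H i j * (shift v i * shift v j))" for v p H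
    unfolding that sum_distrib_left g_def
    by (intro sum.cong refl) (simp only: power2_eq_square mult_ac)
  have rep: "\<exists>H. p = (\<Sum>i\<in>UNIV. \<Sum>j\<in>UNIV. H i j * (shift v i * shift v j))"
    if "peval p v = 0" "\<forall>\<^sub>F x in nhds v. 0 \<le> peval p x" for p v
    using second_order_representation[OF that] .
  have G_nonneg: "\<forall>\<^sub>F x in nhds v. 0 \<le> peval G x" if "v \<in> Z" for v
  proof -
    obtain \<delta> where "0 < \<delta>" "\<forall>\<^sub>F x in nhds v. \<delta> * (norm (x - v))\<^sup>2 \<le> peval G x"
      using min[OF \<open>v \<in> Z\<close>] by blast
    then show ?thesis by (elim eventually_mono) (auto intro: order_trans[rotated])
  qed
  have G_bounded: "G \<in> bounded"
  proof -
    have "(b v)\<^sup>2 * G \<in> bounded" if v: "v \<in> Z" for v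
    proof -
      obtain H where H: "G = (\<Sum>i\<in>UNIV. \<Sum>j\<in>UNIV. H i j * (shift v i * shift v j))"
        using rep[OF zero[OF v] G_nonneg[OF v]] by blast
      show ?thesis
        unfolding local_rep[OF H] by (intro bounded_sum bounded_mult gg v)
    qed
    then have "(\<Sum>v\<in>Z. (b v)\<^sup>2 * G) \<in> bounded" by (rule bounded_sum)
    moreover have "e * e \<in> bounded" by (rule bounded_product[OF u_e u_e])
    ultimately have "(1 + e) * (\<Sum>v\<in>Z. (b v)\<^sup>2 * G) + G * (e * e) \<in> bounded"
      by (simp only: bounded_add bounded_mult)
    also have "(1 + e) * (\<Sum>v\<in>Z. (b v)\<^sup>2 * G) + G * (e * e) = (1 + e) * ((1 - e) * G) + G * (e * e)"
      by (simp add: e_def sum_distrib_right)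
    also have "\<dots> = G" by (simp add: algebra_simps)
    finally show ?thesis .
  qed
  show ?thesis
  proof (rule mem_if_states_positive[OF G_bounded])
    fix \<psi> \<phi> assume st: "state \<psi> \<phi>"
    define x where "x = (\<chi> i. \<psi> (var i))"
    have \<psi>: "\<psi> p = peval p x" for p
      unfolding x_def by (rule peval_unique) (use st in \<open>auto simp: state_def\<close>)
    have \<phi>_u: "\<phi> u = 1"
      and \<phi>_add: "\<And>a b. a \<in> bounded \<Longrightarrow> b \<in> bounded \<Longrightarrow> \<phi> (a + b) = \<phi> a + \<phi> b"
      and \<phi>_mult: "\<And>a b. a \<in> bounded \<Longrightarrow> \<phi> (b * a) = peval b x * \<phi> a"
      and \<phi>_nonneg: "\<And>a. a \<in> M \<Longrightarrow> a \<in> bounded \<Longrightarrow> 0 \<le> \<phi> a"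
      and x_nonneg: "\<And>p. p \<in> M \<Longrightarrow> 0 \<le> peval p x"
      using st by (auto simp: state_def \<psi>)
    have \<phi>_0: "\<phi> 0 = 0" using \<phi>_add[OF bounded_zero bounded_zero] by simp
    have \<phi>_sum: "\<phi> (sum f S) = (\<Sum>i\<in>S. \<phi> (f i))" if "\<And>i. i \<in> S \<Longrightarrow> f i \<in> bounded"
      for f and S :: "'n set"
    proof -
      have "finite S" by simp
      then show ?thesis using that
        by (induction S rule: finite_induct) (auto simp: \<phi>_0 \<phi>_add bounded_sum)
    qed
    show "0 < \<phi> G"
    proof (cases "x \<in> Z")
      case False
      \<comment> \<open>\<open>G\<close> and \<open>u\<close> both lie in the ideal, so either
        factor of \<open>u * G\<close> can be taken out of \<phi>. This ties \<phi> to evaluation at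
        \<open>x\<close>.\<close>
      have "peval u x * \<phi> G = peval G x"
        using \<phi>_mult[OF G_bounded, of u] \<phi>_mult[OF bounded_u, of G] \<phi>_u by (simp add: mult.commute)
      moreover have "0 < peval G x" using pos[OF False x_nonneg] .
      ultimately show ?thesis using x_nonneg[OF u_mem] by (metis zero_less_mult_pos less_eq_real_def mult_zero_left less_irrefl)
    next
      case True
      \<comment> \<open>The second moments of \<phi> at \<open>x\<close>. By
        \<open>\<phi>_rep\<close> they determine \<phi> on the bounded elements with a second-order
        expansion at \<open>x\<close>.\<close>
      define B where "B i j = \<phi> (g x i * g x j)" for i j
      have \<phi>_rep: "\<phi> p = (\<Sum>i\<in>UNIV. \<Sum>j\<in>UNIV. peval (H i j) x * B i j)"
        if p: "p \<in> bounded" "p = (\<Sum>i\<in>UNIV. \<Sum>j\<in>UNIV. H i j * (shift x i * shift x j))" for p H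
      proof -
        have "\<phi> p = \<phi> ((b x)\<^sup>2 * p)" using \<phi>_mult[OF p(1)] b[OF True True] by simp
        also have "\<dots> = (\<Sum>i\<in>UNIV. \<Sum>j\<in>UNIV. \<phi> (H i j * (g x i * g x j)))"
          unfolding local_rep[OF p(2)] by (simp add: \<phi>_sum bounded_sum bounded_mult gg True)
        finally show ?thesis by (simp add: \<phi>_mult gg True B_def)
      qed
      have B_sym: "B i j = B j i" for i j by (simp add: B_def mult.commute)
      have B_nonneg: "0 \<le> (\<Sum>i\<in>UNIV. \<Sum>j\<in>UNIV. z i * z j * B i j)" for z
      proof -
        have sq: "(\<Sum>i\<in>UNIV. of_real (z i) * g x i)\<^sup>2
            = (\<Sum>i\<in>UNIV. \<Sum>j\<in>UNIV. of_real (z i * z j) * (g x i * g x j))"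
          unfolding power2_eq_square sum_product by (intro sum.cong refl) (simp add: mult_ac)
        have "(\<Sum>i\<in>UNIV. of_real (z i) * g x i)\<^sup>2 \<in> M \<inter> bounded"
        proof
          show "(\<Sum>i\<in>UNIV. of_real (z i) * g x i)\<^sup>2 \<in> M" by (intro sosums_subset sosums_square)
          show "(\<Sum>i\<in>UNIV. of_real (z i) * g x i)\<^sup>2 \<in> bounded"
            unfolding sq by (intro bounded_sum bounded_mult gg True)
        qed
        then have "0 \<le> \<phi> ((\<Sum>i\<in>UNIV. of_real (z i) * g x i)\<^sup>2)" by (intro \<phi>_nonneg) auto
        also have "\<dots> = (\<Sum>i\<in>UNIV. \<Sum>j\<in>UNIV. z i * z j * B i j)"
          unfolding sq by (simp add: \<phi>_sum bounded_sum bounded_mult gg True \<phi>_mult B_def del: of_real_mult)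
        finally show ?thesis .
      qed
      have B_diag: "0 \<le> B i i" for i
        using \<phi>_nonneg[OF sosums_subset[OF sosums_square[of "g x i"]]] gg[OF True, of i i]
        by (simp add: B_def power2_eq_square)
      obtain H where H: "G = (\<Sum>i\<in>UNIV. \<Sum>j\<in>UNIV. H i j * (shift x i * shift x j))"
        using rep[OF zero[OF True] G_nonneg[OF True]] by blast
      obtain \<delta> where \<delta>: "0 < \<delta>" "\<forall>\<^sub>F y in nhds x. \<delta> * (norm (y - x))\<^sup>2 \<le> peval G y"
        using min[OF True] by blast
      note form = second_order_form_ge[OF \<delta>(2)[unfolded H]]
      \<comment> \<open>\<open>H\<close> need not be symmetric, hence the average. Only half of the
        growth constant is subtracted: the remaining half makes \<open>A\<close> positive definite,
        the subtracted half bounds \<phi> at \<open>G\<close> below by a multiple of the trace of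
        \<open>B\<close>.\<close>
      define A where "A i j = (peval (H i j) x + peval (H j i) x) / 2 - (if i = j then \<delta> / 2 else 0)" for i j
      have A_sym: "A i j = A j i" for i j by (simp add: A_def)
      have A_pos: "0 < (\<Sum>i\<in>UNIV. \<Sum>j\<in>UNIV. z i * z j * A i j)" if z: "\<exists>i\<in>UNIV. z i \<noteq> 0" for z
      proof -
        have swap: "(\<Sum>i\<in>UNIV. \<Sum>j\<in>UNIV. z i * z j * peval (H j i) x)
            = (\<Sum>i\<in>UNIV. \<Sum>j\<in>UNIV. z i * z j * peval (H i j) x)"
          by (subst sum.swap) (simp add: mult.commute mult.left_commute)
        have nz: "(norm (\<chi> i. z i))\<^sup>2 = (\<Sum>i\<in>UNIV. z i * z i)"
          by (simp add: power2_norm_eq_inner inner_vec_def)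
        obtain i where "z i \<noteq> 0" using z by blast
        then have "(\<chi> i. z i) \<noteq> 0" by (auto simp: vec_eq_iff)
        then have "0 < \<delta> / 2 * (norm (\<chi> i. z i))\<^sup>2" using \<delta>(1) by simp
        also have "\<dots> \<le> (\<Sum>i\<in>UNIV. \<Sum>j\<in>UNIV. z i * z j * peval (H i j) x) - \<delta> / 2 * (norm (\<chi> i. z i))\<^sup>2"
          using form[of "\<chi> i. z i"] by simp
        also have "\<dots> = (\<Sum>i\<in>UNIV. \<Sum>j\<in>UNIV. z i * z j * A i j)"
        proof -
          have "z i * z j * A i j = (z i * z j * peval (H i j) x + z i * z j * peval (H j i) x) / 2
              - (if i = j then \<delta> / 2 * (z i * z i) else 0)" for i j
            by (simp add: A_def field_simps)
          moreover have "(\<Sum>i\<in>UNIV. \<delta> / 2 * (z i * z i)) = \<delta> / 2 * (norm (\<chi> i. z i))\<^sup>2"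
            by (simp only: nz sum_distrib_left)
          ultimately show ?thesis
            by (simp add: sum_subtractf sum.distrib swap flip: sum_divide_distrib)
        qed
        finally show ?thesis .
      qed
      have trace: "0 \<le> (\<Sum>i\<in>UNIV. \<Sum>j\<in>UNIV. A i j * B i j)"
        by (rule trace_mult_nonneg) (simp_all add: A_sym B_sym A_pos B_nonneg)
      have "(\<Sum>i\<in>UNIV. \<Sum>j\<in>UNIV. A i j * B i j) = \<phi> G - \<delta> / 2 * (\<Sum>i\<in>UNIV. B i i)"
      proof -
        have swap: "(\<Sum>i\<in>UNIV. \<Sum>j\<in>UNIV. peval (H j i) x * B i j)
            = (\<Sum>i\<in>UNIV. \<Sum>j\<in>UNIV. peval (H i j) x * B i j)"
          by (subst sum.swap) (simp add: B_sym)
        have "A i j * B i j = (peval (H i j) x * B i j + peval (H j i) x * B i j) / 2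
              - (if i = j then \<delta> / 2 * B i i else 0)" for i j
          by (simp add: A_def field_simps)
        moreover have "(\<Sum>i\<in>UNIV. \<delta> / 2 * B i i) = \<delta> / 2 * (\<Sum>i\<in>UNIV. B i i)"
          by (simp only: sum_distrib_left)
        ultimately show ?thesis
          by (simp add: sum_subtractf sum.distrib swap \<phi>_rep[OF G_bounded H]
              flip: sum_divide_distrib)
      qed
      then have ge: "\<delta> / 2 * (\<Sum>i\<in>UNIV. B i i) \<le> \<phi> G" using trace by simp
      \<comment> \<open>A positive semidefinite \<open>B\<close> with zero diagonal is 0. But
        \<open>u\<close> itself has a second-order expansion at \<open>x\<close>, so \<phi> would be
        0 at \<open>u\<close> instead of 1.\<close>
      have "(\<Sum>i\<in>UNIV. B i i) \<noteq> 0"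
      proof
        assume "(\<Sum>i\<in>UNIV. B i i) = 0"
        then have diag0: "B i i = 0" for i
          using B_diag by (subst (asm) sum_nonneg_eq_0_iff) auto
        have B0: "B i j = 0" for i j
        proof (cases "i = j")
          case False
          have "0 \<le> 2 * s * B i j" for s :: real
          proof -
            define z where "z k = (if k = i then 1 else if k = j then s else 0)" for k
            have "0 \<le> (\<Sum>k\<in>UNIV. \<Sum>l\<in>UNIV. z k * B k l * z l)"
              using B_nonneg[of z] by (simp add: mult_ac)
            also have "\<dots> = 2 * s * B i j"
              using False B_sym[of i j]
              by (subst quadratic_form_pair[of UNIV i j]) (auto simp: z_def diag0)
            finally show ?thesis .
          qed
          from this[of 1] this[of "-1"] show ?thesis by simp
        qed (simp add: diag0)
        have "peval u x = 0"
        proof -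
          have "peval e x = 0"
            using Z True b by (simp add: e_def b if_distrib[of "\<lambda>t. t\<^sup>2"] cong: if_cong sum.cong)
          moreover have "peval (g v i) x = 0" if "v \<in> Z" for v i
            using b[OF that True] by (auto simp: g_def)
          ultimately show ?thesis by (simp add: u_def)
        qed
        moreover have "0 \<le> peval u y" for y
          by (auto simp: u_def intro!: add_nonneg_nonneg sum_nonneg)
        ultimately obtain H' where "u = (\<Sum>i\<in>UNIV. \<Sum>j\<in>UNIV. H' i j * (shift x i * shift x j))"
          using rep[of u x] by auto
        then have "\<phi> u = 0" using \<phi>_rep[OF bounded_u] by (simp add: B0)
        then show False using \<phi>_u by simp
      qed
      then have "0 < (\<Sum>i\<in>UNIV. B i i)"
        using sum_nonneg[of UNIV "\<lambda>i. B i i"] B_diag by (simp add: order_less_le)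
      then show ?thesis using ge \<delta>(1) by (smt (verit) mult_pos_pos half_gt_zero)
    qed
  qed
qed

end

section \<open>The module of the constraints and its positivity set\<close>

section \<open>Ideals plus quadratic modules\<close>

lemma sos_eq_sosums: "(sos :: 'n::finite rpoly set) = sosums"
proof
  show "(sos :: 'n rpoly set) \<subseteq> sosums"
    by (auto simp: sos_def intro!: sosums_sum sosums_square)
  show "sosums \<subseteq> (sos :: 'n rpoly set)"
  proof
    fix s :: "'n rpoly" assume "s \<in> sosums"
    then show "s \<in> sos"
    proof induction
      case zero
      show ?case by (auto simp: sos_def intro!: exI[of _ "0::nat"])
    next
      case (add_square s a)
      then obtain r :: nat and q where "s = (\<Sum>i<r. q i ^ 2)" by (auto simp: sos_def)
      then have "a\<^sup>2 + s = (\<Sum>i<Suc r. (case i of 0 \<Rightarrow> a | Suc j \<Rightarrow> q j) ^ 2)"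
        by (simp only: sum.lessThan_Suc_shift) simp
      then show ?case unfolding sos_def by blast
    qed
  qed
qed

definition ideal_qmodule :: "'j set \<Rightarrow> 'j set \<Rightarrow> ('j \<Rightarrow> 'n::finite rpoly) \<Rightarrow> 'n rpoly set" where
  "ideal_qmodule E I c = {p + q | p q. p \<in> ideal_gen E c \<and> q \<in> qmodule I c}"

lemma ideal_qmodule_iff:
  "a \<in> ideal_qmodule E I c \<longleftrightarrow> (\<exists>p s0 s. s0 \<in> sosums \<and> (\<forall>j\<in>I. s j \<in> sosums) \<and>
     a = (\<Sum>j\<in>E. c j * p j) + (s0 + (\<Sum>j\<in>I. c j * s j)))"
proof
  assume "a \<in> ideal_qmodule E I c"
  then obtain P q where a: "a = P + q" and P: "P \<in> ideal_gen E c" and q: "q \<in> qmodule I c"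
    unfolding ideal_qmodule_def mem_Collect_eq by (elim exE conjE)
  from P obtain p where p: "P = (\<Sum>j\<in>E. c j * p j)" unfolding ideal_gen_def mem_Collect_eq by (elim exE conjE)
  from q obtain s0 s where s: "s0 \<in> sosums" "\<forall>j\<in>I. s j \<in> sosums" "q = s0 + (\<Sum>j\<in>I. c j * s j)"
    unfolding qmodule_def sos_eq_sosums mem_Collect_eq by (elim exE conjE)
  show "\<exists>p s0 s. s0 \<in> sosums \<and> (\<forall>j\<in>I. s j \<in> sosums) \<and>
     a = (\<Sum>j\<in>E. c j * p j) + (s0 + (\<Sum>j\<in>I. c j * s j))"
    unfolding a p s(3)
    by (rule exI[of _ p], rule exI[of _ s0], rule exI[of _ s]) (intro conjI s(1,2) refl)
next
  assume "\<exists>p s0 s. s0 \<in> sosums \<and> (\<forall>j\<in>I. s j \<in> sosums) \<and>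
     a = (\<Sum>j\<in>E. c j * p j) + (s0 + (\<Sum>j\<in>I. c j * s j))"
  then obtain p s0 s where s: "s0 \<in> sosums" "\<forall>j\<in>I. s j \<in> sosums"
    "a = (\<Sum>j\<in>E. c j * p j) + (s0 + (\<Sum>j\<in>I. c j * s j))" by (elim exE conjE)
  have "(\<Sum>j\<in>E. c j * p j) \<in> ideal_gen E c"
    unfolding ideal_gen_def mem_Collect_eq by (rule exI[of _ p]) simp
  moreover have "s0 + (\<Sum>j\<in>I. c j * s j) \<in> qmodule I c"
    unfolding qmodule_def sos_eq_sosums mem_Collect_eq
    by (rule exI[of _ s0], rule exI[of _ s]) (intro conjI s(1,2) refl)
  ultimately show "a \<in> ideal_qmodule E I c"
    unfolding ideal_qmodule_def mem_Collect_eq s(3) by (iprover intro: refl)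
qed

lemma ideal_qmoduleI:
  assumes "s0 \<in> sosums" "\<And>j. j \<in> I \<Longrightarrow> s j \<in> sosums"
  shows "(\<Sum>j\<in>E. c j * p j) + (s0 + (\<Sum>j\<in>I. c j * s j)) \<in> ideal_qmodule E I c"
proof -
  have "\<forall>j\<in>I. s j \<in> sosums" using assms(2) by (rule ballI)
  with assms(1) show ?thesis
    unfolding ideal_qmodule_iff by (intro exI[of _ p] exI[of _ s0] exI[of _ s] conjI refl)
qed

lemma square_module_ideal_qmodule: "square_module (ideal_qmodule E I c)"
proof
  show "0 \<in> ideal_qmodule E I c"
    using ideal_qmoduleI[of 0 I "\<lambda>_. 0" c "\<lambda>_. 0" E] by (simp add: sosums.zero)
next
  fix x y assume "x \<in> ideal_qmodule E I c" "y \<in> ideal_qmodule E I c"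
  then obtain p s0 s p' s0' s' where *: "s0 \<in> sosums" "\<forall>j\<in>I. s j \<in> sosums"
    "x = (\<Sum>j\<in>E. c j * p j) + (s0 + (\<Sum>j\<in>I. c j * s j))"
    "s0' \<in> sosums" "\<forall>j\<in>I. s' j \<in> sosums"
    "y = (\<Sum>j\<in>E. c j * p' j) + (s0' + (\<Sum>j\<in>I. c j * s' j))"
    unfolding ideal_qmodule_iff by blast
  have "(\<Sum>j\<in>E. c j * (p j + p' j)) + ((s0 + s0') + (\<Sum>j\<in>I. c j * (s j + s' j))) \<in> ideal_qmodule E I c"
    using * by (intro ideal_qmoduleI sosums_add) auto
  also have "(\<Sum>j\<in>E. c j * (p j + p' j)) + ((s0 + s0') + (\<Sum>j\<in>I. c j * (s j + s' j))) = x + y"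
    unfolding *(3,6) by (simp add: algebra_simps sum.distrib)
  finally show "x + y \<in> ideal_qmodule E I c" .
next
  fix x a assume "x \<in> ideal_qmodule E I c"
  then obtain p s0 s where *: "s0 \<in> sosums" "\<forall>j\<in>I. s j \<in> sosums"
    "x = (\<Sum>j\<in>E. c j * p j) + (s0 + (\<Sum>j\<in>I. c j * s j))"
    unfolding ideal_qmodule_iff by blast
  have "(\<Sum>j\<in>E. c j * (a\<^sup>2 * p j)) + (a\<^sup>2 * s0 + (\<Sum>j\<in>I. c j * (a\<^sup>2 * s j))) \<in> ideal_qmodule E I c"
    using * by (intro ideal_qmoduleI sosums_mult_square) auto
  also have "(\<Sum>j\<in>E. c j * (a\<^sup>2 * p j)) + (a\<^sup>2 * s0 + (\<Sum>j\<in>I. c j * (a\<^sup>2 * s j))) = a\<^sup>2 * x"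
    unfolding *(3) by (simp add: distrib_left sum_distrib_left mult.left_commute)
  finally show "a\<^sup>2 * x \<in> ideal_qmodule E I c" .
qed

lemma sosums_in_ideal_qmodule: "s \<in> sosums \<Longrightarrow> s \<in> ideal_qmodule E I c"
  using ideal_qmoduleI[of s I "\<lambda>_. 0" c "\<lambda>_. 0" E] by (simp add: sosums.zero)

lemma equality_in_ideal_qmodule:
  assumes "finite E" "j \<in> E" shows "c j * p \<in> ideal_qmodule E I c"
proof -
  have "(\<Sum>i\<in>E. c i * (if i = j then p else 0)) = c j * p"
    using assms by (simp add: if_distrib[of "\<lambda>x. _ * x"] cong: if_cong)
  then show ?thesis
    using ideal_qmoduleI[of 0 I "\<lambda>_. 0" c "\<lambda>i. if i = j then p else 0" E]
    by (simp add: sosums.zero)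
qed

lemma inequality_in_ideal_qmodule:
  assumes "finite I" "j \<in> I" "s \<in> sosums" shows "c j * s \<in> ideal_qmodule E I c"
proof -
  have "(\<Sum>i\<in>I. c i * (if i = j then s else 0)) = c j * s"
    using assms by (simp add: if_distrib[of "\<lambda>x. _ * x"] cong: if_cong)
  then show ?thesis
    using ideal_qmoduleI[of 0 I "\<lambda>i. if i = j then s else 0" c "\<lambda>_. 0" E] assms(3)
    by (auto simp: sosums.zero)
qed

lemma sosums_nonneg: "s \<in> sosums \<Longrightarrow> 0 \<le> peval s x"
  by (induction rule: sosums.induct) auto

text \<open>Recovering \<open>K\<close> from the module lets the global argument work with
  \<open>M\<close> alone, without the constraints.\<close>

lemma semialg_iff_ideal_qmodule_nonneg:
  assumes "finite E" "finite I"
  shows "x \<in> semialg E I c \<longleftrightarrow> (\<forall>p\<in>ideal_qmodule E I c. 0 \<le> peval p x)"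
proof
  assume "x \<in> semialg E I c"
  then have *: "\<And>j. j \<in> E \<Longrightarrow> peval (c j) x = 0" "\<And>j. j \<in> I \<Longrightarrow> 0 \<le> peval (c j) x"
    by (auto simp: semialg_def)
  show "\<forall>p\<in>ideal_qmodule E I c. 0 \<le> peval p x"
  proof
    fix p assume "p \<in> ideal_qmodule E I c"
    then obtain q s0 s where s: "s0 \<in> sosums" "\<forall>j\<in>I. s j \<in> sosums"
      "p = (\<Sum>j\<in>E. c j * q j) + (s0 + (\<Sum>j\<in>I. c j * s j))"
      unfolding ideal_qmodule_iff by blast
    have "peval p x = peval s0 x + (\<Sum>j\<in>I. peval (c j) x * peval (s j) x)"
      by (simp add: s(3) *(1))
    then show "0 \<le> peval p x"
      using s(1,2) *(2) sosums_nonneg by (auto intro!: add_nonneg_nonneg sum_nonneg mult_nonneg_nonneg)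
  qed
next
  assume nn: "\<forall>p\<in>ideal_qmodule E I c. 0 \<le> peval p x"
  have "peval (c j) x = 0" if "j \<in> E" for j
    using bspec[OF nn equality_in_ideal_qmodule[OF assms(1) that, of c 1 I]]
      bspec[OF nn equality_in_ideal_qmodule[OF assms(1) that, of c "-1" I]] by simp
  moreover have "0 \<le> peval (c j) x" if "j \<in> I" for j
    using bspec[OF nn inequality_in_ideal_qmodule[OF assms(2) that sosums_square[of 1], of c E]]
    by simp
  ultimately show "x \<in> semialg E I c" by (simp add: semialg_def)
qed

text \<open>The elements whose square is bounded by a constant modulo \<open>M\<close> form a
  subalgebra: sums use \<open>(p - q)\<^sup>2\<close>, products replace one factor at a time, for
  which \<open>N\<close> must be nonnegative. Adding \<open>(p - of_real (1/2))\<^sup>2\<close> then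
  turns a bound on the square into a bound on \<open>p\<close>.\<close>

lemma archimedean_poly_moduleI:
  fixes M :: "'n::finite rpoly set"
  assumes M: "square_module M" and one: "1 \<in> M" and R: "of_real R - (\<Sum>i\<in>UNIV. (var i)\<^sup>2) \<in> M"
  shows "archimedean_poly_module M"
proof -
  interpret square_module M by fact
  have sq: "a\<^sup>2 \<in> M" for a using square_mult_mem[OF one, of a] by simp
  have "\<exists>N\<ge>0. of_real N - p\<^sup>2 \<in> M" for p
  proof (induction p rule: rpoly_induct)
    case (const r)
    show ?case by (rule exI[of _ "r\<^sup>2"]) (simp add: zero_mem)
  next
    case (var i)
    have "(of_real R - (\<Sum>i\<in>UNIV. (var i)\<^sup>2)) + (\<Sum>j\<in>UNIV - {i}. (var j)\<^sup>2) \<in> M"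
      by (intro add_mem R sum_mem sq)
    then have *: "of_real R - (var i)\<^sup>2 \<in> M" by (simp add: sum.remove[of UNIV i])
    have "of_real (max R 0 - R) + (of_real R - (var i)\<^sup>2) \<in> M"
      using scaleR_mem[OF _ one, of "max R 0 - R"] by (intro add_mem *) (simp add: scaleR_conv_of_real)
    then show ?case by (intro exI[of _ "max R 0"]) simp
  next
    case (add p q)
    then obtain N K where N: "0 \<le> N" "of_real N - p\<^sup>2 \<in> M" "0 \<le> K" "of_real K - q\<^sup>2 \<in> M" by blast
    have "2 *\<^sub>R (of_real N - p\<^sup>2) + (2 *\<^sub>R (of_real K - q\<^sup>2) + (p - q)\<^sup>2) \<in> M"
      by (intro add_mem scaleR_mem sq N) auto
    also have "2 *\<^sub>R (of_real N - p\<^sup>2) + (2 *\<^sub>R (of_real K - q\<^sup>2) + (p - q)\<^sup>2)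
        = of_real (2 * N + 2 * K) - (p + q)\<^sup>2"
      by (simp add: scaleR_conv_of_real power2_eq_square algebra_simps)
    finally show ?case using N by (intro exI[of _ "2 * N + 2 * K"]) simp
  next
    case (mult p q)
    then obtain N K where N: "0 \<le> N" "of_real N - p\<^sup>2 \<in> M" "0 \<le> K" "of_real K - q\<^sup>2 \<in> M" by blast
    have "N *\<^sub>R (of_real K - q\<^sup>2) + q\<^sup>2 * (of_real N - p\<^sup>2) \<in> M"
      by (intro add_mem scaleR_mem square_mult_mem N)
    also have "N *\<^sub>R (of_real K - q\<^sup>2) + q\<^sup>2 * (of_real N - p\<^sup>2) = of_real (N * K) - (p * q)\<^sup>2"
      by (simp add: scaleR_conv_of_real power2_eq_square algebra_simps)
    finally show ?case using N by (intro exI[of _ "N * K"]) simp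
  qed
  then have "\<exists>N. of_real N - p \<in> M" for p
  proof -
    obtain N where "of_real N - p\<^sup>2 \<in> M" using \<open>\<And>p. \<exists>N\<ge>0. of_real N - p\<^sup>2 \<in> M\<close> by blast
    then have "(of_real N - p\<^sup>2) + (p - of_real (1/2))\<^sup>2 \<in> M" by (intro add_mem sq)
    also have "(of_real N - p\<^sup>2) + (p - of_real (1/2))\<^sup>2 = of_real (N + 1/4) - of_real (2 * (1/2)) * p"
      by (simp only: power2_eq_square of_real_add of_real_mult of_real_numeral algebra_simps)
        (simp add: power2_eq_square flip: of_real_mult)
    finally show ?thesis by (intro exI[of _ "N + 1/4"]) simp
  qed
  then show ?thesis
    using one by unfold_locales auto
qed

lemma var_square: "(var i)\<^sup>2 = monomial (Poly_Mapping.single i 2)"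
  unfolding var_def power2_eq_square monomial_add[symmetric] single_add[symmetric]
  by (simp only: one_add_one)

lemma archimedean_sum_obtain:
  assumes "archimedean_sum (ideal_gen E c) (qmodule I c)"
  obtains R where "0 < R" "of_real R - (\<Sum>i\<in>UNIV. (var i)\<^sup>2) \<in> ideal_qmodule E I c"
proof -
  from assms obtain R p q where R: "0 < R" "p \<in> ideal_gen E c" "q \<in> qmodule I c"
    "Poly_Mapping.single 0 R - sqnorm_poly = p + q" unfolding archimedean_sum_def by blast
  have "of_real R - (\<Sum>i\<in>UNIV. (var i)\<^sup>2) = p + q"
    using R(4) by (simp only: of_real_eq_single sqnorm_poly_def var_square)
  then have "of_real R - (\<Sum>i\<in>UNIV. (var i)\<^sup>2) \<in> ideal_qmodule E I c"
    unfolding ideal_qmodule_def mem_Collect_eq using R(2,3) by iprover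
  then show ?thesis using that R(1) by blast
qed

lemma archimedean_ideal_qmodule:
  assumes "archimedean_sum (ideal_gen E c) (qmodule I c)"
  shows "archimedean_poly_module (ideal_qmodule E I c)"
proof -
  obtain R where R: "of_real R - (\<Sum>i\<in>UNIV. (var i)\<^sup>2) \<in> ideal_qmodule E I c"
    using archimedean_sum_obtain[OF assms] .
  have "1 \<in> ideal_qmodule E I c"
    using sosums_in_ideal_qmodule[OF sosums_square[of 1]] by simp
  from archimedean_poly_moduleI[OF square_module_ideal_qmodule this R] show ?thesis .
qed

lemma compact_semialg:
  assumes fin: "finite E" "finite I" and arch: "archimedean_sum (ideal_gen E c) (qmodule I c)"
  shows "compact (semialg E I c)"
proof -
  obtain R where R: "of_real R - (\<Sum>i\<in>UNIV. (var i)\<^sup>2) \<in> ideal_qmodule E I c"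
    using archimedean_sum_obtain[OF arch] .
  have "norm x \<le> sqrt R" if "x \<in> semialg E I c" for x
  proof -
    have "0 \<le> peval (of_real R - (\<Sum>i\<in>UNIV. (var i)\<^sup>2)) x"
      using that R semialg_iff_ideal_qmodule_nonneg[OF fin] by blast
    then have "(norm x)\<^sup>2 \<le> R"
      by (simp add: power2_norm_eq_inner inner_vec_def) (simp add: power2_eq_square)
    then show ?thesis by (rule real_le_rsqrt)
  qed
  then have "bounded (semialg E I c)" by (auto simp: bounded_iff)
  moreover have "closed (semialg E I c)"
  proof -
    have "semialg E I c = (\<Inter>j\<in>E. {x. peval (c j) x = 0}) \<inter> (\<Inter>j\<in>I. {x. 0 \<le> peval (c j) x})"
      by (auto simp: semialg_def)
    also have "closed \<dots>"
      by (intro closed_Int closed_INT ballI closed_Collect_eq closed_Collect_le continuous_on_const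
          continuous_on_peval)
    finally show ?thesis .
  qed
  ultimately show ?thesis by (simp add: compact_eq_bounded_closed)
qed

section \<open>From the optimality conditions to local certificates\<close>

section \<open>The second order conditions\<close>

lemma hessian_form:
  "z \<bullet> (hessian p x *v z) = (\<Sum>i\<in>UNIV. \<Sum>j\<in>UNIV. z $ i * z $ j * peval (pderiv_var i (pderiv_var j p)) x)"
  unfolding inner_vec_def matrix_vector_mult_def hessian_def inner_real_def vec_lambda_beta sum_distrib_left
  by (intro sum.cong refl) (simp only: mult_ac)

lemma DERIV_peval_line:
  "((\<lambda>t. peval p (v + t *\<^sub>R d)) has_real_derivative d \<bullet> grad p (v + t *\<^sub>R d)) (at t)"
proof -
  have "((\<lambda>t. v + t *\<^sub>R d) has_derivative (\<lambda>s. s *\<^sub>R d)) (at t)"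
    by (auto intro!: derivative_eq_intros)
  moreover have "(peval p has_derivative (\<lambda>h. h \<bullet> grad p (v + t *\<^sub>R d))) (at (v + t *\<^sub>R d))"
    using grad_GDERIV[of p "v + t *\<^sub>R d"] by (simp add: gderiv_def)
  ultimately have "((\<lambda>t. peval p (v + t *\<^sub>R d)) has_derivative (\<lambda>s. (s *\<^sub>R d) \<bullet> grad p (v + t *\<^sub>R d))) (at t)"
    by (rule has_derivative_compose)
  moreover have "(\<lambda>s. (s *\<^sub>R d) \<bullet> grad p (v + t *\<^sub>R d)) = (*) (d \<bullet> grad p (v + t *\<^sub>R d))"
    by (simp add: fun_eq_iff)
  ultimately show ?thesis by (simp only: has_field_derivative_def)
qed

lemma taylor_second_order:
  assumes "peval p v = 0" "grad p v = 0"
  shows "\<exists>t. 0 < t \<and> t < 1 \<and> peval p (v + d) = (d \<bullet> (hessian p (v + t *\<^sub>R d) *v d)) / 2"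
proof -
  define diff where "diff m t = (if m = 0 then peval p (v + t *\<^sub>R d)
    else if m = 1 then d \<bullet> grad p (v + t *\<^sub>R d) else d \<bullet> (hessian p (v + t *\<^sub>R d) *v d))" for m :: nat and t
  have d0: "DERIV (diff 0) t :> diff 1 t" for t
    using DERIV_peval_line[of p v d t] by (simp add: diff_def[abs_def])
  have d1: "DERIV (diff 1) t :> diff 2 t" for t
  proof -
    have "((\<lambda>t. \<Sum>i\<in>UNIV. d $ i * peval (pderiv_var i p) (v + t *\<^sub>R d)) has_real_derivative
        (\<Sum>i\<in>UNIV. d $ i * (d \<bullet> grad (pderiv_var i p) (v + t *\<^sub>R d)))) (at t)"
      by (intro DERIV_sum DERIV_cmult DERIV_peval_line)
    moreover have "(\<Sum>i\<in>UNIV. d $ i * (d \<bullet> grad (pderiv_var i p) (v + t *\<^sub>R d)))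
        = d \<bullet> (hessian p (v + t *\<^sub>R d) *v d)"
      unfolding hessian_form
      by (subst sum.swap) (simp add: inner_vec_def grad_def sum_distrib_left mult_ac)
    ultimately show ?thesis
      by (simp add: diff_def[abs_def] inner_vec_def grad_def)
  qed
  have "\<exists>t>0. t < 1 \<and> peval p (v + 1 *\<^sub>R d) = (\<Sum>m<2. diff m 0 / fact m * 1 ^ m) + diff 2 t / fact 2 * 1 ^ 2"
  proof (rule Maclaurin)
    show "diff 0 = (\<lambda>t. peval p (v + t *\<^sub>R d))" by (simp add: diff_def[abs_def])
    show "\<forall>m t. m < 2 \<and> 0 \<le> t \<and> t \<le> 1 \<longrightarrow> DERIV (diff m) t :> diff (Suc m) t"
      using d0 d1 by (auto simp: numeral_2_eq_2 less_Suc_eq)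
  qed simp_all
  then obtain t where t: "0 < t" "t < 1"
    "peval p (v + d) = (\<Sum>m<2. diff m 0 / fact m) + diff 2 t / 2" by auto
  have "(\<Sum>m<2. diff m 0 / fact m) = diff 0 0 + diff 1 0" by (simp add: numeral_2_eq_2)
  then show ?thesis using t assms by (intro exI[of _ t]) (simp add: diff_def)
qed

lemma second_order_limit:
  fixes X :: "nat \<Rightarrow> real^'n::finite"
  assumes p: "peval p v = 0" "grad p v = 0" and X: "X \<longlonglongrightarrow> v" "\<And>n. X n \<noteq> v"
    and z: "(\<lambda>n. (1 / norm (X n - v)) *\<^sub>R (X n - v)) \<longlonglongrightarrow> z"
  shows "(\<lambda>n. peval p (X n) / (norm (X n - v))\<^sup>2) \<longlonglongrightarrow> (z \<bullet> (hessian p v *v z)) / 2"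
proof -
  have "\<exists>t. 0 < t \<and> t < 1 \<and> peval p (X n) = ((X n - v) \<bullet> (hessian p (v + t *\<^sub>R (X n - v)) *v (X n - v))) / 2" for n
    using taylor_second_order[OF p, of "X n - v"] by simp
  then obtain t where t: "\<And>n. 0 < t n" "\<And>n. t n < 1"
    "\<And>n. peval p (X n) = ((X n - v) \<bullet> (hessian p (v + t n *\<^sub>R (X n - v)) *v (X n - v))) / 2" by metis
  define Y where "Y n = v + t n *\<^sub>R (X n - v)" for n
  define U where "U n = (1 / norm (X n - v)) *\<^sub>R (X n - v)" for n
  have "(\<lambda>n. t n *\<^sub>R (X n - v)) \<longlonglongrightarrow> 0"
  proof (rule Lim_null_comparison)
    show "\<forall>\<^sub>F n in sequentially. norm (t n *\<^sub>R (X n - v)) \<le> norm (X n - v)"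
      using t by (auto intro!: always_eventually mult_left_le_one_le simp: less_imp_le)
    show "(\<lambda>n. norm (X n - v)) \<longlonglongrightarrow> 0"
      using X(1) by (simp add: LIM_zero_iff tendsto_norm_zero)
  qed
  then have Y: "Y \<longlonglongrightarrow> v"
    using tendsto_add[OF tendsto_const[of v]] by (fastforce simp: Y_def[abs_def])
  have eq: "peval p (X n) / (norm (X n - v))\<^sup>2
      = (\<Sum>i\<in>UNIV. \<Sum>j\<in>UNIV. U n $ i * U n $ j * peval (pderiv_var i (pderiv_var j p)) (Y n)) / 2" for n
  proof -
    define k where "k = norm (X n - v)"
    have k0: "k \<noteq> 0" using X(2)[of n] by (simp add: k_def)
    have Xk: "X n - v = k *\<^sub>R U n" using X(2)[of n] by (simp add: U_def k_def)
    have "(X n - v) \<bullet> (hessian p (Y n) *v (X n - v)) = k\<^sup>2 * (U n \<bullet> (hessian p (Y n) *v U n))"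
      unfolding Xk
      by (simp only: matrix_vector_mult_scaleR inner_scaleR_left inner_scaleR_right)
        (simp add: power2_eq_square)
    then show ?thesis
      using k0 by (simp add: t(3) Y_def[symmetric] hessian_form k_def[symmetric])
  qed
  have U: "U \<longlonglongrightarrow> z" using z by (simp add: U_def[abs_def])
  have "(\<lambda>n. U n $ i * U n $ j * peval (pderiv_var i (pderiv_var j p)) (Y n)) \<longlonglongrightarrow>
      z $ i * z $ j * peval (pderiv_var i (pderiv_var j p)) v" for i j
    by (intro tendsto_mult tendsto_vec_nth U isCont_tendsto_compose[OF isCont_peval Y])
  then show ?thesis
    unfolding eq hessian_form by (intro tendsto_divide tendsto_sum tendsto_const) simp_all
qed

lemma first_order_limit:
  fixes X :: "nat \<Rightarrow> real^'n::finite"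
  assumes p: "peval p v = 0" and X: "X \<longlonglongrightarrow> v" "\<And>n. X n \<noteq> v"
    and z: "(\<lambda>n. (1 / norm (X n - v)) *\<^sub>R (X n - v)) \<longlonglongrightarrow> z"
  shows "(\<lambda>n. peval p (X n) / norm (X n - v)) \<longlonglongrightarrow> z \<bullet> grad p v"
proof -
  have "(peval p has_derivative (\<lambda>h. h \<bullet> grad p v)) (at v)"
    using grad_GDERIV[of p v] by (simp add: gderiv_def)
  then have lim: "((\<lambda>h. norm (peval p (v + h) - peval p v - h \<bullet> grad p v) / norm h) \<longlongrightarrow> 0) (at 0)"
    by (simp add: has_derivative_at)
  have "filterlim (\<lambda>n. X n - v) (at 0) sequentially"
    using X by (auto simp: filterlim_at LIM_zero_iff)
  from filterlim_compose[OF lim this]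
  have "(\<lambda>n. norm ((peval p (X n) - (X n - v) \<bullet> grad p v) / norm (X n - v))) \<longlonglongrightarrow> 0"
    by (simp add: p)
  then have "(\<lambda>n. (peval p (X n) - (X n - v) \<bullet> grad p v) / norm (X n - v)) \<longlonglongrightarrow> 0"
    by (rule tendsto_norm_zero_cancel)
  from tendsto_add[OF this tendsto_inner[OF z tendsto_const[of "grad p v"]]]
  show ?thesis by (simp add: diff_divide_distrib)
qed

text \<open>If no penalty suffices, then for each \<open>n\<close> some point violates the estimate
  with penalty \<open>Suc n\<close> and growth constant \<open>1 / Suc n\<close>. Along a
  subsequence the directions from \<open>v\<close> converge to a unit vector \<open>z\<close>: the
  growing penalty makes \<open>z\<close> orthogonal to the gradients, while the Hessian form at
  \<open>z\<close> is not positive.\<close>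

lemma quadratic_growth_of_augmented_lagrangian:
  fixes \<Lambda> :: "'n::finite rpoly" and c :: "'j \<Rightarrow> 'n rpoly"
  assumes J: "finite J" and \<Lambda>: "peval \<Lambda> v = 0" "grad \<Lambda> v = 0"
    and c: "\<And>j. j \<in> J \<Longrightarrow> peval (c j) v = 0"
    and pos: "\<And>z. z \<noteq> 0 \<Longrightarrow> (\<And>j. j \<in> J \<Longrightarrow> z \<bullet> grad (c j) v = 0) \<Longrightarrow> 0 < z \<bullet> (hessian \<Lambda> v *v z)"
  shows "\<exists>C>0. \<exists>\<delta>>0. \<forall>\<^sub>F x in nhds v.
      \<delta> * (norm (x - v))\<^sup>2 \<le> peval \<Lambda> x + C * (\<Sum>j\<in>J. (peval (c j) x)\<^sup>2)"
proof (rule ccontr)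
  assume neg: "\<not> ?thesis"
  have "\<exists>x. norm (x - v) < 1 / real (Suc n) \<and>
      peval \<Lambda> x + real (Suc n) * (\<Sum>j\<in>J. (peval (c j) x)\<^sup>2) < (1 / real (Suc n)) * (norm (x - v))\<^sup>2" for n
  proof (rule ccontr)
    assume no: "\<not> ?thesis"
    have "\<forall>\<^sub>F x in nhds v. dist x v < 1 / real (Suc n)"
      by (rule eventually_nhds_metric[THEN iffD2]) (auto intro!: exI[of _ "1 / real (Suc n)"])
    then have "\<forall>\<^sub>F x in nhds v. (1 / real (Suc n)) * (norm (x - v))\<^sup>2
        \<le> peval \<Lambda> x + real (Suc n) * (\<Sum>j\<in>J. (peval (c j) x)\<^sup>2)"
      using no by (elim eventually_mono) (metis dist_norm not_less)
    moreover have "0 < real (Suc n)" "0 < 1 / real (Suc n)" by simp_all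
    ultimately show False using neg by blast
  qed
  then obtain x where x: "\<And>n. norm (x n - v) < 1 / real (Suc n)"
    "\<And>n. peval \<Lambda> (x n) + real (Suc n) * (\<Sum>j\<in>J. (peval (c j) (x n))\<^sup>2) < (1 / real (Suc n)) * (norm (x n - v))\<^sup>2"
    by metis
  have xv: "x n \<noteq> v" for n
  proof
    assume "x n = v"
    then show False using x(2)[of n] \<Lambda> c by simp
  qed
  define U where "U n = (1 / norm (x n - v)) *\<^sub>R (x n - v)" for n
  have "U n \<in> sphere 0 1" for n using xv[of n] by (simp add: U_def)
  then obtain z r where z: "z \<in> sphere 0 1" "strict_mono r" "(U \<circ> r) \<longlonglongrightarrow> z"
    using compact_sphere[of 0 "1::real"] unfolding compact_def by metis
  define X where "X n = x (r n)" for n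
  have xlim: "x \<longlonglongrightarrow> v"
  proof (rule LIM_zero_cancel, rule Lim_null_comparison)
    show "\<forall>\<^sub>F n in sequentially. norm (x n - v) \<le> 1 / real (Suc n)"
      using x(1) by (auto intro!: always_eventually less_imp_le)
    show "(\<lambda>n. 1 / real (Suc n)) \<longlonglongrightarrow> 0" by (rule LIMSEQ_Suc[OF lim_1_over_n])
  qed
  have X: "X \<longlonglongrightarrow> v" "\<And>n. X n \<noteq> v" "(\<lambda>n. (1 / norm (X n - v)) *\<^sub>R (X n - v)) \<longlonglongrightarrow> z"
    using LIMSEQ_subseq_LIMSEQ[OF xlim z(2)] xv z(3) by (auto simp: X_def[abs_def] o_def U_def[abs_def])
  \<comment> \<open>The growth constant is also the reciprocal of the penalty, so
    \<open>ineq\<close> bounds \<open>q\<close> by \<open>h\<close> and \<open>s\<close> by the null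
    sequence \<open>h n * (h n - q n)\<close>.\<close>
  define h where "h n = 1 / real (Suc (r n))" for n
  have h0: "h \<longlonglongrightarrow> 0"
    using LIMSEQ_subseq_LIMSEQ[OF LIMSEQ_Suc[OF lim_1_over_n] z(2)] by (simp add: h_def[abs_def] o_def)
  have hpos: "0 < h n" for n by (simp add: h_def)
  define q where "q n = peval \<Lambda> (X n) / (norm (X n - v))\<^sup>2" for n
  define s where "s n = (\<Sum>j\<in>J. (peval (c j) (X n) / norm (X n - v))\<^sup>2)" for n
  have ineq: "q n + s n / h n < h n" for n
  proof -
    have n0: "0 < (norm (X n - v))\<^sup>2" using X(2)[of n] by simp
    have "(peval \<Lambda> (X n) + real (Suc (r n)) * (\<Sum>j\<in>J. (peval (c j) (X n))\<^sup>2)) / (norm (X n - v))\<^sup>2 < h n"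
      using x(2)[of "r n"] n0 by (subst pos_divide_less_eq) (auto simp: X_def h_def)
    then show ?thesis
      by (simp add: q_def s_def h_def add_divide_distrib power_divide sum_divide_distrib mult.commute
          flip: sum_divide_distrib)
  qed
  have qlim: "q \<longlonglongrightarrow> (z \<bullet> (hessian \<Lambda> v *v z)) / 2"
    unfolding q_def by (rule second_order_limit[OF \<Lambda> X])
  have slim: "s \<longlonglongrightarrow> (\<Sum>j\<in>J. (z \<bullet> grad (c j) v)\<^sup>2)"
    unfolding s_def by (intro tendsto_sum tendsto_power first_order_limit[OF _ X] c)
  have s0: "0 \<le> s n" for n by (simp add: s_def sum_nonneg)
  have "(z \<bullet> (hessian \<Lambda> v *v z)) / 2 \<le> 0"
  proof (rule LIMSEQ_le[OF qlim h0], intro exI[of _ 0] allI impI)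
    fix n show "q n \<le> h n"
      using ineq[of n] divide_nonneg_pos[OF s0 hpos, of n n] by linarith
  qed
  moreover have "(\<Sum>j\<in>J. (z \<bullet> grad (c j) v)\<^sup>2) \<le> 0"
  proof (rule LIMSEQ_le[OF slim])
    show "(\<lambda>n. h n * (h n - q n)) \<longlonglongrightarrow> 0"
      using tendsto_mult[OF h0 tendsto_diff[OF h0 qlim]] by simp
    show "\<exists>N. \<forall>n\<ge>N. s n \<le> h n * (h n - q n)"
    proof (intro exI allI impI)
      fix n
      have "s n / h n \<le> h n - q n" using ineq[of n] by linarith
      then show "s n \<le> h n * (h n - q n)" using hpos[of n] by (simp add: pos_divide_le_eq mult.commute)
    qed
  qed
  then have "z \<bullet> grad (c j) v = 0" if "j \<in> J" for j
    using J that sum_nonneg_eq_0_iff[of J "\<lambda>j. (z \<bullet> grad (c j) v)\<^sup>2"]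
      sum_nonneg[of J "\<lambda>j. (z \<bullet> grad (c j) v)\<^sup>2"] by (simp add: antisym)
  moreover have "z \<noteq> 0" using z(1) by auto
  ultimately show False using pos[of z] by force
qed

text \<open>Uniqueness of derivatives replaces a computation with the coefficients in
  \<open>pderiv_var\<close>.\<close>

lemma grad_lagrangian:
  fixes F :: "'n::finite rpoly"
  shows "grad (F - (\<Sum>j\<in>S. l j *\<^sub>R c j)) x = grad F x - (\<Sum>j\<in>S. l j *\<^sub>R grad (c j) x)"
proof -
  have g: "(peval p has_derivative (\<lambda>h. h \<bullet> grad p x)) (at x)" for p :: "'n rpoly"
    using grad_GDERIV[of p x] by (simp add: gderiv_def)
  have "((\<lambda>x. peval F x - (\<Sum>j\<in>S. l j * peval (c j) x)) has_derivative
      (\<lambda>h. h \<bullet> grad F x - (\<Sum>j\<in>S. l j * (h \<bullet> grad (c j) x)))) (at x)"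
    by (intro has_derivative_diff has_derivative_sum has_derivative_mult_right g)
  moreover have "peval (F - (\<Sum>j\<in>S. l j *\<^sub>R c j)) = (\<lambda>x. peval F x - (\<Sum>j\<in>S. l j * peval (c j) x))"
    by (simp add: fun_eq_iff)
  ultimately have "(\<lambda>h. h \<bullet> grad (F - (\<Sum>j\<in>S. l j *\<^sub>R c j)) x)
      = (\<lambda>h. h \<bullet> grad F x - (\<Sum>j\<in>S. l j * (h \<bullet> grad (c j) x)))"
    by (intro has_derivative_unique[OF g]) simp
  then have "h \<bullet> grad (F - (\<Sum>j\<in>S. l j *\<^sub>R c j)) x = h \<bullet> (grad F x - (\<Sum>j\<in>S. l j *\<^sub>R grad (c j) x))" for h
    by (simp add: inner_diff_right inner_sum_right fun_eq_iff)
  then show ?thesis using vector_eq_ldot by blast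
qed

text \<open>Each multiplier becomes a polynomial \<open>T j\<close> that equals \<open>l j\<close>
  at \<open>v\<close> and falls below it by about \<open>(C + 1) * c j\<close> to first order. Then
  \<open>F - S\<close> is the Lagrangian plus a penalty, whereas membership of \<open>S\<close> asks
  only that \<open>T j\<close> be a square at the inequalities.\<close>

lemma local_certificate:
  fixes F :: "'n::finite rpoly" and c :: "'j \<Rightarrow> 'n rpoly"
  assumes fin: "finite E" "finite I" and disj: "E \<inter> I = {}"
    and v: "v \<in> semialg E I c" and F: "peval F v = 0"
    and mult: "multipliers E I c F v l" and SCC: "SCC I c v l" and SOSC: "SOSC E I c F v l"
  shows "\<exists>S\<in>ideal_qmodule E I c. peval S v = 0 \<and> quadratic_growth_at v (F - S)"
proof -
  define J where "J = active_set E I c v"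
  define \<Lambda> where "\<Lambda> = F - (\<Sum>j\<in>E \<union> I. l j *\<^sub>R c j)"
  have J: "finite J" "E \<subseteq> J" "J \<subseteq> E \<union> I" and cJ: "\<And>j. j \<in> J \<Longrightarrow> peval (c j) v = 0"
    using fin v by (auto simp: J_def active_set_def semialg_def)
  have inactive: "l j = 0" if "j \<in> E \<union> I - J" for j
    using that mult v by (auto simp: J_def active_set_def multipliers_def semialg_def)
  \<comment> \<open>Strict complementarity enters here; \<open>\<beta> j\<close> divides by the root
    of \<open>l j\<close>.\<close>
  have active: "0 < l j" if "j \<in> J - E" for j
    using that SCC cJ[of j] by (auto simp: SCC_def J_def active_set_def)
  have "l j * peval (c j) v = 0" if "j \<in> E \<union> I" for j
    using that inactive[of j] cJ[of j] by (cases "j \<in> J") auto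
  then have "(\<Sum>j\<in>E \<union> I. l j * peval (c j) v) = 0" by (intro sum.neutral ballI)
  then have "peval \<Lambda> v = 0" using F by (simp add: \<Lambda>_def)
  moreover have "grad \<Lambda> v = 0"
    using mult by (simp add: \<Lambda>_def grad_lagrangian multipliers_def)
  ultimately have "\<exists>C>0. \<exists>\<delta>>0. \<forall>\<^sub>F x in nhds v.
      \<delta> * (norm (x - v))\<^sup>2 \<le> peval \<Lambda> x + C * (\<Sum>j\<in>J. (peval (c j) x)\<^sup>2)"
    using SOSC J(1) cJ
    by (intro quadratic_growth_of_augmented_lagrangian) (auto simp: SOSC_def \<Lambda>_def J_def)
  then obtain C \<delta> where C: "0 < C" and \<delta>: "0 < \<delta>"
    "\<forall>\<^sub>F x in nhds v. \<delta> * (norm (x - v))\<^sup>2 \<le> peval \<Lambda> x + C * (\<Sum>j\<in>J. (peval (c j) x)\<^sup>2)"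
    by blast
  \<comment> \<open>A multiplier \<open>l j > 0\<close> of an inequality is replaced by \<open>(sqrt (l j) - \<beta> j c\<^sub>j)\<^sup>2 = l j - (C + 1) c\<^sub>j + \<dots>\<close>,
    a square that produces the penalty term \<open>(C + 1) c\<^sub>j\<^sup>2\<close> up to third order.\<close>
  define \<beta> where "\<beta> j = (C + 1) / (2 * sqrt (l j))" for j
  define T where "T j = (if j \<in> E then of_real (l j) - of_real (C + 1) * c j
      else (of_real (sqrt (l j)) - of_real (\<beta> j) * c j)\<^sup>2)" for j
  define S where "S = (\<Sum>j\<in>J. c j * T j)"
  interpret square_module "ideal_qmodule E I c" by (rule square_module_ideal_qmodule)
  have "c j * T j \<in> ideal_qmodule E I c" if "j \<in> J" for j
  proof (cases "j \<in> E")
    case True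
    then show ?thesis by (intro equality_in_ideal_qmodule fin(1))
  next
    case False
    then have "j \<in> I" using that J(3) by blast
    then show ?thesis
      unfolding T_def using False
      by (simp only: if_False) (intro inequality_in_ideal_qmodule fin(2) sosums_square)
  qed
  then have S_mem: "S \<in> ideal_qmodule E I c" unfolding S_def by (rule sum_mem)
  have S_v: "peval S v = 0" by (simp add: S_def cJ)
  have FS: "peval (F - S) x = peval \<Lambda> x + (\<Sum>j\<in>J. peval (c j) x * (l j - peval (T j) x))" for x
  proof -
    have "(\<Sum>j\<in>E \<union> I. l j * peval (c j) x) = (\<Sum>j\<in>J. l j * peval (c j) x)"
      using fin J inactive by (intro sum.mono_neutral_right) auto
    then show ?thesis
      by (simp add: \<Lambda>_def S_def algebra_simps sum_subtractf)
  qed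
  \<comment> \<open>Close to \<open>v\<close> the cubic error
    \<open>(\<beta> j)\<^sup>2 * y * (y * y)\<close> costs at most \<open>y * y\<close>. This is the
    1 in \<open>C + 1\<close>.\<close>
  have "\<forall>\<^sub>F x in nhds v. \<forall>j\<in>J. (\<beta> j)\<^sup>2 * peval (c j) x < 1"
  proof (rule eventually_ball_finite[OF J(1)], rule ballI)
    fix j assume "j \<in> J"
    have "((\<lambda>x. (\<beta> j)\<^sup>2 * peval (c j) x) \<longlongrightarrow> (\<beta> j)\<^sup>2 * peval (c j) v) (nhds v)"
      using isCont_peval[of v "c j"] by (intro tendsto_intros) (simp add: continuous_at tendsto_at_iff_tendsto_nhds)
    then show "\<forall>\<^sub>F x in nhds v. (\<beta> j)\<^sup>2 * peval (c j) x < 1"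
      by (rule order_tendstoD(2)) (simp add: cJ[OF \<open>j \<in> J\<close>])
  qed
  then have "\<forall>\<^sub>F x in nhds v. \<delta> * (norm (x - v))\<^sup>2 \<le> peval (F - S) x"
    using \<delta>(2)
  proof eventually_elim
    case (elim x)
    have "C * (peval (c j) x)\<^sup>2 \<le> peval (c j) x * (l j - peval (T j) x)" if j: "j \<in> J" for j
    proof (cases "j \<in> E")
      case True
      then show ?thesis by (simp add: T_def power2_eq_square algebra_simps)
    next
      case False
      define y where "y = peval (c j) x"
      have l: "0 < l j" using active j False by auto
      have ab: "2 * sqrt (l j) * \<beta> j = C + 1" using l by (simp add: \<beta>_def)
      have "y * (l j - peval (T j) x) = y * (l j - (sqrt (l j))\<^sup>2) + y * y * (2 * sqrt (l j) * \<beta> j) - (\<beta> j)\<^sup>2 * y * (y * y)"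
        using False by (simp add: T_def y_def power2_eq_square algebra_simps)
      also have "\<dots> = (C + 1) * (y * y) - (\<beta> j)\<^sup>2 * y * (y * y)"
        unfolding ab using l by simp
      also have "\<dots> \<ge> (C + 1) * (y * y) - 1 * (y * y)"
        using elim(1) j by (intro diff_left_mono mult_right_mono) (auto simp: y_def less_imp_le)
      finally show ?thesis by (simp add: y_def power2_eq_square algebra_simps)
    qed
    then have "C * (\<Sum>j\<in>J. (peval (c j) x)\<^sup>2) \<le> (\<Sum>j\<in>J. peval (c j) x * (l j - peval (T j) x))"
      unfolding sum_distrib_left by (rule sum_mono)
    then show ?case using elim(2) FS[of x] by linarith
  qed
  then show ?thesis using S_mem S_v \<delta>(1) by blast
qed

section \<open>Gluing the local certificates\<close>

lemma vanishing_lipschitz: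
  fixes q :: "'n::finite rpoly"
  assumes "peval q v = 0"
  shows "\<exists>C\<ge>0. \<forall>x\<in>cball v 1. \<bar>peval q x\<bar> \<le> C * norm (x - v)"
proof -
  obtain h where h: "q = (\<Sum>i\<in>UNIV. h i * shift v i)"
    using hadamard[of q v] assms by (auto simp: shift_def)
  have "\<exists>B. \<forall>x\<in>cball v 1. \<bar>peval (h i) x\<bar> \<le> B" for i
  proof -
    have "bounded (peval (h i) ` cball v 1)"
      by (intro compact_imp_bounded compact_continuous_image continuous_on_peval compact_cball)
    then show ?thesis by (auto simp: bounded_iff)
  qed
  then obtain B where B: "\<And>i x. x \<in> cball v 1 \<Longrightarrow> \<bar>peval (h i) x\<bar> \<le> B i" by metis
  have "\<bar>peval q x\<bar> \<le> (\<Sum>i\<in>UNIV. \<bar>B i\<bar>) * norm (x - v)" if x: "x \<in> cball v 1" for x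
  proof -
    have "\<bar>peval q x\<bar> \<le> (\<Sum>i\<in>UNIV. \<bar>peval (h i) x * (x $ i - v $ i)\<bar>)"
      by (simp add: h sum_abs)
    also have "\<dots> \<le> (\<Sum>i\<in>UNIV. \<bar>B i\<bar> * norm (x - v))"
    proof (rule sum_mono)
      fix i
      have "\<bar>peval (h i) x\<bar> \<le> \<bar>B i\<bar>" using B[OF x, of i] by linarith
      moreover have "\<bar>x $ i - v $ i\<bar> \<le> norm (x - v)"
        using component_le_norm_cart[of "x - v" i] by simp
      ultimately show "\<bar>peval (h i) x * (x $ i - v $ i)\<bar> \<le> \<bar>B i\<bar> * norm (x - v)"
        unfolding abs_mult by (intro mult_mono) auto
    qed
    finally show ?thesis by (simp add: sum_distrib_right)
  qed
  then show ?thesis by (intro exI[of _ "\<Sum>i\<in>UNIV. \<bar>B i\<bar>"]) (auto intro: sum_nonneg)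
qed

text \<open>Little-o of the squared distance, a perturbation that quadratic growth survives.\<close>

definition negligible_at :: "real^'n::finite \<Rightarrow> 'n rpoly \<Rightarrow> bool" where
  "negligible_at v q \<longleftrightarrow> (\<forall>\<epsilon>>0. \<forall>\<^sub>F x in nhds v. \<bar>peval q x\<bar> \<le> \<epsilon> * (norm (x - v))\<^sup>2)"

lemma negligible_atD:
  "negligible_at v q \<Longrightarrow> 0 < \<epsilon> \<Longrightarrow> \<forall>\<^sub>F x in nhds v. \<bar>peval q x\<bar> \<le> \<epsilon> * (norm (x - v))\<^sup>2"
  by (simp add: negligible_at_def)

lemma eventually_dist_nhds: "0 < e \<Longrightarrow> \<forall>\<^sub>F x in nhds v. norm (x - v) < e"
  by (rule eventually_nhds_metric[THEN iffD2]) (auto simp: dist_norm)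

text \<open>Each of the three vanishing factors contributes one power of the distance; the cofactor
  \<open>r\<close> is absorbed into the third Lipschitz constant.\<close>

lemma negligible_at_product3:
  fixes q1 :: "'n::finite rpoly"
  assumes "peval q1 v = 0" "peval q2 v = 0" "peval q3 v = 0"
  shows "negligible_at v (q1 * q2 * q3 * r)"
  unfolding negligible_at_def
proof (intro allI impI)
  fix \<epsilon> :: real assume \<epsilon>: "0 < \<epsilon>"
  obtain C1 where C1: "0 \<le> C1" "\<And>x. x \<in> cball v 1 \<Longrightarrow> \<bar>peval q1 x\<bar> \<le> C1 * norm (x - v)"
    using vanishing_lipschitz[OF assms(1)] by blast
  obtain C2 where C2: "0 \<le> C2" "\<And>x. x \<in> cball v 1 \<Longrightarrow> \<bar>peval q2 x\<bar> \<le> C2 * norm (x - v)"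
    using vanishing_lipschitz[OF assms(2)] by blast
  obtain C3 where C3: "0 \<le> C3" "\<And>x. x \<in> cball v 1 \<Longrightarrow> \<bar>peval (q3 * r) x\<bar> \<le> C3 * norm (x - v)"
    using vanishing_lipschitz[of "q3 * r" v] assms(3) by auto
  define C where "C = C1 * C2 * C3 + 1"
  have C: "0 < C" using C1 C2 C3 by (auto simp: C_def intro!: add_nonneg_pos)
  have "\<forall>\<^sub>F x in nhds v. norm (x - v) < min 1 (\<epsilon> / C)"
    using \<epsilon> C by (intro eventually_dist_nhds) auto
  then show "\<forall>\<^sub>F x in nhds v. \<bar>peval (q1 * q2 * q3 * r) x\<bar> \<le> \<epsilon> * (norm (x - v))\<^sup>2"
  proof eventually_elim
    case (elim x)
    then have x: "x \<in> cball v 1" by (simp add: dist_norm norm_minus_commute)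
    have "\<bar>peval (q1 * q2 * q3 * r) x\<bar> = \<bar>peval q1 x\<bar> * \<bar>peval q2 x\<bar> * \<bar>peval (q3 * r) x\<bar>"
      by (simp add: abs_mult)
    also have "\<dots> \<le> (C1 * norm (x - v)) * (C2 * norm (x - v)) * (C3 * norm (x - v))"
      using C1 C2 C3 x by (intro mult_mono mult_nonneg_nonneg) auto
    also have "\<dots> = (C1 * C2 * C3) * norm (x - v) * (norm (x - v))\<^sup>2"
      by (simp add: power2_eq_square)
    also have "\<dots> \<le> C * norm (x - v) * (norm (x - v))\<^sup>2"
      by (intro mult_right_mono) (auto simp: C_def)
    also have "\<dots> \<le> \<epsilon> * (norm (x - v))\<^sup>2"
      using elim C by (intro mult_right_mono) (auto simp: field_simps)
    finally show ?case .
  qed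
qed

lemma negligible_at_add:
  assumes "negligible_at v p" "negligible_at v q" shows "negligible_at v (p + q)"
  unfolding negligible_at_def
proof (intro allI impI)
  fix \<epsilon> :: real assume "0 < \<epsilon>"
  then have e: "0 < \<epsilon> / 2" by simp
  have "\<forall>\<^sub>F x in nhds v. \<bar>peval p x\<bar> \<le> \<epsilon> / 2 * (norm (x - v))\<^sup>2"
    "\<forall>\<^sub>F x in nhds v. \<bar>peval q x\<bar> \<le> \<epsilon> / 2 * (norm (x - v))\<^sup>2"
    using negligible_atD[OF assms(1) e] negligible_atD[OF assms(2) e] by auto
  then show "\<forall>\<^sub>F x in nhds v. \<bar>peval (p + q) x\<bar> \<le> \<epsilon> * (norm (x - v))\<^sup>2"
  proof eventually_elim
    case (elim x)
    then show ?case using abs_triangle_ineq[of "peval p x" "peval q x"] by (simp add: field_simps)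
  qed
qed

lemma negligible_at_sum:
  "finite S \<Longrightarrow> (\<And>i. i \<in> S \<Longrightarrow> negligible_at v (q i)) \<Longrightarrow> negligible_at v (sum q S)"
  by (induction S rule: finite_induct)
    (auto intro: negligible_at_add simp: negligible_at_def[of _ 0])

lemma negligible_at_minus: "negligible_at v q \<Longrightarrow> negligible_at v (- q)"
  by (simp add: negligible_at_def)

lemma quadratic_growth_add_negligible:
  assumes "quadratic_growth_at v p" and q: "negligible_at v q"
  shows "quadratic_growth_at v (p + q)"
proof -
  obtain \<delta> where \<delta>: "0 < \<delta>" "\<forall>\<^sub>F x in nhds v. \<delta> * (norm (x - v))\<^sup>2 \<le> peval p x"
    using assms(1) by blast
  have "\<forall>\<^sub>F x in nhds v. \<bar>peval q x\<bar> \<le> \<delta> / 2 * (norm (x - v))\<^sup>2"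
    using \<delta>(1) by (intro negligible_atD[OF q]) simp
  with \<delta>(2) have "\<forall>\<^sub>F x in nhds v. \<delta> / 2 * (norm (x - v))\<^sup>2 \<le> peval (p + q) x"
  proof eventually_elim
    case (elim x)
    have "\<delta> * (norm (x - v))\<^sup>2 = \<delta> / 2 * (norm (x - v))\<^sup>2 + \<delta> / 2 * (norm (x - v))\<^sup>2" by simp
    then show ?case using elim abs_le_D2[OF elim(2)] by (simp only: peval_add)
  qed
  then show ?thesis using \<delta>(1) by (intro exI[of _ "\<delta> / 2"]) simp
qed

lemma continuous_positive_lower_bound:
  fixes f :: "'a::topological_space \<Rightarrow> real"
  assumes "compact C" "continuous_on C f" "\<And>x. x \<in> C \<Longrightarrow> 0 < f x"
  shows "\<exists>\<mu>>0. \<forall>x\<in>C. \<mu> \<le> f x"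
proof (cases "C = {}")
  case False
  then obtain x where "x \<in> C" "\<forall>y\<in>C. f x \<le> f y"
    using continuous_attains_inf[OF assms(1) _ assms(2)] by blast
  then show ?thesis using assms(3) by blast
qed (auto intro: exI[of _ 1])

context archimedean_poly_module
begin

definition positivity_set :: "(real^'n) set" where
  "positivity_set = {x. \<forall>p\<in>M. 0 \<le> peval p x}"

context
  fixes F :: "'n rpoly" and Z :: "(real^'n) set"
  assumes compact: "compact positivity_set"
    and F_nonneg: "\<And>x. x \<in> positivity_set \<Longrightarrow> 0 \<le> peval F x"
    and Z_def: "Z = {x \<in> positivity_set. peval F x = 0}"
    and local: "\<And>v. v \<in> Z \<Longrightarrow> \<exists>S\<in>M. peval S v = 0 \<and> quadratic_growth_at v (F - S)"
begin

text \<open>At zeros close to an accumulation point \<open>v\<close>, \<open>F\<close> is 0 and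
  \<open>S\<close> is nonnegative, so \<open>F - S\<close> is nonpositive there, against its growth
  in all directions.\<close>

lemma finite_zeros: "finite Z"
proof (rule ccontr)
  assume inf: "infinite Z"
  have "closed {x. peval F x = 0}"
    by (intro closed_Collect_eq continuous_on_peval continuous_on_const)
  then have "compact Z"
    using compact_Int_closed[OF compact] by (simp add: Z_def Collect_conj_eq)
  then obtain v where v: "v \<in> Z" "v islimpt Z"
    using Heine_Borel_imp_Bolzano_Weierstrass[OF _ inf subset_refl] by blast
  obtain S \<delta> where S: "S \<in> M" "0 < \<delta>" "\<forall>\<^sub>F x in nhds v. \<delta> * (norm (x - v))\<^sup>2 \<le> peval (F - S) x"
    using local[OF v(1)] by blast
  obtain U where U: "open U" "v \<in> U" "\<And>x. x \<in> U \<Longrightarrow> \<delta> * (norm (x - v))\<^sup>2 \<le> peval (F - S) x"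
    using S(3) unfolding eventually_nhds by blast
  obtain x where x: "x \<in> Z" "x \<in> U" "x \<noteq> v" using v(2) U unfolding islimpt_def by blast
  have "0 < \<delta> * (norm (x - v))\<^sup>2" using S(2) x(3) by simp
  moreover have "peval (F - S) x \<le> 0" using x(1) S(1) by (auto simp: Z_def positivity_set_def)
  ultimately show False using U(3)[OF x(2)] by linarith
qed

text \<open>Square weights keep the terms in \<open>M\<close>. Close to each zero they disturb its
  own certificate, and admit the others, only to third order.\<close>

lemma glued_local_certificate:
  "\<exists>S\<in>M. \<forall>v\<in>Z. peval S v = 0 \<and> quadratic_growth_at v (F - S)"
proof -
  have "\<forall>v\<in>Z. \<exists>S. S \<in> M \<and> peval S v = 0 \<and> quadratic_growth_at v (F - S)"
    using local by blast
  from bchoice[OF this] obtain S where S: "\<forall>v\<in>Z. S v \<in> M \<and> peval (S v) v = 0 \<and> quadratic_growth_at v (F - S v)" ..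
  then have S_mem: "S v \<in> M" and S_v: "peval (S v) v = 0"
    and S_min: "quadratic_growth_at v (F - S v)"
    if "v \<in> Z" for v using that by blast+
  obtain b where b: "\<And>v w. v \<in> Z \<Longrightarrow> w \<in> Z \<Longrightarrow> peval (b v) w = (if v = w then 1 else 0)"
    using lagrange_polys[OF finite_zeros] by blast
  \<comment> \<open>\<open>e v\<close> is 1 at \<open>v\<close>, 0 at the other points of \<open>Z\<close>, and stationary at all of them.\<close>
  define e where "e v = (b v)\<^sup>2 * (3 - 2 * b v)" for v
  define T where "T = (\<Sum>v\<in>Z. (e v)\<^sup>2 * S v)"
  show ?thesis
  proof (intro bexI ballI conjI)
    show "T \<in> M" unfolding T_def by (intro sum_mem square_mult_mem S_mem)
    fix v assume v: "v \<in> Z"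
    show "peval T v = 0"
    proof -
      have "peval ((e w)\<^sup>2 * S w) v = 0" if w: "w \<in> Z" for w
        using b[OF w v] S_v[OF w] by (cases "w = v") (auto simp: e_def)
      then show ?thesis unfolding T_def peval_sum by (intro sum.neutral ballI)
    qed
    have "negligible_at v ((e w)\<^sup>2 * S w)" if w: "w \<in> Z - {v}" for w
    proof -
      have "(e w)\<^sup>2 * S w = b w * b w * b w * (b w * (3 - 2 * b w)\<^sup>2 * S w)"
        by (simp add: e_def power2_eq_square mult_ac)
      then show ?thesis using b[of w v] v w by (auto intro!: negligible_at_product3)
    qed
    then have "negligible_at v (\<Sum>w\<in>Z - {v}. (e w)\<^sup>2 * S w)"
      using finite_zeros by (intro negligible_at_sum) auto
    \<comment> \<open>\<open>1 - e v\<close> has the double zero \<open>(b v - 1)\<^sup>2\<close>,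
      and \<open>S v\<close> supplies the third vanishing factor.\<close>
    moreover have "negligible_at v ((b v - 1) * (b v - 1) * S v * ((2 * b v + 1) * (1 + e v)))"
      using b[OF v v] S_v[OF v] by (intro negligible_at_product3) auto
    moreover have "(b v - 1) * (b v - 1) * S v * ((2 * b v + 1) * (1 + e v)) = S v - (e v)\<^sup>2 * S v"
    proof -
      have "(b v - 1) * (b v - 1) * (2 * b v + 1) = 1 - e v"
        by (simp add: e_def power2_eq_square algebra_simps)
      then have "(b v - 1) * (b v - 1) * S v * ((2 * b v + 1) * (1 + e v)) = (1 - e v) * S v * (1 + e v)"
        by (metis (no_types, lifting) mult.assoc mult.commute)
      also have "\<dots> = S v - (e v)\<^sup>2 * S v" by (simp add: power2_eq_square algebra_simps)
      finally show ?thesis .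
    qed
    ultimately have neg: "negligible_at v ((S v - (e v)\<^sup>2 * S v) + - (\<Sum>w\<in>Z - {v}. (e w)\<^sup>2 * S w))"
      by (intro negligible_at_add negligible_at_minus) simp_all
    have eq: "(F - S v) + ((S v - (e v)\<^sup>2 * S v) + - (\<Sum>w\<in>Z - {v}. (e w)\<^sup>2 * S w)) = F - T"
      unfolding T_def sum.remove[OF finite_zeros v] by simp
    from quadratic_growth_add_negligible[OF S_min[OF v] neg]
    show "quadratic_growth_at v (F - T)"
      unfolding eq .
  qed
qed

text \<open>Away from \<open>Z\<close> nothing prevents \<open>S\<close> from exceeding
  \<open>F\<close>, so it is damped there by a square. Close to \<open>Z\<close>, where
  \<open>F - S\<close> is positive, damping is harmless: the new difference is a convex combination
  of \<open>F\<close> and \<open>F - S\<close>.\<close>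

lemma damped_certificate:
  "\<exists>S\<in>M. (\<forall>x\<in>positivity_set - Z. 0 < peval (F - S) x) \<and> (\<forall>v\<in>Z. peval (F - S) v = 0 \<and> quadratic_growth_at v (F - S))"
proof -
  obtain S where S_mem: "S \<in> M" and S: "\<forall>v\<in>Z. peval S v = 0 \<and> quadratic_growth_at v (F - S)"
    using glued_local_certificate by blast
  then have S_v: "peval S v = 0"
    and S_min: "quadratic_growth_at v (F - S)"
    if "v \<in> Z" for v using that by blast+
  define d :: "real^'n \<Rightarrow> 'n rpoly" where "d v = (\<Sum>i\<in>UNIV. (shift v i)\<^sup>2)" for v
  define u where "u = (\<Prod>v\<in>Z. d v)"
  have d: "peval (d v) x = (norm (x - v))\<^sup>2" for v x
    by (simp add: d_def power2_norm_eq_inner inner_vec_def) (simp add: power2_eq_square)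
  have u_nonneg: "0 \<le> peval u x" for x by (auto simp: u_def d intro!: prod_nonneg)
  have u_pos: "0 < peval u x" if "x \<notin> Z" for x
    using that by (auto simp: u_def d intro!: prod_pos)
  have bdd: "\<exists>B>0. \<forall>x\<in>positivity_set. \<bar>peval p x\<bar> \<le> B" for p
  proof -
    have "bounded (peval p ` positivity_set)"
      by (intro compact_imp_bounded compact_continuous_image continuous_on_peval compact)
    then show ?thesis by (auto simp: bounded_pos)
  qed
  obtain R where R: "0 < R" "\<And>x. x \<in> positivity_set \<Longrightarrow> \<bar>peval u x\<bar> \<le> R" using bdd[of u] by blast
  obtain B where B: "0 < B" "\<And>x. x \<in> positivity_set \<Longrightarrow> \<bar>peval S x\<bar> \<le> B" using bdd[of S] by blast
  \<comment> \<open>\<open>R\<close> bounds \<open>u\<close> on the positivity set, so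
    \<open>t\<close> lies between 0 and 1 there and equals 1 exactly on \<open>Z\<close>.\<close>
  define t where "t = 1 - (1 / R) *\<^sub>R u"
  have t: "0 \<le> peval t x" "peval t x \<le> 1" if "x \<in> positivity_set" for x
    using R(1) R(2)[OF that] u_nonneg[of x] by (auto simp: t_def field_simps)
  have "\<forall>v\<in>Z. \<exists>y. open (fst y) \<and> v \<in> fst y \<and> 0 < snd y \<and>
      (\<forall>x\<in>fst y. snd y * (norm (x - v))\<^sup>2 \<le> peval (F - S) x)"
  proof
    fix v assume "v \<in> Z"
    then obtain \<delta> where "0 < \<delta>" "\<forall>\<^sub>F x in nhds v. \<delta> * (norm (x - v))\<^sup>2 \<le> peval (F - S) x"
      using S_min by blast
    moreover from this(2) obtain U where "open U" "v \<in> U" "\<forall>x\<in>U. \<delta> * (norm (x - v))\<^sup>2 \<le> peval (F - S) x"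
      unfolding eventually_nhds by blast
    ultimately show "\<exists>y. open (fst y) \<and> v \<in> fst y \<and> 0 < snd y \<and>
      (\<forall>x\<in>fst y. snd y * (norm (x - v))\<^sup>2 \<le> peval (F - S) x)"
      by (intro exI[of _ "(U, \<delta>)"]) simp
  qed
  from bchoice[OF this] obtain y where y: "\<forall>v\<in>Z. open (fst (y v)) \<and> v \<in> fst (y v) \<and> 0 < snd (y v) \<and>
      (\<forall>x\<in>fst (y v). snd (y v) * (norm (x - v))\<^sup>2 \<le> peval (F - S) x)" ..
  define U where "U v = fst (y v)" for v
  define \<delta> where "\<delta> v = snd (y v)" for v
  have U: "open (U v)" "v \<in> U v" "0 < \<delta> v"
    and U_min: "\<And>x. x \<in> U v \<Longrightarrow> \<delta> v * (norm (x - v))\<^sup>2 \<le> peval (F - S) x" if "v \<in> Z" for v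
    using y that by (auto simp: U_def \<delta>_def)
  define C where "C = positivity_set - (\<Union>v\<in>Z. U v)"
  have C: "compact C" unfolding C_def using U(1) by (intro compact_diff compact open_UN) auto
  have C_pos: "x \<in> positivity_set" "x \<notin> Z" if "x \<in> C" for x using that U(2) by (auto simp: C_def)
  have "\<exists>\<mu>>0. \<forall>x\<in>C. \<mu> \<le> peval F x"
    using C_pos F_nonneg
    by (intro continuous_positive_lower_bound C continuous_on_peval)
      (force simp: Z_def order_less_le)
  then obtain \<mu> where \<mu>: "0 < \<mu>" "\<And>x. x \<in> C \<Longrightarrow> \<mu> \<le> peval F x" by blast
  have "\<exists>\<rho>>0. \<forall>x\<in>C. \<rho> \<le> peval ((1 / R) *\<^sub>R u) x"
    using C_pos u_pos R(1) by (intro continuous_positive_lower_bound C continuous_on_peval) auto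
  then obtain \<rho> where \<rho>: "0 < \<rho>" "\<And>x. x \<in> C \<Longrightarrow> \<rho> \<le> peval ((1 / R) *\<^sub>R u) x" by blast
  define \<tau> where "\<tau> = max 0 (1 - \<rho>)"
  have \<tau>: "0 \<le> \<tau>" "\<tau> < 1" "\<And>x. x \<in> C \<Longrightarrow> peval t x \<le> \<tau>"
  proof -
    show "0 \<le> \<tau>" "\<tau> < 1" using \<rho>(1) by (auto simp: \<tau>_def)
    show "peval t x \<le> \<tau>" if "x \<in> C" for x
      using \<rho>(2)[OF that] by (simp add: \<tau>_def t_def le_max_iff_disj)
  qed
  obtain N where N: "\<tau> ^ N < \<mu> / B" using real_arch_pow_inv[OF _ \<tau>(2), of "\<mu> / B"] \<mu>(1) B(1) by auto
  \<comment> \<open>\<open>H\<close> is 1 to second order on \<open>Z\<close>, and uniformly small on \<open>C\<close>, where \<open>S\<close> may exceed \<open>F\<close>.\<close>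
  define H where "H = t ^ N"
  define T where "T = H\<^sup>2 * S"
  have H: "0 \<le> peval H x" "peval H x \<le> 1" if "x \<in> positivity_set" for x
    using t[OF that] by (auto simp: H_def power_le_one)
  have FT: "F - T = (F - S) + (1 - H\<^sup>2) * S" by (simp add: T_def algebra_simps)
  show ?thesis
  proof (intro bexI ballI conjI)
    show "T \<in> M" unfolding T_def by (intro square_mult_mem S_mem)
    fix x assume "x \<in> positivity_set - Z"
    then have x: "x \<in> positivity_set" "x \<notin> Z" by auto
    show "0 < peval (F - T) x"
    proof (cases "x \<in> C")
      case True
      have "(peval H x)\<^sup>2 \<le> peval H x" using H[OF x(1)] by (simp add: power2_eq_square mult_left_le)
      also have "\<dots> \<le> \<tau> ^ N" using \<tau>(3)[OF True] t[OF x(1)] by (simp add: H_def power_mono)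
      finally have "(peval H x)\<^sup>2 * \<bar>peval S x\<bar> \<le> \<tau> ^ N * B"
        using B(2)[OF x(1)] \<tau>(1) by (intro mult_mono) auto
      also have "\<dots> < \<mu>" using N B(1) by (simp add: field_simps)
      also have "\<dots> \<le> peval F x" by (rule \<mu>(2)[OF True])
      finally have "(peval H x)\<^sup>2 * \<bar>peval S x\<bar> < peval F x" .
      moreover have "(peval H x)\<^sup>2 * peval S x \<le> (peval H x)\<^sup>2 * \<bar>peval S x\<bar>"
        by (intro mult_left_mono) auto
      ultimately show ?thesis by (simp add: T_def)
    next
      case False
      then obtain v where v: "v \<in> Z" "x \<in> U v" using x by (auto simp: C_def)
      have "x \<noteq> v" using v(1) x(2) by blast
      then have "0 < \<delta> v * (norm (x - v))\<^sup>2" using U(3)[OF v(1)] by simp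
      then have FS: "0 < peval F x - peval S x" using U_min[OF v] by simp
      have Fx: "0 < peval F x" using F_nonneg[OF x(1)] x by (auto simp: Z_def order_less_le)
      have eq: "peval (F - T) x = (1 - (peval H x)\<^sup>2) * peval F x + (peval H x)\<^sup>2 * (peval F x - peval S x)"
        by (simp add: T_def algebra_simps)
      have H2: "(peval H x)\<^sup>2 \<le> 1" using H[OF x(1)] by (simp add: power_le_one)
      show ?thesis
      proof (cases "peval H x = 0")
        case True
        then show ?thesis using Fx eq by simp
      next
        case False
        then have "0 < (peval H x)\<^sup>2 * (peval F x - peval S x)" using FS by simp
        moreover have "0 \<le> (1 - (peval H x)\<^sup>2) * peval F x" using H2 Fx by simp
        ultimately show ?thesis unfolding eq by linarith
      qed
    qed
  next
    fix v assume v: "v \<in> Z"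
    show "peval (F - T) v = 0" using v S_v[OF v] by (simp add: T_def Z_def)
    \<comment> \<open>\<open>1 - t\<close> carries the factor \<open>d v\<close>, a sum of squares
      of functions vanishing at \<open>v\<close>. Together with \<open>S\<close> this gives three
      vanishing factors in each summand.\<close>
    have "1 - H\<^sup>2 = (1 - t) * (\<Sum>i<2 * N. t ^ i)"
      by (simp add: H_def one_diff_power_eq mult.commute flip: power_mult)
    moreover have "1 - t = d v * ((1 / R) *\<^sub>R (\<Prod>w\<in>Z - {v}. d w))"
      using finite_zeros v by (simp add: t_def u_def prod.remove[of Z v])
    ultimately have eq: "(1 - H\<^sup>2) * S = (\<Sum>i\<in>UNIV. shift v i * shift v i * S *
        ((1 / R) *\<^sub>R (\<Prod>w\<in>Z - {v}. d w) * (\<Sum>i<2 * N. t ^ i)))"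
      unfolding d_def[of v] sum_distrib_right[symmetric] power2_eq_square by (simp only: mult_ac)
    have "negligible_at v ((1 - H\<^sup>2) * S)"
      unfolding eq using S_v[OF v] by (intro negligible_at_sum negligible_at_product3) auto
    from quadratic_growth_add_negligible[OF S_min[OF v] this]
    show "quadratic_growth_at v (F - T)"
      unfolding FT .
  qed
qed

text \<open>Close to \<open>Z\<close> the square of \<open>p\<close> is of the order of the squared
  distance and is absorbed by half of the growth of \<open>F - S\<close>; on the compact rest it is
  absorbed by the positive minimum. So \<open>mem_if_strict_local_minima\<close> still applies, and
  \<open>S\<close> is added back.\<close>

theorem minus_square_mem:
  assumes p: "\<And>v. v \<in> Z \<Longrightarrow> peval p v = 0"
  shows "\<exists>\<eta>>0. F - \<eta> *\<^sub>R p\<^sup>2 \<in> M"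
proof -
  obtain S where S_mem: "S \<in> M" and S_pos: "\<forall>x\<in>positivity_set - Z. 0 < peval (F - S) x"
    and "\<forall>v\<in>Z. peval (F - S) v = 0 \<and> quadratic_growth_at v (F - S)"
    using damped_certificate by blast
  then have S_v: "peval (F - S) v = 0"
    and S_min: "quadratic_growth_at v (F - S)"
    if "v \<in> Z" for v using that by blast+
  define G where "G = F - S"
  have "\<forall>v\<in>Z. \<exists>y. open (fst y) \<and> v \<in> fst y \<and> 0 < fst (snd y) \<and> 0 < snd (snd y) \<and>
      (\<forall>x\<in>fst y. fst (snd y) * (norm (x - v))\<^sup>2 + snd (snd y) * (peval p x)\<^sup>2 \<le> peval G x)"
  proof
    fix v assume v: "v \<in> Z"
    obtain \<delta> where \<delta>: "0 < \<delta>" "\<forall>\<^sub>F x in nhds v. \<delta> * (norm (x - v))\<^sup>2 \<le> peval G x"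
      using S_min[OF v] by (auto simp: G_def)
    obtain L where L: "0 \<le> L" "\<And>x. x \<in> cball v 1 \<Longrightarrow> \<bar>peval p x\<bar> \<le> L * norm (x - v)"
      using vanishing_lipschitz[OF p[OF v]] by blast
    \<comment> \<open>At most half of \<delta> after multiplication by \<open>L\<^sup>2\<close>; the
      added 1 covers \<open>L = 0\<close>.\<close>
    define \<eta> where "\<eta> = \<delta> / (2 * (L\<^sup>2 + 1))"
    have L1: "0 < L\<^sup>2 + 1" by (simp add: add_nonneg_pos)
    have \<eta>: "0 < \<eta>" "\<eta> * L\<^sup>2 \<le> \<delta> / 2" using \<delta>(1) L1 by (auto simp: \<eta>_def field_simps)
    have "\<forall>\<^sub>F x in nhds v. norm (x - v) < 1" by (rule eventually_dist_nhds) simp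
    with \<delta>(2) have "\<forall>\<^sub>F x in nhds v. \<delta> / 2 * (norm (x - v))\<^sup>2 + \<eta> * (peval p x)\<^sup>2 \<le> peval G x"
    proof eventually_elim
      case (elim x)
      then have "x \<in> cball v 1" by (simp add: dist_norm norm_minus_commute)
      from L(2)[OF this] have "(peval p x)\<^sup>2 \<le> (L * norm (x - v))\<^sup>2"
        using L(1) by (simp add: abs_le_square_iff[symmetric] abs_mult)
      then have "\<eta> * (peval p x)\<^sup>2 \<le> \<eta> * (L * norm (x - v))\<^sup>2" using \<eta>(1) by simp
      also have "\<dots> = (\<eta> * L\<^sup>2) * (norm (x - v))\<^sup>2" by (simp add: power_mult_distrib)
      also have "\<dots> \<le> \<delta> / 2 * (norm (x - v))\<^sup>2" using \<eta>(2) by (intro mult_right_mono) auto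
      finally show ?case using elim(1) by (simp add: field_simps)
    qed
    then obtain U where "open U" "v \<in> U"
      "\<forall>x\<in>U. \<delta> / 2 * (norm (x - v))\<^sup>2 + \<eta> * (peval p x)\<^sup>2 \<le> peval G x"
      unfolding eventually_nhds by blast
    then show "\<exists>y. open (fst y) \<and> v \<in> fst y \<and> 0 < fst (snd y) \<and> 0 < snd (snd y) \<and>
      (\<forall>x\<in>fst y. fst (snd y) * (norm (x - v))\<^sup>2 + snd (snd y) * (peval p x)\<^sup>2 \<le> peval G x)"
      using \<delta>(1) \<eta>(1) by (intro exI[of _ "(U, \<delta> / 2, \<eta>)"]) simp
  qed
  from bchoice[OF this] obtain y where y: "\<forall>v\<in>Z. open (fst (y v)) \<and> v \<in> fst (y v) \<and>
      0 < fst (snd (y v)) \<and> 0 < snd (snd (y v)) \<and>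
      (\<forall>x\<in>fst (y v). fst (snd (y v)) * (norm (x - v))\<^sup>2 + snd (snd (y v)) * (peval p x)\<^sup>2 \<le> peval G x)" ..
  define U where "U v = fst (y v)" for v
  define \<delta> where "\<delta> v = fst (snd (y v))" for v
  define \<eta> where "\<eta> v = snd (snd (y v))" for v
  have U: "open (U v)" "v \<in> U v" "0 < \<delta> v" "0 < \<eta> v"
    and U_min: "\<And>x. x \<in> U v \<Longrightarrow> \<delta> v * (norm (x - v))\<^sup>2 + \<eta> v * (peval p x)\<^sup>2 \<le> peval G x"
    if "v \<in> Z" for v using y that by (auto simp: U_def \<delta>_def \<eta>_def)
  define C where "C = positivity_set - (\<Union>v\<in>Z. U v)"
  have C: "compact C" unfolding C_def using U(1) by (intro compact_diff compact open_UN) auto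
  have C_pos: "x \<in> positivity_set" "x \<notin> Z" if "x \<in> C" for x using that U(2) by (auto simp: C_def)
  have "\<exists>\<mu>>0. \<forall>x\<in>C. \<mu> \<le> peval G x"
    using C_pos S_pos by (intro continuous_positive_lower_bound C continuous_on_peval) (auto simp: G_def)
  then obtain \<mu> where \<mu>: "0 < \<mu>" "\<And>x. x \<in> C \<Longrightarrow> \<mu> \<le> peval G x" by blast
  have "bounded (peval (p\<^sup>2) ` C)"
    by (intro compact_imp_bounded compact_continuous_image continuous_on_peval C)
  then obtain B where B: "0 < B" "\<And>x. x \<in> C \<Longrightarrow> (peval p x)\<^sup>2 \<le> B"
    by (auto simp: bounded_pos)
  \<comment> \<open>The first entry keeps \<open>\<epsilon> * (peval p x)\<^sup>2\<close> within
    half of \<mu> on \<open>C\<close>, and keeps the minimum meaningful when \<open>Z\<close> is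
    empty.\<close>
  define \<epsilon> where "\<epsilon> = Min (insert (\<mu> / (2 * B)) (\<eta> ` Z))"
  have fin: "finite (insert (\<mu> / (2 * B)) (\<eta> ` Z))" using finite_zeros by simp
  have \<epsilon>: "0 < \<epsilon>" using fin U(4) \<mu>(1) B(1) by (auto simp: \<epsilon>_def Min_gr_iff)
  have \<epsilon>_le: "\<epsilon> \<le> \<mu> / (2 * B)" "\<And>v. v \<in> Z \<Longrightarrow> \<epsilon> \<le> \<eta> v" using fin by (auto simp: \<epsilon>_def)
  have near': "\<delta> v * (norm (x - v))\<^sup>2 \<le> peval (G - \<epsilon> *\<^sub>R p\<^sup>2) x" if "v \<in> Z" "x \<in> U v" for v x
  proof -
    have "\<epsilon> * (peval p x)\<^sup>2 \<le> \<eta> v * (peval p x)\<^sup>2" using \<epsilon>_le(2)[OF that(1)] by (intro mult_right_mono) auto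
    then show ?thesis using U_min[OF that] by simp
  qed
  have "G - \<epsilon> *\<^sub>R p\<^sup>2 \<in> M"
  proof (rule mem_if_strict_local_minima[OF finite_zeros])
    fix x assume x: "x \<notin> Z" "\<And>q. q \<in> M \<Longrightarrow> 0 \<le> peval q x"
    then have xp: "x \<in> positivity_set" by (simp add: positivity_set_def)
    show "0 < peval (G - \<epsilon> *\<^sub>R p\<^sup>2) x"
    proof (cases "x \<in> C")
      case True
      have "\<epsilon> * (peval p x)\<^sup>2 \<le> \<mu> / (2 * B) * B"
        using \<epsilon>_le(1) B(2)[OF True] \<epsilon> \<mu>(1) B(1) by (intro mult_mono) auto
      also have "\<dots> < \<mu>" using \<mu>(1) B(1) by simp
      finally show ?thesis using \<mu>(2)[OF True] by simp
    next
      case False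
      then obtain v where v: "v \<in> Z" "x \<in> U v" using xp by (auto simp: C_def)
      have "x \<noteq> v" using v(1) x(1) by blast
      then have "0 < \<delta> v * (norm (x - v))\<^sup>2" using U(3)[OF v(1)] by simp
      then show ?thesis using near'[OF v] by linarith
    qed
  next
    fix v assume v: "v \<in> Z"
    show "peval (G - \<epsilon> *\<^sub>R p\<^sup>2) v = 0" using S_v[OF v] p[OF v] by (simp add: G_def)
    show "quadratic_growth_at v (G - \<epsilon> *\<^sub>R p\<^sup>2)"
      unfolding eventually_nhds using U(1-3)[OF v] near'[OF v] by blast
  qed
  then have "(G - \<epsilon> *\<^sub>R p\<^sup>2) + S \<in> M" by (intro add_mem S_mem)
  also have "(G - \<epsilon> *\<^sub>R p\<^sup>2) + S = F - \<epsilon> *\<^sub>R p\<^sup>2" by (simp add: G_def)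
  finally show ?thesis using \<epsilon> by blast
qed

end

end

section \<open>Attainment in (P) by finitely many atoms, without a duality gap\<close>

section \<open>Strong duality\<close>

text \<open>Atoms are indexed by points, so a relation comes either from dependent vectors or from
  two points with the same vector. Moving along it until the first weight reaches 0 removes a point.
  The bound depends only on \<open>W\<close>, which later permits a compactness argument.\<close>

lemma conic_caratheodory:
  fixes \<phi> :: "'b \<Rightarrow> 'v::real_vector" and t :: "'b \<Rightarrow> real"
  assumes W: "finite W" "\<And>x. x \<in> S \<Longrightarrow> \<phi> x \<in> span W"
    and S: "finite S" "\<And>x. x \<in> S \<Longrightarrow> 0 \<le> t x"
  shows "\<exists>T\<subseteq>S. \<exists>t'. card T \<le> card W \<and> (\<forall>x\<in>T. 0 \<le> t' x) \<and>
     (\<Sum>x\<in>T. t' x *\<^sub>R \<phi> x) = (\<Sum>x\<in>S. t x *\<^sub>R \<phi> x)"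
  using S W(2)
proof (induction "card S" arbitrary: S t rule: less_induct)
  case less
  show ?case
  proof (cases "card S \<le> card W")
    case True
    then show ?thesis using less.prems by blast
  next
    case False
    have "\<exists>u. (\<exists>x\<in>S. u x \<noteq> 0) \<and> (\<Sum>x\<in>S. u x *\<^sub>R \<phi> x) = 0"
    proof (cases "inj_on \<phi> S")
      case True
      have "dependent (\<phi> ` S)"
      proof (rule ccontr)
        assume "\<not> dependent (\<phi> ` S)"
        then have "card (\<phi> ` S) \<le> card W"
          using independent_span_bound[OF W(1), of "\<phi> ` S"] less.prems(3) by blast
        then show False using False card_image[OF True] by simp
      qed
      then obtain u where u: "\<exists>v\<in>\<phi> ` S. u v \<noteq> 0" "(\<Sum>v\<in>\<phi> ` S. u v *\<^sub>R v) = 0"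
        using dependent_finite[of "\<phi> ` S"] less.prems(1) by auto
      then show ?thesis
        using sum.reindex[OF True, of "\<lambda>v. u v *\<^sub>R v"] by (intro exI[of _ "u \<circ> \<phi>"]) auto
    next
      case False
      then obtain x y where xy: "x \<in> S" "y \<in> S" "x \<noteq> y" "\<phi> x = \<phi> y" by (auto simp: inj_on_def)
      define u :: "'b \<Rightarrow> real" where "u z = (if z = x then 1 else if z = y then - 1 else 0)" for z
      have "(\<Sum>z\<in>S. u z *\<^sub>R \<phi> z) = (\<Sum>z\<in>{x, y}. u z *\<^sub>R \<phi> z)"
        using less.prems(1) xy by (intro sum.mono_neutral_right) (auto simp: u_def)
      also have "\<dots> = 0" using xy by (simp add: u_def)
      finally show ?thesis using xy(1) by (intro exI[of _ u]) (auto simp: u_def)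
    qed
    then obtain u0 x0 where u0: "x0 \<in> S" "u0 x0 \<noteq> 0" "(\<Sum>x\<in>S. u0 x *\<^sub>R \<phi> x) = 0" by blast
    \<comment> \<open>The sign makes \<open>u\<close> positive somewhere, so the minimal ratio below
      is taken over a nonempty set.\<close>
    define u where "u x = sgn (u0 x0) * u0 x" for x
    have u_sum: "(\<Sum>x\<in>S. u x *\<^sub>R \<phi> x) = 0"
      using u0(3) by (simp add: u_def scaleR_sum_right[symmetric] flip: scaleR_scaleR)
    have "0 < u x0" using u0(2) by (simp add: u_def sgn_if)
    define P where "P = {x \<in> S. 0 < u x}"
    have P: "finite P" "P \<noteq> {}" using less.prems(1) u0(1) \<open>0 < u x0\<close> by (auto simp: P_def)
    define r where "r = Min ((\<lambda>x. t x / u x) ` P)"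
    have "r \<in> (\<lambda>x. t x / u x) ` P" unfolding r_def using P by (intro Min_in) auto
    then obtain y where y: "y \<in> P" "r = t y / u y" by auto
    have r_le: "r \<le> t x / u x" if "x \<in> P" for x
      unfolding r_def using P that by (intro Min_le) auto
    have r_nn: "0 \<le> r" using y less.prems(2) by (auto simp: P_def)
    define t' where "t' x = t x - r * u x" for x
    have t'_nn: "0 \<le> t' x" if "x \<in> S" for x
    proof (cases "x \<in> P")
      case True
      then show ?thesis using r_le[OF True] by (simp add: t'_def P_def field_simps)
    next
      case False
      then have "r * u x \<le> 0" using that r_nn by (auto simp: P_def mult_nonneg_nonpos)
      then show ?thesis using less.prems(2)[OF that] by (simp add: t'_def)
    qed
    have t'_y: "t' y = 0" using y by (simp add: t'_def P_def)
    have yS: "y \<in> S" using y by (simp add: P_def)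
    have "(\<Sum>x\<in>S. t x *\<^sub>R \<phi> x) = (\<Sum>x\<in>S. t' x *\<^sub>R \<phi> x) + r *\<^sub>R (\<Sum>x\<in>S. u x *\<^sub>R \<phi> x)"
      by (simp add: t'_def scaleR_sum_right algebra_simps flip: sum.distrib)
    also have "\<dots> = (\<Sum>x\<in>S - {y}. t' x *\<^sub>R \<phi> x)"
      using u_sum t'_y yS less.prems(1) by (simp add: sum.remove[of S y])
    finally have eq: "(\<Sum>x\<in>S - {y}. t' x *\<^sub>R \<phi> x) = (\<Sum>x\<in>S. t x *\<^sub>R \<phi> x)" by simp
    have "card (S - {y}) < card S" using yS less.prems(1) by (intro card_Diff1_less)
    from less.hyps[OF this, of t'] less.prems t'_nn
    show ?thesis unfolding eq by (auto 0 3)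
  qed
qed

lemma finite_family_convergent_subsequence:
  fixes g :: "nat \<Rightarrow> nat \<Rightarrow> 'a::metric_space"
  assumes "compact C" "\<And>k i. i < N \<Longrightarrow> g k i \<in> C"
  shows "\<exists>r l. strict_mono (r :: nat \<Rightarrow> nat) \<and> (\<forall>i<N. l i \<in> C \<and> (\<lambda>k. g (r k) i) \<longlonglongrightarrow> l i)"
  using assms(2)
proof (induction N)
  case 0
  show ?case by (auto intro!: exI[of _ id] simp: strict_mono_id)
next
  case (Suc N)
  then obtain r l where r: "strict_mono r" "\<And>i. i < N \<Longrightarrow> l i \<in> C"
    "\<And>i. i < N \<Longrightarrow> (\<lambda>k. g (r k) i) \<longlonglongrightarrow> l i" by (metis less_Suc_eq)
  obtain a s where s: "a \<in> C" "strict_mono s" "((\<lambda>k. g (r k) N) \<circ> s) \<longlonglongrightarrow> a"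
    using assms(1) Suc.prems unfolding compact_def by (metis lessI)
  have "(\<lambda>k. g ((r \<circ> s) k) i) \<longlonglongrightarrow> (l(N := a)) i" if "i < Suc N" for i
    using that s(3) LIMSEQ_subseq_LIMSEQ[OF r(3) s(2), of i]
    by (cases "i = N") (auto simp: o_def)
  moreover have "(l(N := a)) i \<in> C" if "i < Suc N" for i
    using that r(2)[of i] s(1) by (cases "i = N") auto
  ultimately show ?case
    using strict_mono_o[OF r(1) s(2)] by blast
qed

lemma pairing_scaleR: "pairing (r *\<^sub>R p) y = r * pairing p y"
proof -
  have "Poly_Mapping.keys (r *\<^sub>R p) \<subseteq> Poly_Mapping.keys p"
    by (auto simp: in_keys_iff lookup_scaleR)
  then show ?thesis
    by (subst pairing_superset[OF finite_keys]) (auto simp: pairing_def lookup_scaleR sum_distrib_left mult_ac)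
qed

lemma peval_residual [simp]:
  "peval (residual f a m \<theta>) x = peval f x - (\<Sum>i=1..m. \<theta> i * peval (a i) x)"
  by (simp add: residual_def)

text \<open>
  The vectors \<open>(f(x), a\<^sub>1(x), \<dots>, a\<^sub>m(x))\<close> live in \<open>nat \<Rightarrow>\<^sub>0 real\<close>, with \<open>f\<close> at index 0.
\<close>

definition data_vec :: "'n::finite rpoly \<Rightarrow> (nat \<Rightarrow> 'n rpoly) \<Rightarrow> nat \<Rightarrow> real^'n \<Rightarrow> nat \<Rightarrow>\<^sub>0 real" where
  "data_vec f a m x = (\<Sum>i\<le>m. Poly_Mapping.single i (peval (if i = 0 then f else a i) x))"

lemma lookup_sum_singles:
  "finite S \<Longrightarrow> lookup (\<Sum>i\<in>S. Poly_Mapping.single i (h i)) j = (if j \<in> S then h j else (0::real))"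
  by (simp add: lookup_sum lookup_single when_def eq_commute)

lemma lookup_data_vec:
  "lookup (data_vec f a m x) i
    = (if i \<le> m then peval (if i = 0 then f else a i) x else 0)"
  by (simp add: data_vec_def lookup_sum_singles)

definition conic_hull_of :: "'b set \<Rightarrow> ('b \<Rightarrow> 'v::real_vector) \<Rightarrow> 'v set" where
  "conic_hull_of K \<phi> = {\<Sum>x\<in>S. t x *\<^sub>R \<phi> x | S t. finite S \<and> S \<subseteq> K \<and> (\<forall>x\<in>S. 0 \<le> t x)}"

lemma conic_hull_ofI:
  "finite S \<Longrightarrow> S \<subseteq> K \<Longrightarrow> (\<And>x. x \<in> S \<Longrightarrow> 0 \<le> t x) \<Longrightarrow> (\<Sum>x\<in>S. t x *\<^sub>R \<phi> x) \<in> conic_hull_of K \<phi>"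
  by (auto simp: conic_hull_of_def)

lemma zero_in_conic_hull_of: "0 \<in> conic_hull_of K \<phi>"
  using conic_hull_ofI[of "{}"] by auto

lemma add_in_conic_hull_of:
  assumes "y \<in> conic_hull_of K \<phi>" "z \<in> conic_hull_of K \<phi>"
  shows "y + z \<in> conic_hull_of K \<phi>"
proof -
  obtain S t S' t' where S: "finite S" "S \<subseteq> K" "\<forall>x\<in>S. 0 \<le> t x" "y = (\<Sum>x\<in>S. t x *\<^sub>R \<phi> x)"
    and S': "finite S'" "S' \<subseteq> K" "\<forall>x\<in>S'. 0 \<le> t' x" "z = (\<Sum>x\<in>S'. t' x *\<^sub>R \<phi> x)"
    using assms unfolding conic_hull_of_def by blast
  define w where "w x = (if x \<in> S then t x else 0) + (if x \<in> S' then t' x else 0)" for x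
  have "y = (\<Sum>x\<in>S \<union> S'. (if x \<in> S then t x else 0) *\<^sub>R \<phi> x)"
    "z = (\<Sum>x\<in>S \<union> S'. (if x \<in> S' then t' x else 0) *\<^sub>R \<phi> x)"
    unfolding S(4) S'(4) using S(1) S'(1) by (auto intro!: sum.mono_neutral_cong_left)
  then have "y + z = (\<Sum>x\<in>S \<union> S'. w x *\<^sub>R \<phi> x)"
    by (simp add: w_def scaleR_left_distrib sum.distrib)
  moreover have "0 \<le> w x" for x using S(3) S'(3) by (simp add: w_def)
  ultimately show ?thesis using S S' by (auto intro!: conic_hull_ofI)
qed

lemma scaleR_in_conic_hull_of:
  assumes "y \<in> conic_hull_of K \<phi>" "0 \<le> r" shows "r *\<^sub>R y \<in> conic_hull_of K \<phi>"
proof -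
  obtain S t where "finite S" "S \<subseteq> K" "\<forall>x\<in>S. 0 \<le> t x" "y = (\<Sum>x\<in>S. t x *\<^sub>R \<phi> x)"
    using assms(1) unfolding conic_hull_of_def by blast
  moreover from this have "r *\<^sub>R y = (\<Sum>x\<in>S. (r * t x) *\<^sub>R \<phi> x)" by (simp add: scaleR_sum_right)
  ultimately show ?thesis using assms(2) by (auto intro!: conic_hull_ofI)
qed

context
  fixes K :: "(real^'n::finite) set" and f :: "'n rpoly" and a :: "nat \<Rightarrow> 'n rpoly"
    and b :: "nat \<Rightarrow> real" and m1 m :: nat and \<theta> \<theta>0 :: "nat \<Rightarrow> real"
  assumes m1: "m1 \<le> m"
    and feasible: "\<forall>x\<in>K. 0 \<le> peval (residual f a m \<theta>) x" "\<forall>i\<in>{m1<..m}. 0 \<le> \<theta> i"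
    and optimal: "\<And>\<theta>'. \<forall>x\<in>K. 0 \<le> peval (residual f a m \<theta>') x \<Longrightarrow> \<forall>i\<in>{m1<..m}. 0 \<le> \<theta>' i \<Longrightarrow>
        dual_objective b m \<theta>' \<le> dual_objective b m \<theta>"
begin

lemma approximate_primal_solution:
  assumes \<epsilon>: "0 < \<epsilon>"
  shows "\<exists>y\<in>conic_hull_of K (data_vec f a m).
     (\<forall>i\<in>{1..m1}. \<bar>lookup y i - b i\<bar> \<le> \<epsilon>) \<and>
     (\<forall>i\<in>{m1<..m}. b i - \<epsilon> \<le> lookup y i) \<and>
     lookup y 0 \<le> dual_objective b m \<theta> + \<epsilon>"
proof (rule ccontr)
  assume no: "\<not> ?thesis"
  define vs where "vs = dual_objective b m \<theta>"
  let ?C = "conic_hull_of K (data_vec f a m)"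
  \<comment> \<open>The relaxed system, made homogeneous by \<tau> and shifted by \<open>v\<close>.
    For \<open>v = 0\<close> and positive \<tau>, the vector \<open>y\<close> divided by \<tau>
    would be an approximate solution.\<close>
  define near where "near v y \<tau> \<longleftrightarrow> 0 \<le> \<tau> \<and> y \<in> ?C \<and>
     (\<forall>i\<in>{1..m1}. \<bar>lookup v i - (lookup y i - \<tau> * b i)\<bar> \<le> \<tau> * \<epsilon>) \<and>
     (\<forall>i\<in>{m1<..m}. lookup v i \<le> lookup y i - \<tau> * b i + \<tau> * \<epsilon>) \<and>
     lookup y 0 - \<tau> * vs - \<tau> * \<epsilon> \<le> lookup v 0"
    for v y :: "nat \<Rightarrow>\<^sub>0 real" and \<tau> :: real
  define Q where "Q = {v. \<exists>y \<tau>. near v y \<tau>}"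
  have QI: "v \<in> Q" if "near v y \<tau>" for v y \<tau> using that by (auto simp: Q_def)
  define u :: "nat \<Rightarrow>\<^sub>0 real" where
    "u = (\<Sum>i\<le>m. Poly_Mapping.single i (if i = 0 then - vs else - b i))"
  have u: "lookup u i = (if i \<le> m then if i = 0 then - vs else - b i else 0)" for i
    by (simp add: u_def lookup_sum_singles)
  have not_near: False if "near v y \<tau>" "0 < \<tau>" "\<forall>i\<in>{1..m1}. lookup v i = 0"
    "\<forall>i\<in>{m1<..m}. 0 \<le> lookup v i" "lookup v 0 \<le> 0" for v y \<tau>
  proof -
    define z where "z = (1 / \<tau>) *\<^sub>R y"
    have lz: "lookup z i = lookup y i / \<tau>" for i
      by (simp add: z_def lookup_scaleR)
    have "z \<in> ?C" using that unfolding z_def near_def by (intro scaleR_in_conic_hull_of) auto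
    moreover have "\<bar>lookup z i - b i\<bar> \<le> \<epsilon>" if i: "i \<in> {1..m1}" for i
    proof -
      have "\<bar>0 - (lookup y i - \<tau> * b i)\<bar> \<le> \<tau> * \<epsilon>"
        using \<open>near v y \<tau>\<close> \<open>\<forall>i\<in>{1..m1}. lookup v i = 0\<close> i by (metis near_def)
      moreover have "\<bar>lookup z i - b i\<bar> = \<bar>lookup y i - \<tau> * b i\<bar> / \<tau>"
        using \<open>0 < \<tau>\<close> by (simp add: lz abs_div_pos diff_divide_distrib)
      ultimately show ?thesis using \<open>0 < \<tau>\<close> by (simp add: pos_divide_le_eq mult.commute)
    qed
    moreover have "b i - \<epsilon> \<le> lookup z i" if i: "i \<in> {m1<..m}" for i
    proof -
      have "lookup v i \<le> lookup y i - \<tau> * b i + \<tau> * \<epsilon>"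
        using \<open>near v y \<tau>\<close> i by (simp add: near_def)
      moreover have "0 \<le> lookup v i"
        using \<open>\<forall>i\<in>{m1<..m}. 0 \<le> lookup v i\<close> i by blast
      ultimately have "\<tau> * (b i - \<epsilon>) \<le> lookup y i" by (simp add: algebra_simps)
      then show ?thesis using \<open>0 < \<tau>\<close> by (simp add: lz pos_le_divide_eq mult.commute)
    qed
    moreover have "lookup z 0 \<le> vs + \<epsilon>"
    proof -
      have "lookup y 0 \<le> \<tau> * (vs + \<epsilon>)"
        using that(1,5) by (simp add: near_def algebra_simps)
      then show ?thesis using \<open>0 < \<tau>\<close> by (simp add: lz pos_divide_le_eq mult.commute)
    qed
    ultimately show False using no by (auto simp: vs_def)
  qed
  have "\<exists>L. linear L \<and> (\<forall>x\<in>Q. 0 \<le> L x) \<and> L u = (1::real)"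
  proof (rule cone_separation)
    show "0 \<in> Q" by (rule QI[of 0 0 0]) (simp add: near_def zero_in_conic_hull_of)
    show "x + y \<in> Q" if "x \<in> Q" "y \<in> Q" for x y
    proof -
      obtain x' \<tau> y' \<sigma> where "near x x' \<tau>" "near y y' \<sigma>" using \<open>x \<in> Q\<close> \<open>y \<in> Q\<close> by (auto simp: Q_def)
      then have "near (x + y) (x' + y') (\<tau> + \<sigma>)"
        by (fastforce simp: near_def lookup_add algebra_simps intro: add_in_conic_hull_of)
      then show ?thesis by (rule QI)
    qed
    show "r *\<^sub>R x \<in> Q" if r: "0 \<le> r" and "x \<in> Q" for r x
    proof -
      obtain y \<tau> where y: "near x y \<tau>" using \<open>x \<in> Q\<close> by (auto simp: Q_def)
      have "near (r *\<^sub>R x) (r *\<^sub>R y) (r * \<tau>)"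
        unfolding near_def
      proof (intro conjI ballI)
        show "0 \<le> r * \<tau>" "r *\<^sub>R y \<in> ?C" using y r by (auto simp: near_def scaleR_in_conic_hull_of)
      next
        fix i assume "i \<in> {1..m1}"
        then have "r * \<bar>lookup x i - (lookup y i - \<tau> * b i)\<bar> \<le> r * (\<tau> * \<epsilon>)"
          using y r by (intro mult_left_mono) (auto simp: near_def)
        moreover have "\<bar>lookup (r *\<^sub>R x) i - (lookup (r *\<^sub>R y) i - r * \<tau> * b i)\<bar>
            = r * \<bar>lookup x i - (lookup y i - \<tau> * b i)\<bar>"
          using r by (simp add: lookup_scaleR abs_mult_pos' algebra_simps flip: right_diff_distrib)
        ultimately show "\<bar>lookup (r *\<^sub>R x) i - (lookup (r *\<^sub>R y) i - r * \<tau> * b i)\<bar>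
            \<le> r * \<tau> * \<epsilon>" by (simp add: mult.assoc)
      next
        fix i assume "i \<in> {m1<..m}"
        then have "r * lookup x i \<le> r * (lookup y i - \<tau> * b i + \<tau> * \<epsilon>)"
          using y r by (intro mult_left_mono) (auto simp: near_def)
        then show "lookup (r *\<^sub>R x) i \<le> lookup (r *\<^sub>R y) i - r * \<tau> * b i + r * \<tau> * \<epsilon>"
          by (simp add: lookup_scaleR algebra_simps)
      next
        have "r * (lookup y 0 - \<tau> * vs - \<tau> * \<epsilon>) \<le> r * lookup x 0"
          using y r by (intro mult_left_mono) (auto simp: near_def)
        then show "lookup (r *\<^sub>R y) 0 - r * \<tau> * vs - r * \<tau> * \<epsilon> \<le> lookup (r *\<^sub>R x) 0"
          by (simp add: lookup_scaleR algebra_simps)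
      qed
      then show ?thesis by (rule QI)
    qed
    show "u \<in> Q"
      by (rule QI[of u 0 1]) (use \<epsilon> m1 in \<open>auto simp: near_def u zero_in_conic_hull_of\<close>)
    show "\<exists>N. v + N *\<^sub>R u \<in> Q" for v
    proof -
      define N where "N = (\<Sum>i\<le>m. \<bar>lookup v i\<bar>) / \<epsilon>"
      have N: "\<bar>lookup v i\<bar> \<le> N * \<epsilon>" if "i \<le> m" for i
        using member_le_sum[of i "{..m}" "\<lambda>i. \<bar>lookup v i\<bar>"] that \<epsilon>
        by (simp add: N_def)
      have "0 \<le> N" using \<epsilon> by (auto simp: N_def intro!: divide_nonneg_pos sum_nonneg)
      then have "near (v + N *\<^sub>R u) 0 N"
        using N m1 abs_le_D1[OF N] abs_le_D2[OF N, of 0]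
        by (auto simp: near_def u lookup_add lookup_scaleR zero_in_conic_hull_of)
      then show ?thesis using QI by blast
    qed
    show "- u \<notin> Q"
    proof
      assume "- u \<in> Q"
      then obtain y \<tau> where y: "near (- u) y \<tau>" by (auto simp: Q_def)
      have "near 0 y (\<tau> + 1)"
        unfolding near_def
      proof (intro conjI ballI)
        show "0 \<le> \<tau> + 1" "y \<in> ?C" using y by (auto simp: near_def)
      next
        fix i assume i: "i \<in> {1..m1}"
        then have "\<bar>b i - (lookup y i - \<tau> * b i)\<bar> \<le> \<tau> * \<epsilon>"
          using y m1 by (auto simp: near_def u)
        then show "\<bar>lookup 0 i - (lookup y i - (\<tau> + 1) * b i)\<bar> \<le> (\<tau> + 1) * \<epsilon>"
          using \<epsilon> by (simp add: algebra_simps)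
      next
        fix i assume i: "i \<in> {m1<..m}"
        then have "b i \<le> lookup y i - \<tau> * b i + \<tau> * \<epsilon>"
          using y by (auto simp: near_def u)
        then show "lookup 0 i \<le> lookup y i - (\<tau> + 1) * b i + (\<tau> + 1) * \<epsilon>"
          using \<epsilon> by (simp add: algebra_simps)
      next
        have "lookup y 0 - \<tau> * vs - \<tau> * \<epsilon> \<le> vs"
          using y by (simp add: near_def u)
        then show "lookup y 0 - (\<tau> + 1) * vs - (\<tau> + 1) * \<epsilon> \<le> lookup 0 0"
          using \<epsilon> by (simp add: algebra_simps)
      qed
      moreover have "0 < \<tau> + 1" using y by (auto simp: near_def)
      ultimately show False using not_near by fastforce
    qed
  qed
  then obtain L where L: "linear L" "\<And>x. x \<in> Q \<Longrightarrow> 0 \<le> L x" "L u = (1::real)"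
    by blast
  define e :: "nat \<Rightarrow> nat \<Rightarrow>\<^sub>0 real" where "e i = Poly_Mapping.single i 1" for i
  have L_sum: "L (\<Sum>i\<le>m. Poly_Mapping.single i (h i)) = (\<Sum>i\<le>m. h i * L (e i))" for h
  proof -
    have "Poly_Mapping.single i (h i) = h i *\<^sub>R e i" for i
      by (rule poly_mapping_eqI) (simp add: e_def lookup_scaleR lookup_single when_def)
    then show ?thesis by (simp add: linear_sum[OF L(1)] linear_scale[OF L(1)])
  qed
  define \<tau> where "\<tau> = L (e 0)"
  define \<eta> where "\<eta> i = - L (e i)" for i
  have split: "(\<Sum>i\<le>m. (if i = 0 then h0 else h i) * L (e i)) = \<tau> * h0 - (\<Sum>i=1..m. \<eta> i * h i)"
    for h0 and h :: "nat \<Rightarrow> real"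
  proof -
    have "{..m} = insert 0 {1..m}" by auto
    then have "(\<Sum>i\<le>m. (if i = 0 then h0 else h i) * L (e i))
        = h0 * L (e 0) + (\<Sum>i=1..m. (if i = 0 then h0 else h i) * L (e i))" by simp
    also have "(\<Sum>i=1..m. (if i = 0 then h0 else h i) * L (e i)) = (\<Sum>i=1..m. - (\<eta> i * h i))"
      by (intro sum.cong) (auto simp: \<eta>_def)
    finally show ?thesis by (simp add: \<tau>_def sum_negf)
  qed
  have \<tau>: "0 \<le> \<tau>"
    unfolding \<tau>_def
    by (rule L(2), rule QI[of _ 0 0]) (auto simp: near_def zero_in_conic_hull_of e_def lookup_one when_def)
  have \<eta>: "0 \<le> \<eta> i" if "i \<in> {m1<..m}" for i
  proof -
    have "near (- e i) 0 0"
      using that by (auto simp: near_def zero_in_conic_hull_of e_def lookup_single when_def)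
    then have "0 \<le> L (- e i)" by (intro L(2) QI)
    then show ?thesis by (simp add: \<eta>_def linear_neg[OF L(1)])
  qed
  have \<eta>_nonneg: "0 \<le> \<tau> * peval f x - (\<Sum>i=1..m. \<eta> i * peval (a i) x)" if x: "x \<in> K" for x
  proof -
    have "data_vec f a m x \<in> ?C"
      using conic_hull_ofI[of "{x}" K "\<lambda>_. 1" "data_vec f a m"] x by simp
    then have "near (data_vec f a m x) (data_vec f a m x) 0" by (simp add: near_def)
    then have "0 \<le> L (data_vec f a m x)" by (intro L(2) QI)
    also have "\<dots> = (\<Sum>i\<le>m. (if i = 0 then peval f x else peval (a i) x) * L (e i))"
      unfolding data_vec_def L_sum by (intro sum.cong) auto
    finally show ?thesis unfolding split .
  qed
  have "1 = (\<Sum>i\<le>m. (if i = 0 then - vs else - b i) * L (e i))"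
    using L(3) unfolding u_def L_sum by simp
  then have \<eta>_obj: "(\<Sum>i=1..m. b i * \<eta> i) = 1 + \<tau> * vs"
    unfolding split by (simp add: sum_negf mult.commute)
  show False
  \<comment> \<open>If the functional ignores the objective, \<eta> is an improving direction at
    \<theta>. Otherwise dividing \<eta> by \<tau> gives a feasible point whose value exceeds
    \<open>vs\<close> by \<open>1 / \<tau>\<close>.\<close>
  proof (cases "\<tau> = 0")
    case True
    have "dual_objective b m (\<lambda>i. \<theta> i + \<eta> i) \<le> dual_objective b m \<theta>"
    proof (intro optimal ballI)
      fix x assume x: "x \<in> K"
      have "(\<Sum>i=1..m. \<eta> i * peval (a i) x) \<le> 0" using \<eta>_nonneg[OF x] True by simp
      moreover have "(\<Sum>i=1..m. \<theta> i * peval (a i) x) \<le> peval f x" using feasible(1) x by simp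
      ultimately have "(\<Sum>i=1..m. \<theta> i * peval (a i) x) + (\<Sum>i=1..m. \<eta> i * peval (a i) x) \<le> peval f x"
        by linarith
      then show "0 \<le> peval (residual f a m (\<lambda>i. \<theta> i + \<eta> i)) x"
        by (simp add: distrib_right sum.distrib)
    qed (use feasible(2) \<eta> in auto)
    then show False using \<eta>_obj True by (simp add: dual_objective_def distrib_left sum.distrib)
  next
    case False
    then have \<tau>: "0 < \<tau>" using \<tau> by simp
    have "dual_objective b m (\<lambda>i. \<eta> i / \<tau>) \<le> vs"
      unfolding vs_def
    proof (intro optimal ballI)
      fix x assume "x \<in> K"
      then have "0 \<le> (\<tau> * peval f x - (\<Sum>i=1..m. \<eta> i * peval (a i) x)) / \<tau>"
        using \<eta>_nonneg \<tau> by (intro divide_nonneg_pos) auto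
      then show "0 \<le> peval (residual f a m (\<lambda>i. \<eta> i / \<tau>)) x"
        using \<tau> by (simp add: diff_divide_distrib sum_divide_distrib)
    qed (use \<eta> \<tau> in auto)
    moreover have "dual_objective b m (\<lambda>i. \<eta> i / \<tau>) = (1 + \<tau> * vs) / \<tau>"
      unfolding \<eta>_obj[symmetric] by (simp add: dual_objective_def sum_divide_distrib)
    ultimately show False using \<tau> by (simp add: pos_divide_le_eq mult.commute)
  qed
qed

text \<open>A fixed number of atoms, padded with weight 0 at \<open>x0\<close>, makes elements of
  the cone comparable along a sequence. \<open>Suc m\<close> counts the objective and the
  \<open>m\<close> constraints.\<close>

lemma conic_hull_enumeration:
  assumes x0: "x0 \<in> K" and y: "y \<in> conic_hull_of K (data_vec f a m)"
  shows "\<exists>g :: nat \<Rightarrow> real \<times> (real^'n). (\<forall>j. 0 \<le> fst (g j) \<and> snd (g j) \<in> K) \<and>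
     y = (\<Sum>j<Suc m. fst (g j) *\<^sub>R data_vec f a m (snd (g j)))"
proof -
  define W where "W = (\<lambda>i. Poly_Mapping.single i (1::real)) ` {..m}"
  have W: "finite W" "card W \<le> Suc m"
    using card_image_le[of "{..m}" "\<lambda>i. Poly_Mapping.single i (1::real)"] by (auto simp: W_def)
  have span: "data_vec f a m x \<in> span W" for x
    unfolding data_vec_def
  proof (rule span_sum)
    fix i assume "i \<in> {..m}"
    have "Poly_Mapping.single i (peval (if i = 0 then f else a i) x)
        = peval (if i = 0 then f else a i) x *\<^sub>R Poly_Mapping.single i 1"
      by (rule poly_mapping_eqI) (simp add: lookup_scaleR lookup_single when_def)
    also have "\<dots> \<in> span W" using \<open>i \<in> {..m}\<close> by (intro span_scale span_base) (auto simp: W_def)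
    finally show "Poly_Mapping.single i (peval (if i = 0 then f else a i) x) \<in> span W" .
  qed
  obtain S t where S: "finite S" "S \<subseteq> K" "\<forall>x\<in>S. 0 \<le> t x" "y = (\<Sum>x\<in>S. t x *\<^sub>R data_vec f a m x)"
    using y unfolding conic_hull_of_def by blast
  obtain T t' where T: "T \<subseteq> S" "card T \<le> card W" "\<forall>x\<in>T. 0 \<le> t' x"
    "(\<Sum>x\<in>T. t' x *\<^sub>R data_vec f a m x) = (\<Sum>x\<in>S. t x *\<^sub>R data_vec f a m x)"
  proof -
    have "\<exists>T\<subseteq>S. \<exists>t'. card T \<le> card W \<and> (\<forall>x\<in>T. 0 \<le> t' x) \<and>
        (\<Sum>x\<in>T. t' x *\<^sub>R data_vec f a m x) = (\<Sum>x\<in>S. t x *\<^sub>R data_vec f a m x)"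
      by (rule conic_caratheodory[OF W(1) span S(1)]) (use S(3) in blast)
    then show ?thesis using that by blast
  qed
  have "finite T" using T(1) S(1) by (rule finite_subset)
  then obtain h where h: "bij_betw h {0..<card T} T" using ex_bij_betw_nat_finite by blast
  define g where "g j = (if j < card T then (t' (h j), h j) else (0, x0))" for j
  have hT: "h j \<in> T" if "j < card T" for j using h that by (auto simp: bij_betw_def)
  have "(\<Sum>j<Suc m. fst (g j) *\<^sub>R data_vec f a m (snd (g j)))
      = (\<Sum>j\<in>{0..<card T}. fst (g j) *\<^sub>R data_vec f a m (snd (g j)))"
    using T(2) W(2) by (intro sum.mono_neutral_right) (auto simp: g_def)
  also have "\<dots> = (\<Sum>j\<in>{0..<card T}. t' (h j) *\<^sub>R data_vec f a m (h j))"
    by (intro sum.cong) (auto simp: g_def)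
  also have "\<dots> = y"
    unfolding S(4) T(4)[symmetric] by (rule sum.reindex_bij_betw[OF h])
  finally have "y = (\<Sum>j<Suc m. fst (g j) *\<^sub>R data_vec f a m (snd (g j)))" ..
  moreover have "0 \<le> fst (g j) \<and> snd (g j) \<in> K" for j
    using hT[of j] T(1,3) S(2) x0 by (auto simp: g_def)
  ultimately show ?thesis by blast
qed

text \<open>Approximate solutions with \<open>Suc m\<close> atoms have a limit once their weights
  are bounded. The residual at the strictly feasible \<theta>0 is at least \<rho> on
  \<open>K\<close>, so \<rho> times a weight is at most the pairing with that residual, which the
  approximate constraints and objective control.\<close>

theorem finitely_atomic_primal_solution:
  assumes K: "compact K" and slater: "\<forall>x\<in>K. 0 < peval (residual f a m \<theta>0) x" "\<forall>i\<in>{m1<..m}. 0 \<le> \<theta>0 i"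
  shows "\<exists>(N::nat) t X. (\<forall>j<N. 0 \<le> t j \<and> X j \<in> K) \<and>
     (\<forall>i\<in>{1..m1}. (\<Sum>j<N. t j * peval (a i) (X j)) = b i) \<and>
     (\<forall>i\<in>{m1<..m}. b i \<le> (\<Sum>j<N. t j * peval (a i) (X j))) \<and>
     (\<Sum>j<N. t j * peval f (X j)) \<le> dual_objective b m \<theta>"
proof -
  let ?C = "conic_hull_of K (data_vec f a m)"
  show ?thesis
  proof (cases "K = {}")
    \<comment> \<open>No padding point \<open>x0\<close> exists here; the cone is
      \<open>{0}\<close>, and no atoms are needed.\<close>
    case True
    then have C0: "?C = {0}" by (auto simp: conic_hull_of_def)
    have ap: "(\<forall>i\<in>{1..m1}. \<bar>b i\<bar> \<le> \<epsilon>) \<and> (\<forall>i\<in>{m1<..m}. b i \<le> \<epsilon>) \<and> 0 \<le> dual_objective b m \<theta> + \<epsilon>"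
      if "0 < \<epsilon>" for \<epsilon>
      using approximate_primal_solution[OF that] unfolding C0 by auto
    have "b i = 0" if "i \<in> {1..m1}" for i
      using field_le_epsilon[of "\<bar>b i\<bar>" 0] ap that by auto
    moreover have "b i \<le> 0" if "i \<in> {m1<..m}" for i
      using field_le_epsilon[of "b i" 0] ap that by auto
    moreover have "0 \<le> dual_objective b m \<theta>"
      using field_le_epsilon[of 0 "dual_objective b m \<theta>"] ap by auto
    ultimately show ?thesis by (intro exI[of _ 0]) auto
  next
    case False
    then obtain x0 where x0: "x0 \<in> K" by blast
    define \<epsilon> where "\<epsilon> k = 1 / real (Suc k)" for k
    have \<epsilon>: "0 < \<epsilon> k" "\<epsilon> k \<le> 1" for k by (auto simp: \<epsilon>_def)
    have \<epsilon>0: "\<epsilon> \<longlonglongrightarrow> 0" unfolding \<epsilon>_def by (rule LIMSEQ_Suc[OF lim_1_over_n])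
    have "\<exists>g :: nat \<Rightarrow> real \<times> (real^'n). (\<forall>j. 0 \<le> fst (g j) \<and> snd (g j) \<in> K) \<and>
       (\<forall>i\<in>{1..m1}. \<bar>(\<Sum>j<Suc m. fst (g j) * peval (a i) (snd (g j))) - b i\<bar> \<le> \<epsilon> k) \<and>
       (\<forall>i\<in>{m1<..m}. b i - \<epsilon> k \<le> (\<Sum>j<Suc m. fst (g j) * peval (a i) (snd (g j)))) \<and>
       (\<Sum>j<Suc m. fst (g j) * peval f (snd (g j))) \<le> dual_objective b m \<theta> + \<epsilon> k" for k
    proof -
      obtain y where y: "y \<in> ?C" "\<forall>i\<in>{1..m1}. \<bar>lookup y i - b i\<bar> \<le> \<epsilon> k"
        "\<forall>i\<in>{m1<..m}. b i - \<epsilon> k \<le> lookup y i"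
        "lookup y 0 \<le> dual_objective b m \<theta> + \<epsilon> k"
        using approximate_primal_solution[OF \<epsilon>(1)] by blast
      obtain g :: "nat \<Rightarrow> real \<times> (real^'n)" where g: "\<forall>j. 0 \<le> fst (g j) \<and> snd (g j) \<in> K"
        "y = (\<Sum>j<Suc m. fst (g j) *\<^sub>R data_vec f a m (snd (g j)))"
        using conic_hull_enumeration[OF x0 y(1)] by blast
      have l: "lookup y i = (\<Sum>j<Suc m. fst (g j) * peval (if i = 0 then f else a i) (snd (g j)))"
        if "i \<le> m" for i
        using that unfolding g(2) lookup_sum by (simp add: lookup_scaleR lookup_data_vec)
      show ?thesis using y(2-4) g(1) m1 l by (intro exI[of _ g]) (force simp del: sum.lessThan_Suc)
    qed
    then have "\<exists>g. \<forall>k. (\<forall>j. 0 \<le> fst (g k j) \<and> snd (g k j) \<in> K) \<and>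
       (\<forall>i\<in>{1..m1}. \<bar>(\<Sum>j<Suc m. fst (g k j) * peval (a i) (snd (g k j))) - b i\<bar> \<le> \<epsilon> k) \<and>
       (\<forall>i\<in>{m1<..m}. b i - \<epsilon> k \<le> (\<Sum>j<Suc m. fst (g k j) * peval (a i) (snd (g k j)))) \<and>
       (\<Sum>j<Suc m. fst (g k j) * peval f (snd (g k j))) \<le> dual_objective b m \<theta> + \<epsilon> k"
      by (intro choice allI)
    then obtain g :: "nat \<Rightarrow> nat \<Rightarrow> real \<times> (real^'n)" where g: "\<And>k j. 0 \<le> fst (g k j)" "\<And>k j. snd (g k j) \<in> K"
      "\<And>k i. i \<in> {1..m1} \<Longrightarrow> \<bar>(\<Sum>j<Suc m. fst (g k j) * peval (a i) (snd (g k j))) - b i\<bar> \<le> \<epsilon> k"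
      "\<And>k i. i \<in> {m1<..m} \<Longrightarrow> b i - \<epsilon> k \<le> (\<Sum>j<Suc m. fst (g k j) * peval (a i) (snd (g k j)))"
      "\<And>k. (\<Sum>j<Suc m. fst (g k j) * peval f (snd (g k j))) \<le> dual_objective b m \<theta> + \<epsilon> k"
      by blast
    obtain \<rho> where \<rho>: "0 < \<rho>" "\<forall>x\<in>K. \<rho> \<le> peval (residual f a m \<theta>0) x"
      using continuous_positive_lower_bound[OF K continuous_on_peval] slater(1) by blast
    \<comment> \<open>All tolerances are at most 1. For an equality, \<open>y i\<close> is within 1
      of \<open>b i\<close>; for an inequality only a lower bound is known, and the sign of
      \<open>\<theta>0 i\<close> makes it sufficient.\<close>
    define D where "D = dual_objective b m \<theta> + 1 + (\<Sum>i=1..m. \<bar>\<theta>0 i\<bar> * (\<bar>b i\<bar> + 1))"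
    have mass: "fst (g k j) \<le> D / \<rho>" if j: "j < Suc m" for k j
    proof -
      define y where "y i = (\<Sum>j<Suc m. fst (g k j) * peval (a i) (snd (g k j)))" for i
      have "\<rho> * fst (g k j) \<le> fst (g k j) * peval (residual f a m \<theta>0) (snd (g k j))"
        using \<rho>(2) g(1,2) by (subst mult.commute) (intro mult_left_mono, auto simp del: peval_residual)
      also have "\<dots> \<le> (\<Sum>j<Suc m. fst (g k j) * peval (residual f a m \<theta>0) (snd (g k j)))"
        using j g(1,2) slater(1)
        by (intro member_le_sum mult_nonneg_nonneg) (auto simp del: peval_residual simp: less_imp_le)
      also have "\<dots> = (\<Sum>j<Suc m. fst (g k j) * peval f (snd (g k j))) - (\<Sum>i=1..m. \<theta>0 i * y i)"
      proof -
        have "(\<Sum>j<Suc m. fst (g k j) * (\<Sum>i=1..m. \<theta>0 i * peval (a i) (snd (g k j))))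
            = (\<Sum>i=1..m. \<theta>0 i * y i)"
          unfolding y_def sum_distrib_left by (subst sum.swap) (intro sum.cong refl, simp only: mult_ac)
        then show ?thesis by (simp only: peval_residual right_diff_distrib sum_subtractf)
      qed
      also have "\<dots> = (\<Sum>j<Suc m. fst (g k j) * peval f (snd (g k j))) + (\<Sum>i=1..m. - (\<theta>0 i * y i))"
        by (simp only: sum_negf diff_conv_add_uminus)
      also have "\<dots> \<le> D"
        unfolding D_def
      proof (intro add_mono sum_mono)
        show "(\<Sum>j<Suc m. fst (g k j) * peval f (snd (g k j))) \<le> dual_objective b m \<theta> + 1"
          using g(5)[of k] \<epsilon>(2)[of k] by linarith
        fix i assume i: "i \<in> {1..m}"
        show "- (\<theta>0 i * y i) \<le> \<bar>\<theta>0 i\<bar> * (\<bar>b i\<bar> + 1)"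
        proof (cases "i \<le> m1")
          case True
          then have "\<bar>y i - b i\<bar> \<le> 1" using i g(3)[of i k] \<epsilon>(2)[of k] by (auto simp: y_def simp del: sum.lessThan_Suc)
          then have "\<bar>\<theta>0 i\<bar> * \<bar>y i\<bar> \<le> \<bar>\<theta>0 i\<bar> * (\<bar>b i\<bar> + 1)" by (intro mult_left_mono) linarith+
          then show ?thesis using abs_ge_minus_self[of "\<theta>0 i * y i"] by (simp add: abs_mult)
        next
          case False
          then have im: "i \<in> {m1<..m}" using i by auto
          then have "b i - 1 \<le> y i" using g(4)[of i k] \<epsilon>(2)[of k] unfolding y_def by linarith
          then have "\<theta>0 i * - y i \<le> \<theta>0 i * (\<bar>b i\<bar> + 1)"
            using slater(2) im by (intro mult_left_mono) auto
          then show ?thesis using slater(2) im by simp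
        qed
      qed
      finally show ?thesis using \<rho>(1) by (simp add: pos_le_divide_eq mult.commute)
    qed
    have "compact ({0..D / \<rho>} \<times> K)" by (intro compact_Times compact_Icc K)
    moreover have "g k j \<in> {0..D / \<rho>} \<times> K" if "j < Suc m" for k j
      using g(1,2)[of k j] mass[OF that, of k] by (simp add: mem_Times_iff)
    ultimately obtain r l where r: "strict_mono (r :: nat \<Rightarrow> nat)"
      and l: "\<forall>j<Suc m. l j \<in> {0..D / \<rho>} \<times> K \<and> (\<lambda>k. g (r k) j) \<longlonglongrightarrow> l j"
      using finite_family_convergent_subsequence[of "{0..D / \<rho>} \<times> K" "Suc m" g] by blast
    have lim: "(\<lambda>k. \<Sum>j<Suc m. fst (g (r k) j) * peval p (snd (g (r k) j)))
        \<longlonglongrightarrow> (\<Sum>j<Suc m. fst (l j) * peval p (snd (l j)))" for p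
      using l by (intro tendsto_sum tendsto_mult tendsto_fst isCont_tendsto_compose[OF isCont_peval] tendsto_snd) auto
    have \<epsilon>r: "(\<lambda>k. \<epsilon> (r k)) \<longlonglongrightarrow> 0"
      using LIMSEQ_subseq_LIMSEQ[OF \<epsilon>0 r] by (simp add: o_def)
    show ?thesis
    proof (intro exI[of _ "Suc m"] exI[of _ "\<lambda>j. fst (l j)"] exI[of _ "\<lambda>j. snd (l j)"] conjI ballI allI impI)
      fix j assume "j < Suc m"
      then have "l j \<in> {0..D / \<rho>} \<times> K" using l by blast
      then show "0 \<le> fst (l j)" "snd (l j) \<in> K" by (auto simp: mem_Times_iff)
    next
      fix i assume i: "i \<in> {1..m1}"
      have "(\<lambda>k. (\<Sum>j<Suc m. fst (g (r k) j) * peval (a i) (snd (g (r k) j))) - b i) \<longlonglongrightarrow> 0"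
        by (rule Lim_null_comparison[OF _ \<epsilon>r]) (use g(3)[OF i] in \<open>simp del: sum.lessThan_Suc\<close>)
      from LIMSEQ_unique[OF lim LIM_zero_cancel[OF this]]
      show "(\<Sum>j<Suc m. fst (l j) * peval (a i) (snd (l j))) = b i" .
    next
      fix i assume i: "i \<in> {m1<..m}"
      have "(\<lambda>k. b i - \<epsilon> (r k)) \<longlonglongrightarrow> b i - 0" by (intro tendsto_intros \<epsilon>r)
      then show "b i \<le> (\<Sum>j<Suc m. fst (l j) * peval (a i) (snd (l j)))"
        using LIMSEQ_le[OF _ lim] g(4)[OF i] by (simp del: sum.lessThan_Suc)
    next
      have "(\<lambda>k. dual_objective b m \<theta> + \<epsilon> (r k)) \<longlonglongrightarrow> dual_objective b m \<theta> + 0"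
        by (intro tendsto_intros \<epsilon>r)
      then show "(\<Sum>j<Suc m. fst (l j) * peval f (snd (l j))) \<le> dual_objective b m \<theta>"
        using LIMSEQ_le[OF lim] g(5) by (simp del: sum.lessThan_Suc)
    qed
  qed
qed

end

section \<open>Degrees of certificates and atomic moment sequences\<close>

section \<open>Degree bounds and moment sequences\<close>

lemma expo_size_le_deg: "\<alpha> \<in> Poly_Mapping.keys p \<Longrightarrow> expo_size \<alpha> \<le> deg p"
  by (simp add: deg_def)

lemma in_polys_deg: "p \<in> polys (int (deg p))"
  by (simp add: polys_def expo_size_le_deg)

lemma polys_mono: "p \<in> polys d \<Longrightarrow> d \<le> e \<Longrightarrow> p \<in> polys e"
  by (force simp: polys_def)

lemma polys_zero: "0 \<in> polys d"
  by (simp add: polys_def)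

lemma polys_add: "p \<in> polys d \<Longrightarrow> q \<in> polys d \<Longrightarrow> p + q \<in> polys d"
  using keys_add[of p q] by (force simp: polys_def)

lemma polys_scaleR: "p \<in> polys d \<Longrightarrow> r *\<^sub>R p \<in> polys d"
  by (auto simp: polys_def in_keys_iff lookup_scaleR)

lemma polys_sum: "(\<And>i. i \<in> S \<Longrightarrow> p i \<in> polys d) \<Longrightarrow> sum p S \<in> polys d"
  by (induction S rule: infinite_finite_induct) (auto intro: polys_add polys_zero)

lemma polys_diff: "p \<in> polys d \<Longrightarrow> q \<in> polys d \<Longrightarrow> p - q \<in> polys d"
  using polys_add[of p d "(-1) *\<^sub>R q"] polys_scaleR[of q d "-1"] by simp

lemma polys_mult: "p \<in> polys d \<Longrightarrow> q \<in> polys e \<Longrightarrow> p * q \<in> polys (d + e)"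
  using keys_mult[of p q] by (fastforce simp: polys_def expo_size_add)

lemma polys_monomial: "int (expo_size \<alpha>) \<le> d \<Longrightarrow> monomial \<alpha> \<in> polys d"
  by (simp add: polys_def monomial_def)

lemma polys_residual:
  "f \<in> polys d \<Longrightarrow> \<forall>i\<in>{1..m}. a i \<in> polys d \<Longrightarrow> residual f a m \<theta> \<in> polys d"
  unfolding residual_def by (intro polys_diff polys_sum polys_scaleR) auto

text \<open>\<open>D\<close> bounds the degrees of the polynomials that are squared, and not only
  half the degree of the sum, because each of them must fit into the index set of the localizing
  matrix.\<close>

lemma sosums_degree_bound:
  assumes "s \<in> sosums"
  shows "\<exists>D. s \<in> polys (int (2 * D)) \<and> (\<forall>q k w. 2 * D + deg q \<le> 2 * k \<longrightarrow>
    psd_on (loc_matrix_index k q) (loc_matrix q w) \<longrightarrow> 0 \<le> pairing (q * s) w)"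
  using assms
proof induction
  case zero
  show ?case by (simp add: polys_zero)
next
  case (add_square s p)
  then obtain D where D: "s \<in> polys (int (2 * D))"
    "\<And>q k w. 2 * D + deg q \<le> 2 * k \<Longrightarrow> psd_on (loc_matrix_index k q) (loc_matrix q w) \<Longrightarrow> 0 \<le> pairing (q * s) w"
    by blast
  define B where "B = max D (deg p)"
  have "p * p \<in> polys (int (2 * deg p))"
    using polys_mult[OF in_polys_deg in_polys_deg, of p p] by simp
  then have "p\<^sup>2 + s \<in> polys (int (2 * B))"
    using D(1) unfolding power2_eq_square by (intro polys_add) (auto elim!: polys_mono simp: B_def)
  moreover have "0 \<le> pairing (q * (p\<^sup>2 + s)) w"
    if k: "2 * B + deg q \<le> 2 * k" and psd: "psd_on (loc_matrix_index k q) (loc_matrix q w)" for q k w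
  proof -
    have "Poly_Mapping.keys p \<subseteq> loc_matrix_index k q"
      using expo_size_le_deg[of _ p] k by (fastforce simp: loc_matrix_index_def B_def)
    note form = loc_matrix_quadratic_form[OF this, of w]
    have "0 \<le> pairing (q * p\<^sup>2) w"
      unfolding form[symmetric] using psd unfolding psd_on_def by blast
    moreover have "0 \<le> pairing (q * s) w" using k by (intro D(2)[OF _ psd]) (simp add: B_def)
    ultimately show ?thesis by (simp add: distrib_left pairing_add)
  qed
  ultimately show ?case by blast
qed

definition localizing_conditions ::
  "'j set \<Rightarrow> 'j set \<Rightarrow> ('j \<Rightarrow> 'n::finite rpoly) \<Rightarrow> nat \<Rightarrow> ('n expo \<Rightarrow> real) \<Rightarrow> bool" where
  "localizing_conditions E I c k w \<longleftrightarrow>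
     (\<forall>j\<in>E. \<forall>\<alpha>\<in>loc_vector_index k (c j). loc_vector (c j) w \<alpha> = 0) \<and>
     (\<forall>j\<in>I. psd_on (loc_matrix_index k (c j)) (loc_matrix (c j) w)) \<and>
     psd_on (loc_matrix_index k (1::'n rpoly)) (loc_matrix 1 w)"

lemma Pk_feasible_iff:
  "w \<in> Pk_feasible a b m1 m E I c k \<longleftrightarrow>
     w \<in> tms (2 * k) \<and> linear_constraints a b m1 m w \<and> localizing_conditions E I c k w"
  by (simp add: Pk_feasible_def localizing_conditions_def)

lemma deg_one [simp]: "deg 1 = 0"
  by (simp add: deg_def expo_size_def flip: single_one)

text \<open>A representation of \<open>g\<close> involves finitely many polynomials, so one degree
  serves both relaxations: the same cofactors witness truncated membership and nonnegativity on
  every pseudo-moment sequence. The sums in \<open>k0\<close> are crude bounds for the single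
  degrees.\<close>

lemma truncated_certificate:
  fixes c :: "'j \<Rightarrow> 'n::finite rpoly"
  assumes fin: "finite E" "finite I" and g: "g \<in> ideal_qmodule E I c"
  shows "\<exists>k0. \<forall>k\<ge>k0. (\<exists>p\<in>ideal_trunc E c (2 * k). \<exists>q\<in>qmodule_trunc I c (2 * k). g = p + q) \<and>
     (\<forall>w. localizing_conditions E I c k w \<longrightarrow> 0 \<le> pairing g w)"
proof -
  obtain p s0 s where s0: "s0 \<in> sosums" and s: "\<forall>j\<in>I. s j \<in> sosums"
    and g_eq: "g = (\<Sum>j\<in>E. c j * p j) + (s0 + (\<Sum>j\<in>I. c j * s j))"
    using g unfolding ideal_qmodule_iff by blast
  obtain D0 where D0: "s0 \<in> polys (int (2 * D0))" "\<And>k w. 2 * D0 \<le> 2 * k \<Longrightarrow>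
    psd_on (loc_matrix_index k (1::'n rpoly)) (loc_matrix 1 w) \<Longrightarrow> 0 \<le> pairing s0 w"
    using sosums_degree_bound[OF s0] by (metis add_0_right deg_one mult_1)
  have "\<forall>j\<in>I. \<exists>D. s j \<in> polys (int (2 * D)) \<and> (\<forall>q k w. 2 * D + deg q \<le> 2 * k \<longrightarrow>
    psd_on (loc_matrix_index k q) (loc_matrix q w) \<longrightarrow> 0 \<le> pairing (q * s j) w)"
    using sosums_degree_bound s by blast
  from bchoice[OF this] obtain D where D: "\<forall>j\<in>I. s j \<in> polys (int (2 * D j)) \<and>
    (\<forall>q k w. 2 * D j + deg q \<le> 2 * k \<longrightarrow>
      psd_on (loc_matrix_index k q) (loc_matrix q w) \<longrightarrow> 0 \<le> pairing (q * s j) w)" ..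
  define k0 where "k0 = D0 + (\<Sum>j\<in>E. deg (p j) + deg (c j)) + (\<Sum>j\<in>I. D j + deg (c j))"
  have E_bound: "deg (p j) + deg (c j) \<le> 2 * k" if "j \<in> E" "k0 \<le> k" for j k
    using member_le_sum[OF that(1) _ fin(1), of "\<lambda>j. deg (p j) + deg (c j)"] that(2)
    by (simp add: k0_def)
  have I_bound: "2 * D j + deg (c j) \<le> 2 * k" if "j \<in> I" "k0 \<le> k" for j k
    using member_le_sum[OF that(1) _ fin(2), of "\<lambda>j. D j + deg (c j)"] that(2)
    by (simp add: k0_def)
  show ?thesis
  proof (intro exI[of _ k0] allI impI conjI)
    fix k assume k: "k0 \<le> k"
    have "(\<Sum>j\<in>E. c j * p j) \<in> ideal_trunc E c (2 * k)"
      unfolding ideal_trunc_def mem_Collect_eq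
    proof (intro exI[of _ p] conjI refl ballI)
      fix j assume "j \<in> E"
      then show "p j \<in> polys (int (2 * k) - int (deg (c j)))"
        using E_bound[OF _ k, of j] by (intro polys_mono[OF in_polys_deg]) auto
    qed
    moreover have "s0 + (\<Sum>j\<in>I. c j * s j) \<in> qmodule_trunc I c (2 * k)"
      unfolding qmodule_trunc_def mem_Collect_eq
    proof (rule exI[of _ s0], rule exI[of _ s], intro conjI refl ballI IntI)
      show "s0 \<in> sos" "s0 \<in> polys (int (2 * k))"
        using s0 k polys_mono[OF D0(1), of "int (2 * k)"] by (auto simp: sos_eq_sosums k0_def)
      fix j assume j: "j \<in> I"
      show "s j \<in> sos" using s j by (simp add: sos_eq_sosums)
      show "s j \<in> polys (int (2 * k) - int (deg (c j)))"
        using I_bound[OF j k] D j by (auto elim!: polys_mono dest!: bspec)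
    qed
    ultimately show "\<exists>p\<in>ideal_trunc E c (2 * k). \<exists>q\<in>qmodule_trunc I c (2 * k). g = p + q"
      using g_eq by blast
    fix w assume w: "localizing_conditions E I c k w"
    have "pairing (c j * p j) w = 0" if j: "j \<in> E" for j
    proof -
      have "Poly_Mapping.keys (p j) \<subseteq> loc_vector_index k (c j)"
        using expo_size_le_deg[of _ "p j"] E_bound[OF j k] by (fastforce simp: loc_vector_index_def)
      from loc_vector_linear_form[OF this, of w] show ?thesis
        using w j by (simp add: localizing_conditions_def)
    qed
    moreover have "0 \<le> pairing s0 w"
      using w k by (intro D0(2)[of k]) (auto simp: localizing_conditions_def k0_def)
    moreover have "0 \<le> pairing (c j * s j) w" if j: "j \<in> I" for j
      using D j I_bound[OF j k] w by (auto simp: localizing_conditions_def)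
    ultimately show "0 \<le> pairing g w"
      unfolding g_eq by (simp add: pairing_add pairing_sum sum_nonneg)
  qed
qed

lemma truncated_in_ideal_qmodule:
  assumes "p \<in> ideal_trunc E c k" "q \<in> qmodule_trunc I c k"
  shows "p + q \<in> ideal_qmodule E I c"
proof -
  obtain h where "p = (\<Sum>j\<in>E. c j * h j)" using assms(1) unfolding ideal_trunc_def by blast
  moreover obtain s0 s where "s0 \<in> sosums" "\<forall>j\<in>I. s j \<in> sosums" "q = s0 + (\<Sum>j\<in>I. c j * s j)"
    using assms(2) unfolding qmodule_trunc_def sos_eq_sosums by blast
  ultimately show ?thesis by (simp add: ideal_qmoduleI)
qed

definition atomic_tms :: "nat \<Rightarrow> nat \<Rightarrow> (nat \<Rightarrow> real) \<Rightarrow> (nat \<Rightarrow> real^'n) \<Rightarrow> 'n::finite expo \<Rightarrow> real" where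
  "atomic_tms d N t X = tms_restrict d (\<lambda>\<alpha>. \<Sum>i<N. t i * expo_eval \<alpha> (X i))"

lemma pairing_atomic_tms:
  assumes "p \<in> polys (int d)"
  shows "pairing p (atomic_tms d N t X) = (\<Sum>i<N. t i * peval p (X i))"
proof -
  have "pairing p (atomic_tms d N t X)
      = (\<Sum>\<alpha>\<in>Poly_Mapping.keys p. \<Sum>i<N. lookup p \<alpha> * (t i * expo_eval \<alpha> (X i)))"
    using assms unfolding pairing_def sum_distrib_left[symmetric]
    by (intro sum.cong refl) (auto simp: atomic_tms_def tms_restrict_def polys_def expos_def)
  also have "\<dots> = (\<Sum>i<N. t i * peval p (X i))"
    by (subst sum.swap) (simp add: peval_def sum_distrib_left mult_ac)
  finally show ?thesis .
qed

lemma psd_atomic_tms: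
  assumes "\<And>i. i < N \<Longrightarrow> 0 \<le> t i * peval q (X i)"
  shows "psd_on (loc_matrix_index k q) (loc_matrix q (atomic_tms (2 * k) N t X))"
  unfolding psd_on_def
proof (intro conjI ballI allI loc_matrix_symmetric)
  fix u :: "'a expo \<Rightarrow> real"
  let ?S = "loc_matrix_index k q"
  define L where "L = loc_matrix q (atomic_tms (2 * k) N t X)"
  have entry: "L \<alpha> \<beta>
      = (\<Sum>i<N. t i * peval q (X i) * (expo_eval \<alpha> (X i) * expo_eval \<beta> (X i)))"
    if "\<alpha> \<in> ?S" "\<beta> \<in> ?S" for \<alpha> \<beta>
  proof -
    have "q * monomial (\<alpha> + \<beta>) \<in> polys (int (deg q) + int (expo_size (\<alpha> + \<beta>)))"
      by (intro polys_mult in_polys_deg polys_monomial) simp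
    then have "q * monomial (\<alpha> + \<beta>) \<in> polys (int (2 * k))"
      by (rule polys_mono) (use that in \<open>simp add: loc_matrix_index_def expo_size_add\<close>)
    from pairing_atomic_tms[OF this] show ?thesis
      by (simp add: L_def loc_matrix_def expo_eval_add mult_ac)
  qed
  have "(\<Sum>\<alpha>\<in>?S. \<Sum>\<beta>\<in>?S. u \<alpha> * L \<alpha> \<beta> * u \<beta>)
      = (\<Sum>\<alpha>\<in>?S. \<Sum>\<beta>\<in>?S. \<Sum>i<N. t i * peval q (X i) * ((u \<alpha> * expo_eval \<alpha> (X i)) * (u \<beta> * expo_eval \<beta> (X i))))"
    by (intro sum.cong refl) (simp add: entry sum_distrib_left sum_distrib_right mult_ac)
  also have "\<dots> = (\<Sum>\<alpha>\<in>?S. \<Sum>i<N. \<Sum>\<beta>\<in>?S. t i * peval q (X i) * ((u \<alpha> * expo_eval \<alpha> (X i)) * (u \<beta> * expo_eval \<beta> (X i))))"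
    by (intro sum.cong refl sum.swap)
  also have "\<dots> = (\<Sum>i<N. \<Sum>\<alpha>\<in>?S. \<Sum>\<beta>\<in>?S. t i * peval q (X i) * ((u \<alpha> * expo_eval \<alpha> (X i)) * (u \<beta> * expo_eval \<beta> (X i))))"
    by (rule sum.swap)
  also have "\<dots> = (\<Sum>i<N. t i * peval q (X i) * (\<Sum>\<alpha>\<in>?S. u \<alpha> * expo_eval \<alpha> (X i))\<^sup>2)"
    by (simp only: power2_eq_square sum_product) (simp only: sum_distrib_left)
  also have "\<dots> \<ge> 0" by (intro sum_nonneg mult_nonneg_nonneg[OF assms]) auto
  finally show "0 \<le> (\<Sum>\<alpha>\<in>?S. \<Sum>\<beta>\<in>?S. u \<alpha> * loc_matrix q (atomic_tms (2 * k) N t X) \<alpha> \<beta> * u \<beta>)"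
    by (simp only: L_def)
qed

lemma localizing_conditions_atomic_tms:
  assumes "\<And>i. i < N \<Longrightarrow> 0 \<le> t i" "\<And>i. i < N \<Longrightarrow> X i \<in> semialg E I c"
  shows "localizing_conditions E I c k (atomic_tms (2 * k) N t X)"
  unfolding localizing_conditions_def
proof (intro conjI ballI psd_atomic_tms)
  fix j \<alpha> assume j: "j \<in> E" and \<alpha>: "\<alpha> \<in> loc_vector_index k (c j)"
  have "c j * monomial \<alpha> \<in> polys (int (deg (c j)) + int (expo_size \<alpha>))"
    by (intro polys_mult in_polys_deg polys_monomial) simp
  then have "c j * monomial \<alpha> \<in> polys (int (2 * k))"
    by (rule polys_mono) (use \<alpha> in \<open>simp add: loc_vector_index_def\<close>)
  then show "loc_vector (c j) (atomic_tms (2 * k) N t X) \<alpha> = 0"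
    unfolding loc_vector_def using assms(2) j
    by (subst pairing_atomic_tms) (auto simp: semialg_def intro!: sum.neutral)
qed (use assms in \<open>auto simp: semialg_def\<close>)

text \<open>In a second countable space the complement of the support is covered by the countably
  many basic open sets of measure 0.\<close>

lemma AE_in_measure_support:
  fixes M :: "'a::second_countable_topology measure"
  assumes sets: "sets M = sets borel"
  shows "AE x in M. x \<in> measure_support M"
proof -
  obtain B :: "'a set set" where B: "countable B" "topological_basis B"
    using ex_countable_basis by blast
  define B0 where "B0 = {U \<in> B. emeasure M U = 0}"
  have open_B: "open U" if "U \<in> B" for U using B(2) that by (rule topological_basis_open)
  have "countable B0" using B(1) by (simp add: B0_def)
  then have "AE x in M. \<forall>U\<in>B0. x \<notin> U"
  proof (rule AE_ball_countable[THEN iffD2, rule_format])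
    fix U assume "U \<in> B0"
    then have "U \<in> null_sets M" using open_B by (auto simp: B0_def null_sets_def sets)
    then show "AE x in M. x \<notin> U" by (rule AE_not_in)
  qed
  then show ?thesis
  proof eventually_elim
    case (elim x)
    show ?case
      unfolding measure_support_def
    proof safe
      fix V assume V: "open V" "x \<in> V"
      then obtain U where U: "U \<in> B" "x \<in> U" "U \<subseteq> V" using topological_basisE[OF B(2)] by blast
      have "emeasure M U \<noteq> 0" using elim U by (auto simp: B0_def)
      moreover have "emeasure M U \<le> emeasure M V" using U V by (intro emeasure_mono) (auto simp: sets)
      ultimately show "0 < emeasure M V" by (metis not_gr_zero le_zero_eq)
    qed
  qed
qed

lemma pairing_moment:
  assumes p: "p \<in> polys (int d)"
    and M: "\<And>\<alpha>. \<alpha> \<in> expos d \<Longrightarrow> integrable M (expo_eval \<alpha>) \<and> y \<alpha> = integral\<^sup>L M (expo_eval \<alpha>)"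
  shows "pairing p y = integral\<^sup>L M (peval p)"
proof -
  have k: "\<alpha> \<in> expos d" if "\<alpha> \<in> Poly_Mapping.keys p" for \<alpha>
    using p that by (auto simp: polys_def expos_def)
  have "integral\<^sup>L M (peval p) = (\<Sum>\<alpha>\<in>Poly_Mapping.keys p. integral\<^sup>L M (\<lambda>x. lookup p \<alpha> * expo_eval \<alpha> x))"
    unfolding peval_def[abs_def] using M k by (intro Bochner_Integration.integral_sum) auto
  also have "\<dots> = pairing p y"
    unfolding pairing_def using M k by (intro sum.cong) auto
  finally show ?thesis ..
qed

lemma pairing_moment_cone_nonneg:
  assumes p: "p \<in> polys (int d)" "\<And>x. x \<in> K \<Longrightarrow> 0 \<le> peval p x" and y: "y \<in> moment_cone d K"
  shows "0 \<le> pairing p y"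
proof -
  obtain M :: "(real^'a) measure" where M: "sets M = sets borel" "measure_support M \<subseteq> K"
    "\<forall>\<alpha>\<in>expos d. integrable M (expo_eval \<alpha>) \<and> y \<alpha> = integral\<^sup>L M (expo_eval \<alpha>)"
    using y by (auto simp: moment_cone_def)
  have "AE x in M. 0 \<le> peval p x"
    using AE_in_measure_support[OF M(1)] M(2) p(2) by (auto elim!: eventually_mono)
  moreover have "pairing p y = integral\<^sup>L M (peval p)"
    using M(3) by (intro pairing_moment[OF p(1)]) auto
  ultimately show ?thesis by (simp add: integral_nonneg_AE)
qed

lemma atomic_in_moment_cone:
  fixes X :: "nat \<Rightarrow> real^'n::finite"
  assumes K: "closed K" and X: "\<And>i. i < N \<Longrightarrow> 0 \<le> t i" "\<And>i. i < N \<Longrightarrow> X i \<in> K"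
  shows "tms_restrict d (\<lambda>\<alpha>. \<Sum>i<N. t i * expo_eval \<alpha> (X i)) \<in> moment_cone d K"
proof -
  \<comment> \<open>A weighted counting measure on the indices, pushed forward by \<open>X\<close>,
    so coinciding points need no special treatment.\<close>
  define P where "P = density (count_space {..<N}) (\<lambda>i. ennreal (t i))"
  define M where "M = distr P borel X"
  have X_meas: "X \<in> measurable P borel" by (simp add: P_def)
  have meas: "expo_eval \<alpha> \<in> borel_measurable borel" for \<alpha> :: "'n expo"
    using continuous_on_peval[of UNIV "monomial \<alpha>"]
    by (intro borel_measurable_continuous_onI) (simp add: continuous_on_cong[OF refl peval_monomial])
  have t_AE: "AE i in count_space {..<N}. 0 \<le> t i" using X(1) by (auto simp: AE_count_space)
  have int: "integrable M (expo_eval \<alpha>)" and val: "integral\<^sup>L M (expo_eval \<alpha>) = (\<Sum>i<N. t i * expo_eval \<alpha> (X i))"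
    for \<alpha> :: "'n expo"
  proof -
    have "integrable P (\<lambda>i. expo_eval \<alpha> (X i))"
      unfolding P_def by (subst integrable_density) (auto simp: t_AE integrable_count_space)
    then show "integrable M (expo_eval \<alpha>)"
      unfolding M_def by (simp add: integrable_distr_eq[OF X_meas meas])
    have "integral\<^sup>L M (expo_eval \<alpha>) = integral\<^sup>L P (\<lambda>i. expo_eval \<alpha> (X i))"
      unfolding M_def by (rule integral_distr[OF X_meas meas])
    also have "\<dots> = (\<Sum>i<N. t i * expo_eval \<alpha> (X i))"
      unfolding P_def by (subst integral_density) (auto simp: t_AE lebesgue_integral_count_space_finite)
    finally show "integral\<^sup>L M (expo_eval \<alpha>) = (\<Sum>i<N. t i * expo_eval \<alpha> (X i))" .
  qed
  have "x \<notin> measure_support M" if x: "x \<notin> K" for x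
  proof -
    have "X -` (- K) \<inter> space P = {}" using X(2) by (auto simp: P_def)
    then have "emeasure M (- K) = 0"
      unfolding M_def using K by (subst emeasure_distr[OF X_meas]) auto
    then show ?thesis using K x by (auto simp: measure_support_def intro!: exI[of _ "- K"])
  qed
  moreover have "sets M = sets borel" by (simp add: M_def)
  ultimately show ?thesis
    unfolding moment_cone_def mem_Collect_eq
    using int val by (intro conjI exI[of _ M]) (auto simp: tms_def tms_restrict_def)
qed

text \<open>The constant 1 has degree 0, so a small positive constant can be subtracted from
  \<open>p\<close> without leaving the space or the cone.\<close>

lemma interior_nonneg_imp_positive:
  assumes p: "p \<in> int_nonneg_polys d K" and x: "x \<in> K"
  shows "0 < peval p x"
proof -
  obtain T where T: "openin (top_of_set (polys (int d))) T" "p \<in> T" "T \<subseteq> nonneg_polys d K"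
    using p by (auto simp: int_nonneg_polys_def interior_of_def)
  obtain U where U: "open U" "T = polys (int d) \<inter> U"
    using T(1) by (auto simp: openin_open)
  have "((\<lambda>e. p - e *\<^sub>R 1) \<longlongrightarrow> p - 0 *\<^sub>R 1) (at_right (0::real))" by (intro tendsto_intros)
  then have "\<forall>\<^sub>F e in at_right 0. p - e *\<^sub>R 1 \<in> U"
    using U T(2) by (intro topological_tendstoD) auto
  then have "\<forall>\<^sub>F e in at_right 0. p - e *\<^sub>R 1 \<in> U \<and> (0::real) < e"
    by (intro eventually_conj eventually_at_right_less)
  then obtain e :: real where e: "p - e *\<^sub>R 1 \<in> U" "0 < e"
    using eventually_happens[of _ "at_right (0::real)"] by (auto simp: trivial_limit_at_right_real)
  have "Poly_Mapping.keys (p - e *\<^sub>R 1) \<subseteq> Poly_Mapping.keys p \<union> {0}"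
    by (auto simp: in_keys_iff lookup_minus lookup_scaleR lookup_one when_def split: if_splits)
  then have "p - e *\<^sub>R 1 \<in> polys (int d)"
    using T(2) U(2) by (auto simp: polys_def expo_size_def)
  then have "p - e *\<^sub>R 1 \<in> nonneg_polys d K" using e(1) U(2) T(3) by blast
  then have "0 \<le> peval (p - e *\<^sub>R 1) x" using x by (simp add: nonneg_polys_def)
  then show ?thesis using e(2) by simp
qed

section \<open>Ranks and kernels of moment matrices\<close>

section \<open>Flat truncation\<close>

lemma moment_entry: "loc_matrix 1 w \<alpha> \<beta> = w (\<alpha> + \<beta>)"
  using pairing_single[of "\<alpha> + \<beta>" 1 w] by (simp add: loc_matrix_def monomial_def)

lemma moment_index: "loc_matrix_index s 1 = expos s"
  by (auto simp: loc_matrix_index_def expos_def)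

definition moment_row :: "nat \<Rightarrow> ('n::finite expo \<Rightarrow> real) \<Rightarrow> 'n expo \<Rightarrow> 'n expo \<Rightarrow>\<^sub>0 real" where
  "moment_row s w \<alpha> = (\<Sum>\<beta>\<in>expos s. Poly_Mapping.single \<beta> (w (\<alpha> + \<beta>)))"

text \<open>Restriction does not touch the entries in use, so ranks at different truncation orders
  are all computed from rows of the same \<open>w\<close>.\<close>

lemma moment_rank_restrict:
  assumes "s \<le> t"
  shows "moment_rank s (tms_restrict (2 * t) w) = dim (moment_row s w ` expos s)"
proof -
  have "tms_restrict (2 * t) w (\<alpha> + \<beta>) = w (\<alpha> + \<beta>)" if "\<alpha> \<in> expos s" "\<beta> \<in> expos s" for \<alpha> \<beta>
    using that assms by (simp add: tms_restrict_def expos_def expo_size_add)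
  then have "(\<lambda>\<alpha>. \<Sum>\<beta>\<in>expos s. Poly_Mapping.single \<beta> (tms_restrict (2 * t) w (\<alpha> + \<beta>))) ` expos s
      = moment_row s w ` expos s"
    by (intro image_cong refl) (simp add: moment_row_def)
  then show ?thesis by (simp add: moment_rank_def rank_on_def moment_index moment_entry)
qed

text \<open>Dropping columns is a linear map that sends the longer rows to the shorter ones.\<close>

lemma dim_moment_rows_mono:
  assumes st: "s \<le> t"
  shows "dim (moment_row s w ` expos s) \<le> dim (moment_row t w ` expos t)"
proof -
  define \<pi> :: "('a expo \<Rightarrow>\<^sub>0 real) \<Rightarrow> 'a expo \<Rightarrow>\<^sub>0 real" where
    "\<pi> v = (\<Sum>\<beta>\<in>expos s. Poly_Mapping.single \<beta> (lookup v \<beta>))" for v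
  have l: "lookup (\<Sum>\<beta>\<in>expos k. Poly_Mapping.single \<beta> (h \<beta>)) \<gamma> = (if \<gamma> \<in> expos k then h \<gamma> else 0)"
    for h :: "'a expo \<Rightarrow> real" and \<gamma> k
    by (simp add: lookup_sum lookup_single when_def eq_commute)
  have "linear \<pi>"
    by (intro linearI poly_mapping_eqI) (simp_all add: \<pi>_def l lookup_add lookup_scaleR)
  have sub: "expos s \<subseteq> expos t" using st by (auto simp: expos_def)
  have row: "\<pi> (moment_row t w \<alpha>) = moment_row s w \<alpha>" for \<alpha>
    using sub by (intro poly_mapping_eqI) (auto simp: \<pi>_def moment_row_def l)
  obtain B where B: "B \<subseteq> moment_row t w ` expos t" "independent B"
    "moment_row t w ` expos t \<subseteq> span B" "card B = dim (moment_row t w ` expos t)"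
    using basis_exists by blast
  have "finite B" using B(1) by (rule finite_subset) simp
  have "moment_row s w ` expos s \<subseteq> \<pi> ` span B"
    using B(3) sub by (force simp flip: row)
  also have "\<dots> = span (\<pi> ` B)" using linear_span_image[OF \<open>linear \<pi>\<close>] by simp
  finally have "dim (moment_row s w ` expos s) \<le> card (\<pi> ` B)"
    using \<open>finite B\<close> by (intro dim_le_card) auto
  also have "\<dots> \<le> card B" by (rule card_image_le[OF \<open>finite B\<close>])
  finally show ?thesis using B(4) by simp
qed

text \<open>\<open>Suc n\<close> strict increases would carry \<open>r\<close> beyond the bound
  \<open>n\<close>.\<close>

lemma stationary_step:
  fixes r :: "nat \<Rightarrow> nat"
  assumes mono: "\<And>i. r i \<le> r (Suc i)" and bound: "r (Suc n) \<le> n"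
  shows "\<exists>i\<le>n. r i = r (Suc i)"
proof (rule ccontr)
  assume no: "\<not> ?thesis"
  have "i \<le> Suc n \<Longrightarrow> i \<le> r i" for i
  proof (induction i)
    case (Suc i)
    then have "r i \<noteq> r (Suc i)" using no by auto
    then show ?case using Suc mono[of i] by simp
  qed simp
  from this[of "Suc n"] show False using bound by simp
qed

text \<open>The square of \<open>p\<close> pairs to 0, so positivity along
  \<open>q + t *\<^sub>R p\<close> is an affine inequality in \<open>t\<close>, and its slope must
  vanish.\<close>

lemma pairing_eq_zero_of_square:
  assumes psd: "psd_on (loc_matrix_index k (1::'n::finite rpoly)) (loc_matrix 1 w)"
    and p: "p \<in> polys (int k)" and q: "q \<in> polys (int k)" and 0: "pairing (p\<^sup>2) w \<le> 0"
  shows "pairing (p * q) w = 0"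
proof -
  have sq: "0 \<le> pairing (r\<^sup>2) w" if "r \<in> polys (int k)" for r :: "'n rpoly"
  proof -
    have "Poly_Mapping.keys r \<subseteq> loc_matrix_index k 1"
      using that by (auto simp: moment_index expos_def polys_def)
    note form = loc_matrix_quadratic_form[OF this, of w]
    have "0 \<le> pairing (1 * r\<^sup>2) w"
      unfolding form[symmetric] using psd unfolding psd_on_def by blast
    then show ?thesis by simp
  qed
  have quad: "0 \<le> pairing (q\<^sup>2) w + 2 * t * pairing (p * q) w" for t
  proof -
    have "0 \<le> pairing ((q + t *\<^sub>R p)\<^sup>2) w" using p q by (intro sq polys_add polys_scaleR)
    also have "(q + t *\<^sub>R p)\<^sup>2 = q\<^sup>2 + ((2 * t) *\<^sub>R (p * q) + t\<^sup>2 *\<^sub>R p\<^sup>2)"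
      by (simp add: scaleR_conv_of_real power2_eq_square algebra_simps)
    also have "pairing \<dots> w = pairing (q\<^sup>2) w + 2 * t * pairing (p * q) w"
      using 0 sq[OF p] by (simp add: pairing_add pairing_scaleR)
    finally show ?thesis .
  qed
  show ?thesis
  proof (rule ccontr)
    assume nz: "pairing (p * q) w \<noteq> 0"
    have "0 \<le> pairing (q\<^sup>2) w + 2 * (- (pairing (q\<^sup>2) w + 1) / (2 * pairing (p * q) w)) * pairing (p * q) w"
      by (rule quad)
    also have "\<dots> = - 1" using nz by (simp add: field_simps)
    finally show False by simp
  qed
qed

section \<open>Weak duality, exactness of the relaxations and flat truncation\<close>

lemma inf_value_eq:
  "x \<in> S \<Longrightarrow> F x \<le> v \<Longrightarrow> (\<And>z. z \<in> S \<Longrightarrow> v \<le> F z) \<Longrightarrow> inf_value F S = ereal v"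
  unfolding inf_value_def by (rule antisym) (auto intro: INF_lower2 INF_greatest)

lemma sup_value_eq:
  "x \<in> S \<Longrightarrow> v \<le> F x \<Longrightarrow> (\<And>z. z \<in> S \<Longrightarrow> F z \<le> v) \<Longrightarrow> sup_value F S = ereal v"
  unfolding sup_value_def by (rule antisym) (auto intro: SUP_upper2 SUP_least)

lemma deg_le_of_half_deg: "half_deg p \<le> k \<Longrightarrow> deg p \<le> 2 * k"
  unfolding half_deg_def by linarith

text \<open>The inequality of weak duality. It rests on the linear constraints alone and so applies
  to true moments and to pseudo-moments alike.\<close>

lemma pairing_residual_le:
  assumes w: "linear_constraints a b m1 m w" and \<theta>: "\<forall>i\<in>{m1<..m}. 0 \<le> \<theta> i" and "m1 \<le> m"
  shows "pairing (residual f a m \<theta>) w \<le> pairing f w - dual_objective b m \<theta>"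
proof -
  have "pairing (f - g) w = pairing f w - pairing g w" for g
    using pairing_add[of "f - g" g w] by simp
  then have "pairing (residual f a m \<theta>) w = pairing f w - (\<Sum>i=1..m. \<theta> i * pairing (a i) w)"
    by (simp add: residual_def pairing_sum pairing_scaleR)
  moreover have "dual_objective b m \<theta> \<le> (\<Sum>i=1..m. \<theta> i * pairing (a i) w)"
    unfolding dual_objective_def
  proof (rule sum_mono)
    fix i assume i: "i \<in> {1..m}"
    show "b i * \<theta> i \<le> \<theta> i * pairing (a i) w"
    proof (cases "i \<le> m1")
      case True
      then show ?thesis using w i by (simp add: linear_constraints_def)
    next
      case False
      then have "b i \<le> pairing (a i) w" "0 \<le> \<theta> i" using w \<theta> i by (auto simp: linear_constraints_def)
      then show ?thesis by (simp add: mult.commute mult_left_mono)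
    qed
  qed
  ultimately show ?thesis by simp
qed

theorem theorem3p2:
  fixes f :: "'n::finite rpoly" and a :: "nat \<Rightarrow> 'n rpoly" and b :: "nat \<Rightarrow> real"
    and m1 m d :: nat
    and E I :: "'j set" and c :: "'j \<Rightarrow> 'n rpoly" and K :: "(real^'n) set"
    and \<theta>opt :: "nat \<Rightarrow> real" and yopt :: "'n expo \<Rightarrow> real"
  assumes "f \<in> polys (int d)" and "\<forall>i\<in>{1..m}. a i \<in> polys (int d)"
    and "m1 \<le> m"
    and "finite E" and "finite I" and "E \<inter> I = {}"
    and "K = semialg E I c"
    and "archimedean_sum (ideal_gen E c) (qmodule I c)"
    and "is_maximizer (dual_objective b m) (D_feasible f a m1 m d K) \<theta>opt"
    and "is_minimizer (pairing f) (P_feasible a b m1 m d K) yopt"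
    and "yopt \<noteq> (\<lambda>_. 0)"
    and "\<exists>\<theta>\<in>D_feasible f a m1 m d K. residual f a m \<theta> \<in> int_nonneg_polys d K"
    and "\<forall>x. is_minimizer (peval (residual f a m \<theta>opt)) K x \<longrightarrow>
           optimality_conditions E I c (residual f a m \<theta>opt) x"
  shows "(\<exists>N\<ge>d0 f a m (E \<union> I) c. \<forall>k\<ge>N.
            sup_value (dual_objective b m) (Dk_feasible f a m1 m E I c k)
              = inf_value (pairing f) (Pk_feasible a b m1 m E I c k) \<and>
            inf_value (pairing f) (Pk_feasible a b m1 m E I c k)
              = sup_value (dual_objective b m) (D_feasible f a m1 m d K) \<and>
            sup_value (dual_objective b m) (D_feasible f a m1 m d K)
              = inf_value (pairing f) (P_feasible a b m1 m d K)) \<and>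
         (\<exists>N\<ge>d0 f a m (E \<union> I) c. \<forall>k\<ge>N. \<forall>w.
            is_minimizer (pairing f) (Pk_feasible a b m1 m E I c k) w \<longrightarrow>
            flat_truncation (d0 f a m (E \<union> I) c) (dK (E \<union> I) c) k w)"
proof -
  note fd = assms(1) and ad = assms(2) and m1 = assms(3) and fin = assms(4,5) and disj = assms(6)
    and K_def = assms(7) and archM = assms(8) and opt = assms(13)
  define F where "F = residual f a m \<theta>opt"
  define M where "M = ideal_qmodule E I c"
  define vs where "vs = dual_objective b m \<theta>opt"
  define D0 where "D0 = d0 f a m (E \<union> I) c"
  define DK where "DK = dK (E \<union> I) c"
  define Z where "Z = {x \<in> K. peval F x = 0}"
  interpret archimedean_poly_module M
    unfolding M_def by (rule archimedean_ideal_qmodule[OF archM])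
  have K_pos: "positivity_set = K"
    unfolding positivity_set_def unfolding K_def M_def
    by (rule set_eqI) (simp add: semialg_iff_ideal_qmodule_nonneg[OF fin])
  have compact_K: "compact K" unfolding K_def by (rule compact_semialg[OF fin archM])
  have \<theta>_feas: "\<theta>opt \<in> D_feasible f a m1 m d K"
    and \<theta>_max: "\<And>\<theta>. \<theta> \<in> D_feasible f a m1 m d K \<Longrightarrow> dual_objective b m \<theta> \<le> vs"
    using assms(9) by (auto simp: is_maximizer_def vs_def)
  have D_feasible_iff: "\<theta> \<in> D_feasible f a m1 m d K \<longleftrightarrow>
      (\<forall>x\<in>K. 0 \<le> peval (residual f a m \<theta>) x) \<and> (\<forall>i\<in>{m1<..m}. 0 \<le> \<theta> i)" for \<theta>
    using polys_residual[OF fd ad] by (auto simp: D_feasible_def nonneg_polys_def)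
  have F_nonneg: "0 \<le> peval F x" if "x \<in> K" for x
    using \<theta>_feas that unfolding D_feasible_iff F_def by blast
  have \<theta>_sign: "\<forall>i\<in>{m1<..m}. 0 \<le> \<theta>opt i" using \<theta>_feas unfolding D_feasible_iff by blast

  have local: "\<exists>S\<in>M. peval S v = 0 \<and> quadratic_growth_at v (F - S)"
    if v: "v \<in> Z" for v
  proof -
    have "is_minimizer (peval F) K v" using v F_nonneg by (auto simp: is_minimizer_def Z_def)
    then have "optimality_conditions E I c F v" using opt by (simp add: F_def)
    then obtain l where "multipliers E I c F v l" "SCC I c v l" "SOSC E I c F v l"
      by (auto simp: optimality_conditions_def)
    then show ?thesis
      unfolding M_def using v by (intro local_certificate[OF fin disj]) (auto simp: Z_def K_def)
  qed
  note cert_ass = compact_K[folded K_pos] F_nonneg[folded K_pos] Z_def[folded K_pos] local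
  have finite_Z: "finite Z"
    by (rule finite_zeros[of F, OF cert_ass])
  have cert: "\<exists>\<eta>>0. F - \<eta> *\<^sub>R p\<^sup>2 \<in> M" if "\<And>v. v \<in> Z \<Longrightarrow> peval p v = 0" for p
    by (rule minus_square_mem[of F Z, OF cert_ass that])

  \<comment> \<open>The certificate for the zero polynomial already gives exactness: the one order
    \<open>k1\<close> makes \<open>\<theta>opt\<close> feasible for the dual relaxation and bounds
    the primal relaxation below by \<open>vs\<close>.\<close>
  have "F \<in> M" using cert[of 0] by auto
  from truncated_certificate[OF fin this[unfolded M_def]] obtain k1 where k1: "\<And>k. k1 \<le> k \<Longrightarrow>
     (\<exists>p\<in>ideal_trunc E c (2 * k). \<exists>q\<in>qmodule_trunc I c (2 * k). F = p + q)"
    "\<And>k w. k1 \<le> k \<Longrightarrow> localizing_conditions E I c k w \<Longrightarrow> 0 \<le> pairing F w" by blast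

  \<comment> \<open>One finite combination of points serves at every order: its moments up to degree
    \<open>d\<close> solve (P), those up to degree \<open>2 * k\<close> solve the
    relaxation.\<close>
  obtain N :: nat and t X where tX: "\<And>j. j < N \<Longrightarrow> 0 \<le> t j" "\<And>j. j < N \<Longrightarrow> X j \<in> K"
    "\<And>i. i \<in> {1..m1} \<Longrightarrow> (\<Sum>j<N. t j * peval (a i) (X j)) = b i"
    "\<And>i. i \<in> {m1<..m} \<Longrightarrow> b i \<le> (\<Sum>j<N. t j * peval (a i) (X j))"
    "(\<Sum>j<N. t j * peval f (X j)) \<le> vs"
  proof -
    obtain \<theta>0 where \<theta>0: "\<theta>0 \<in> D_feasible f a m1 m d K" "residual f a m \<theta>0 \<in> int_nonneg_polys d K"
      using assms(12) by blast
    have "\<exists>(N::nat) t X. (\<forall>j<N. 0 \<le> t j \<and> X j \<in> K) \<and>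
       (\<forall>i\<in>{1..m1}. (\<Sum>j<N. t j * peval (a i) (X j)) = b i) \<and>
       (\<forall>i\<in>{m1<..m}. b i \<le> (\<Sum>j<N. t j * peval (a i) (X j))) \<and>
       (\<Sum>j<N. t j * peval f (X j)) \<le> dual_objective b m \<theta>opt"
    proof (rule finitely_atomic_primal_solution[OF m1 _ \<theta>_sign _ compact_K])
      show "\<forall>x\<in>K. 0 \<le> peval (residual f a m \<theta>opt) x" using F_nonneg by (simp only: F_def) blast
      show "dual_objective b m \<theta>' \<le> dual_objective b m \<theta>opt"
        if "\<forall>x\<in>K. 0 \<le> peval (residual f a m \<theta>') x" "\<forall>i\<in>{m1<..m}. 0 \<le> \<theta>' i" for \<theta>'
        using \<theta>_max[of \<theta>'] that unfolding D_feasible_iff vs_def by blast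
      show "\<forall>x\<in>K. 0 < peval (residual f a m \<theta>0) x"
        using interior_nonneg_imp_positive[OF \<theta>0(2)] by blast
      show "\<forall>i\<in>{m1<..m}. 0 \<le> \<theta>0 i" using \<theta>0(1) unfolding D_feasible_iff by blast
    qed
    then show ?thesis unfolding vs_def[symmetric] using that by blast
  qed
  have deg_d0: "f \<in> polys (int (2 * k))" "\<And>i. i \<in> {1..m} \<Longrightarrow> a i \<in> polys (int (2 * k))" if "D0 \<le> k" for k
  proof -
    have *: "half_deg f \<le> D0" "\<And>i. i \<in> {1..m} \<Longrightarrow> half_deg (a i) \<le> D0"
      unfolding D0_def d0_def by (intro Max_ge; simp)+
    show "f \<in> polys (int (2 * k))"
      using deg_le_of_half_deg[of f k] *(1) that by (intro polys_mono[OF in_polys_deg]) auto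
    show "a i \<in> polys (int (2 * k))" if "i \<in> {1..m}" for i
      using deg_le_of_half_deg[of "a i" k] *(2)[OF that] \<open>D0 \<le> k\<close>
      by (intro polys_mono[OF in_polys_deg]) auto
  qed
  have atomic_constraints: "linear_constraints a b m1 m (atomic_tms e N t X)"
    if "\<And>i. i \<in> {1..m} \<Longrightarrow> a i \<in> polys (int e)" for e
    using tX(3,4) that m1 by (auto simp: linear_constraints_def pairing_atomic_tms)
  have atomic_Pk: "atomic_tms (2 * k) N t X \<in> Pk_feasible a b m1 m E I c k"
    "pairing f (atomic_tms (2 * k) N t X) \<le> vs" if "D0 \<le> k" for k
    unfolding Pk_feasible_iff
    using deg_d0[OF that] tX(1,2,5)
    by (auto simp: pairing_atomic_tms K_def intro!: atomic_constraints localizing_conditions_atomic_tms)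
      (simp add: tms_def atomic_tms_def tms_restrict_def)
  have Pk_ge: "vs \<le> pairing f w" if "k1 \<le> k" "w \<in> Pk_feasible a b m1 m E I c k" for k w
    using k1(2)[OF that(1), of w] that(2) pairing_residual_le[OF _ \<theta>_sign m1, of a b w f]
    by (simp add: Pk_feasible_iff F_def vs_def)
  have Pk_value: "inf_value (pairing f) (Pk_feasible a b m1 m E I c k) = ereal vs"
    if "D0 \<le> k" "k1 \<le> k" for k
    using atomic_Pk[OF that(1)] Pk_ge[OF that(2)] by (intro inf_value_eq)
  have D_value: "sup_value (dual_objective b m) (D_feasible f a m1 m d K) = ereal vs"
    using \<theta>_feas \<theta>_max by (intro sup_value_eq[of \<theta>opt]) (auto simp: vs_def)
  have P_value: "inf_value (pairing f) (P_feasible a b m1 m d K) = ereal vs"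
  proof (rule inf_value_eq)
    show "atomic_tms d N t X \<in> P_feasible a b m1 m d K"
      using atomic_in_moment_cone[OF compact_imp_closed[OF compact_K], of N t X d] tX(1,2)
        atomic_constraints[of d] ad by (auto simp: P_feasible_def atomic_tms_def)
    show "pairing f (atomic_tms d N t X) \<le> vs" using tX(5) fd by (simp add: pairing_atomic_tms)
    fix y assume y: "y \<in> P_feasible a b m1 m d K"
    have "0 \<le> pairing F y"
      using y F_nonneg polys_residual[OF fd ad]
      by (intro pairing_moment_cone_nonneg[of F d K]) (auto simp: P_feasible_def F_def)
    then show "vs \<le> pairing f y"
      using pairing_residual_le[OF _ \<theta>_sign m1, of a b y f] y
      by (simp add: P_feasible_def F_def vs_def)
  qed
  have Dk_value: "sup_value (dual_objective b m) (Dk_feasible f a m1 m E I c k) = ereal vs"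
    if "k1 \<le> k" for k
  proof (rule sup_value_eq)
    show "\<theta>opt \<in> Dk_feasible f a m1 m E I c k"
      using k1(1)[OF that] \<theta>_sign by (simp add: Dk_feasible_def F_def)
    show "vs \<le> dual_objective b m \<theta>opt" by (simp add: vs_def)
    fix \<theta> assume "\<theta> \<in> Dk_feasible f a m1 m E I c k"
    then obtain p q where pq: "p \<in> ideal_trunc E c (2 * k)" "q \<in> qmodule_trunc I c (2 * k)"
      "residual f a m \<theta> = p + q" and \<theta>: "\<forall>i\<in>{m1<..m}. 0 \<le> \<theta> i"
      by (auto simp: Dk_feasible_def)
    have "residual f a m \<theta> \<in> M"
      unfolding M_def pq(3) by (rule truncated_in_ideal_qmodule[OF pq(1,2)])
    then have "\<forall>x\<in>K. 0 \<le> peval (residual f a m \<theta>) x"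
      using K_pos unfolding positivity_set_def by blast
    then show "dual_objective b m \<theta> \<le> vs" using \<theta> by (intro \<theta>_max) (simp only: D_feasible_iff)
  qed

  have flat: "\<exists>k2. \<forall>k\<ge>k2. \<forall>w. is_minimizer (pairing f) (Pk_feasible a b m1 m E I c k) w \<longrightarrow>
      flat_truncation D0 DK k w"
  proof -
    obtain L where L: "\<And>v w. v \<in> Z \<Longrightarrow> w \<in> Z \<Longrightarrow> peval (L v) w = (if v = w then 1 else 0)"
      using lagrange_polys[OF finite_Z] by blast
    \<comment> \<open>The highest order reached by \<open>card Z + 1\<close> steps of length
      \<open>DK\<close> that start at \<open>D0 - DK\<close>.\<close>
    define T where "T = D0 + card Z * DK"
    \<comment> \<open>Modulo this remainder a monomial is its Lagrange interpolant on
      \<open>Z\<close>.\<close>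
    define r :: "'n expo \<Rightarrow> 'n rpoly" where
      "r \<alpha> = monomial \<alpha> - (\<Sum>v\<in>Z. expo_eval \<alpha> v *\<^sub>R L v)" for \<alpha>
    have r_Z: "peval (r \<alpha>) v = 0" if "v \<in> Z" for \<alpha> v
    proof -
      have "(\<Sum>x\<in>Z. expo_eval \<alpha> x * peval (L x) v) = (\<Sum>x\<in>Z. if x = v then expo_eval \<alpha> v else 0)"
        using L[OF _ that] by (intro sum.cong) auto
      then show ?thesis using finite_Z that by (simp add: r_def)
    qed
    have "\<forall>\<alpha>. \<exists>\<eta>k. 0 < fst \<eta>k \<and> (\<forall>k\<ge>snd \<eta>k. \<forall>w. localizing_conditions E I c k w \<longrightarrow>
        0 \<le> pairing (F - fst \<eta>k *\<^sub>R (r \<alpha>)\<^sup>2) w)"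
    proof
      fix \<alpha>
      obtain \<eta> where \<eta>: "0 < \<eta>" "F - \<eta> *\<^sub>R (r \<alpha>)\<^sup>2 \<in> M" using cert[of "r \<alpha>"] r_Z by blast
      obtain k0 where "\<forall>k\<ge>k0. \<forall>w. localizing_conditions E I c k w \<longrightarrow> 0 \<le> pairing (F - \<eta> *\<^sub>R (r \<alpha>)\<^sup>2) w"
        using truncated_certificate[OF fin \<eta>(2)[unfolded M_def]] by blast
      then show "\<exists>\<eta>k. 0 < fst \<eta>k \<and> (\<forall>k\<ge>snd \<eta>k. \<forall>w. localizing_conditions E I c k w \<longrightarrow>
        0 \<le> pairing (F - fst \<eta>k *\<^sub>R (r \<alpha>)\<^sup>2) w)"
        using \<eta>(1) by (intro exI[of _ "(\<eta>, k0)"]) simp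
    qed
    from choice[OF this] obtain \<eta>k where \<eta>k: "\<And>\<alpha>. 0 < fst (\<eta>k \<alpha>)"
      "\<And>\<alpha> k w. snd (\<eta>k \<alpha>) \<le> k \<Longrightarrow> localizing_conditions E I c k w \<Longrightarrow>
        0 \<le> pairing (F - fst (\<eta>k \<alpha>) *\<^sub>R (r \<alpha>)\<^sup>2) w" by blast
    \<comment> \<open>Only the finitely many exponents in \<open>expos T\<close> need certificates,
      so one threshold covers them. The degrees are included because \<open>r \<alpha>\<close>
      itself must be indexed by the moment matrix of order \<open>k\<close>.\<close>
    define k2 where "k2 = k1 + D0 + T + (\<Sum>\<alpha>\<in>expos T. snd (\<eta>k \<alpha>) + deg (r \<alpha>))"
    have k2: "snd (\<eta>k \<alpha>) \<le> k2" "deg (r \<alpha>) \<le> k2" if "\<alpha> \<in> expos T" for \<alpha>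
      using member_le_sum[of \<alpha> "expos T" "\<lambda>\<alpha>. snd (\<eta>k \<alpha>) + deg (r \<alpha>)"] that
      by (simp_all add: k2_def)
    show ?thesis
    proof (intro exI[of _ k2] allI impI)
      fix k w assume k: "k2 \<le> k" and w: "is_minimizer (pairing f) (Pk_feasible a b m1 m E I c k) w"
      have k': "k1 \<le> k" "D0 \<le> k" "T \<le> k" using k by (auto simp: k2_def)
      have w_feas: "w \<in> Pk_feasible a b m1 m E I c k" using w by (simp add: is_minimizer_def)
      then have w_loc: "localizing_conditions E I c k w" and w_lin: "linear_constraints a b m1 m w"
        by (auto simp: Pk_feasible_iff)
      \<comment> \<open>Minimality of \<open>w\<close> enters through comparison with the atomic
        sequence.\<close>
      have "pairing f w \<le> vs"
        using w atomic_Pk[OF k'(2)] by (auto simp: is_minimizer_def intro: order_trans)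
      then have F_le: "pairing F w \<le> 0"
        using pairing_residual_le[OF w_lin \<theta>_sign m1, of f] by (simp add: F_def vs_def)
      have psd: "psd_on (loc_matrix_index k (1::'n rpoly)) (loc_matrix 1 w)"
        using w_loc by (simp add: localizing_conditions_def)
      have kernel: "pairing (r \<alpha> * monomial \<beta>) w = 0" if \<alpha>: "\<alpha> \<in> expos T" and \<beta>: "\<beta> \<in> expos T" for \<alpha> \<beta>
      proof (rule pairing_eq_zero_of_square[OF psd])
        show "r \<alpha> \<in> polys (int k)" using k2(2)[OF \<alpha>] k by (intro polys_mono[OF in_polys_deg]) auto
        show "monomial \<beta> \<in> polys (int k)" using \<beta> k' by (intro polys_monomial) (auto simp: expos_def)
        have "0 \<le> pairing (F - fst (\<eta>k \<alpha>) *\<^sub>R (r \<alpha>)\<^sup>2) w"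
          using k2(1)[OF \<alpha>] k by (intro \<eta>k(2)[OF _ w_loc]) auto
        also have "F - fst (\<eta>k \<alpha>) *\<^sub>R (r \<alpha>)\<^sup>2 = F + (- fst (\<eta>k \<alpha>)) *\<^sub>R (r \<alpha>)\<^sup>2" by simp
        finally have "fst (\<eta>k \<alpha>) * pairing ((r \<alpha>)\<^sup>2) w \<le> 0"
          unfolding pairing_add pairing_scaleR using F_le by simp
        then show "pairing ((r \<alpha>)\<^sup>2) w \<le> 0" using \<eta>k(1)[of \<alpha>] by (simp add: mult_le_0_iff)
      qed
      \<comment> \<open>The rows that belong to the Lagrange polynomials. By \<open>kernel\<close>
        the row of an exponent is their combination, with the values of its monomial on
        \<open>Z\<close> as coefficients.\<close>
      define R where "R s v = (\<Sum>\<beta>\<in>expos s. Poly_Mapping.single \<beta> (pairing (L v * monomial \<beta>) w))" for s v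
      have rank_le: "dim (moment_row s w ` expos s) \<le> card Z" if s: "s \<le> T" for s
      proof -
        have sT: "\<alpha> \<in> expos T" if "\<alpha> \<in> expos s" for \<alpha> :: "'n expo"
          using that s by (simp add: expos_def)
        have entry: "w (\<alpha> + \<beta>) = (\<Sum>v\<in>Z. expo_eval \<alpha> v * pairing (L v * monomial \<beta>) w)"
          if "\<alpha> \<in> expos s" "\<beta> \<in> expos s" for \<alpha> \<beta>
        proof -
          have "monomial (\<alpha> + \<beta>) = r \<alpha> * monomial \<beta> + (\<Sum>v\<in>Z. expo_eval \<alpha> v *\<^sub>R (L v * monomial \<beta>))"
            by (simp add: r_def monomial_add left_diff_distrib sum_distrib_right)
          then have "pairing (monomial (\<alpha> + \<beta>)) w = (\<Sum>v\<in>Z. expo_eval \<alpha> v * pairing (L v * monomial \<beta>) w)"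
            using kernel[OF sT[OF that(1)] sT[OF that(2)]]
            by (simp add: pairing_add pairing_sum pairing_scaleR)
          then show ?thesis by (simp add: monomial_def pairing_single)
        qed
        have "moment_row s w \<alpha> = (\<Sum>v\<in>Z. expo_eval \<alpha> v *\<^sub>R R s v)" if \<alpha>: "\<alpha> \<in> expos s" for \<alpha>
        proof (rule poly_mapping_eqI)
          fix \<gamma>
          have l: "lookup (\<Sum>\<beta>\<in>expos s. Poly_Mapping.single \<beta> (h \<beta>)) \<gamma> = (if \<gamma> \<in> expos s then h \<gamma> else 0)"
            for h :: "'n expo \<Rightarrow> real"
            by (simp add: lookup_sum lookup_single when_def eq_commute)
          show "lookup (moment_row s w \<alpha>) \<gamma>
              = lookup (\<Sum>v\<in>Z. expo_eval \<alpha> v *\<^sub>R R s v) \<gamma>"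
            using entry[OF \<alpha>] by (simp add: moment_row_def R_def l lookup_sum[of _ Z] lookup_scaleR)
        qed
        moreover have "(\<Sum>v\<in>Z. expo_eval \<alpha> v *\<^sub>R R s v) \<in> span (R s ` Z)" for \<alpha>
          by (intro span_sum span_scale span_base imageI)
        ultimately have "moment_row s w ` expos s \<subseteq> span (R s ` Z)" by auto
        then have "dim (moment_row s w ` expos s) \<le> card (R s ` Z)"
          using finite_Z by (intro dim_le_card) auto
        also have "\<dots> \<le> card Z" by (rule card_image_le[OF finite_Z])
        finally show ?thesis .
      qed
      have DK_D0: "DK \<le> D0" unfolding DK_def D0_def d0_def by (intro Max_ge) auto
      \<comment> \<open>The chain begins one step below \<open>D0\<close>: a flat truncation at
        order \<open>t\<close> compares \<open>t\<close> with \<open>t - DK\<close>, and only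
        \<open>t\<close> itself has to be at least \<open>D0\<close>.\<close>
      define \<rho> where "\<rho> i = dim (moment_row (D0 - DK + i * DK) w ` expos (D0 - DK + i * DK))" for i
      have "\<exists>i\<le>card Z. \<rho> i = \<rho> (Suc i)"
      proof (rule stationary_step)
        show "\<rho> i \<le> \<rho> (Suc i)" for i unfolding \<rho>_def by (rule dim_moment_rows_mono) simp
        show "\<rho> (Suc (card Z)) \<le> card Z"
          unfolding \<rho>_def using DK_D0 by (intro rank_le) (simp add: T_def)
      qed
      then obtain i where i: "i \<le> card Z" "\<rho> i = \<rho> (Suc i)" by blast
      define s where "s = D0 + i * DK"
      have s: "s - DK = D0 - DK + i * DK" "s = D0 - DK + Suc i * DK"
        using DK_D0 by (auto simp: s_def)
      have "s \<le> T" using i(1) by (simp add: s_def T_def)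
      then have "s \<in> {D0..k}" using k' by (simp add: s_def)
      moreover have "moment_rank (s - DK) (tms_restrict (2 * s) w) = moment_rank s (tms_restrict (2 * s) w)"
        using i(2) unfolding \<rho>_def s[symmetric] by (simp add: moment_rank_restrict)
      ultimately show "flat_truncation D0 DK k w" unfolding flat_truncation_def by blast
    qed
  qed
  then obtain k2 where k2: "\<And>k w. k2 \<le> k \<Longrightarrow> is_minimizer (pairing f) (Pk_feasible a b m1 m E I c k) w \<Longrightarrow>
      flat_truncation D0 DK k w" by blast
  show ?thesis
    unfolding D0_def[symmetric] DK_def[symmetric]
  proof (intro conjI)
    show "\<exists>N\<ge>D0. \<forall>k\<ge>N.
            sup_value (dual_objective b m) (Dk_feasible f a m1 m E I c k)
              = inf_value (pairing f) (Pk_feasible a b m1 m E I c k) \<and>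
            inf_value (pairing f) (Pk_feasible a b m1 m E I c k)
              = sup_value (dual_objective b m) (D_feasible f a m1 m d K) \<and>
            sup_value (dual_objective b m) (D_feasible f a m1 m d K)
              = inf_value (pairing f) (P_feasible a b m1 m d K)"
      using Pk_value Dk_value D_value P_value by (intro exI[of _ "max D0 k1"]) auto
    show "\<exists>N\<ge>D0. \<forall>k\<ge>N. \<forall>w.
            is_minimizer (pairing f) (Pk_feasible a b m1 m E I c k) w \<longrightarrow> flat_truncation D0 DK k w"
      using k2 by (intro exI[of _ "max D0 k2"]) auto
  qed
qed

end
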